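(* Let $\mathcal F=\{2K_2,C_4,C_5\}$. The following statements hold. (i) The class $\operatorname{Forb}(\mathcal F)$, which is the class of split graphs, is generalized spectrally closed. (ii) For no integer $\ell\ge 5$ does there exist a walk-realizable $\mathcal F$-supporter of order $\ell$.
   Context: All graphs are finite, simple, and nonempty (at least one vertex). $K_r$ and $C_r$ denote the complete graph and the cycle on $r$ vertices, and $2K_2=K_2\sqcup K_2$. $\overline G$ is the complement of $G$, $A(G)$ its adjacency matrix, and $G[U]$ the subgraph induced by $U\subseteq V(G)$. For a family $\mathcal F$ of graphs, $\operatorname{Forb}(\mathcal F)$ is the class of graphs containing no member of $\mathcal F$ as an induced subgraph. A graph is split if its vertex set is the disjoint union of a clique and an independent set (either possibly empty); by a theorem of Földes and Hammer, the class of split graphs equals $\operatorname{Forb}(\{2K_2,C_4,C_5\})$. Two graphs are generalized cospectral if their adjacency matrices are cospectral (same characteristic polynomial) and the adjacency matrices of their complements are cospectral. A graph class $\mathcal C$ is generalized spectrally closed if every graph generalized cospectral with a member of $\mathcal C$ also belongs to $\mathcal C$. For a nonempty binary word $\beta=(\beta_1,\ldots,\beta_k)\in\{0,1\}^k$ (of length $|\beta|=k$), put $M_1(G):=A(G)$, $M_0(G):=A(\overline G)$ and $n_\beta(G):=\operatorname{tr}(M_{\beta_1}(G)\cdots M_{\beta_k}(G))$. For $\ell\ge1$ let $\mathcal U_{\le \ell}$ be the set of isomorphism classes of nonempty graphs on at most $\ell$ vertices, and let $\operatorname{ind}(H,G):=|\{U\subseteq V(G):G[U]\cong H\}|$. For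 $\ell\ge5$, an $\mathcal F$-supporter of order $\ell$ is a graph parameter of the form $\Phi(G)=\sum_{H\in\mathcal U_{\le\ell}}d_H\operatorname{ind}(H,G)$ with real coefficients satisfying $d_H\ge0$ for all $H$, $d_F>0$ for every $F\in\mathcal F$, and $d_H=0$ whenever $H\in\operatorname{Forb}(\mathcal F)$. It is walk-realizable if it is (as a function on graphs) a real linear combination of the parameters $n_\beta$ with $1\le|\beta|\le\ell$. *)

theory Defs
  imports
    "Jordan_Normal_Form.Char_Poly"
    "Graph_Theory.Pair_Digraph"
    "Graph_Theory.Digraph_Component"
    "Graph_Theory.Digraph_Isomorphism"
begin

text \<open>
  A finite simple graph is a finite, symmetric, loop-free pair digraph
  (\<open>pair_graph\<close>), where an edge $uv$ is the pair of arcs $(u,v)$ and $(v,u)$.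
  The vertices form an arbitrary finite nonempty set of naturals. Every finite graph is isomorphic
  to such a graph and all notions below are invariant under isomorphism. Having one ambient type
  makes graph classes into sets and graph parameters into functions.
\<close>

type_synonym ngraph = "nat pair_pre_digraph"

definition sgraph :: "ngraph \<Rightarrow> bool" where
  "sgraph G \<longleftrightarrow> pair_graph G \<and> pverts G \<noteq> {}"

definition graph_iso :: "ngraph \<Rightarrow> ngraph \<Rightarrow> bool" (infix \<open>\<cong>\<^sub>g\<close> 50) where
  "G \<cong>\<^sub>g H \<longleftrightarrow> digraph_iso (with_proj G) (with_proj H)"

definition induced :: "ngraph \<Rightarrow> nat set \<Rightarrow> ngraph" where
  "induced G U = \<lparr> pverts = U, parcs = parcs G \<inter> U \<times> U \<rparr>"

definition complement :: "ngraph \<Rightarrow> ngraph" where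
  "complement G =
    \<lparr> pverts = pverts G,
      parcs = {(u, v). u \<in> pverts G \<and> v \<in> pverts G \<and> u \<noteq> v \<and> (u, v) \<notin> parcs G} \<rparr>"

definition two_K2 :: ngraph where
  "two_K2 = \<lparr> pverts = {0, 1, 2, 3}, parcs = {(0, 1), (1, 0), (2, 3), (3, 2)} \<rparr>"

definition cycle_graph :: "nat \<Rightarrow> ngraph" where
  "cycle_graph r =
    \<lparr> pverts = {..<r},
      parcs = {(i, j). i < r \<and> j < r \<and> (j = (i + 1) mod r \<or> i = (j + 1) mod r)} \<rparr>"

definition Forb :: "ngraph set \<Rightarrow> ngraph set" where
  "Forb \<F> = {G. sgraph G \<and> \<not> (\<exists>F\<in>\<F>. \<exists>U \<subseteq> pverts G. induced G U \<cong>\<^sub>g F)}"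

definition split_obstructions :: "ngraph set" where
  "split_obstructions = {two_K2, cycle_graph 4, cycle_graph 5}"

definition split_graph :: "ngraph \<Rightarrow> bool" where
  "split_graph G \<longleftrightarrow> sgraph G \<and>
    (\<exists>K S. pverts G = K \<union> S \<and> K \<inter> S = {} \<and>
      (\<forall>u\<in>K. \<forall>v\<in>K. u \<noteq> v \<longrightarrow> (u, v) \<in> parcs G) \<and>
      (\<forall>u\<in>S. \<forall>v\<in>S. (u, v) \<notin> parcs G))"

text \<open>
  Rows and columns follow the increasing order of the vertices, so a graph and its complement use
  the same indexing.
\<close>

definition adj_mat :: "ngraph \<Rightarrow> real mat" where
  "adj_mat G = (let vs = sorted_list_of_set (pverts G); n = card (pverts G) in
    mat n n (\<lambda>(i, j). if (vs ! i, vs ! j) \<in> parcs G then 1 else 0))"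

definition cospectral :: "ngraph \<Rightarrow> ngraph \<Rightarrow> bool" where
  "cospectral G H \<longleftrightarrow> char_poly (adj_mat G) = char_poly (adj_mat H)"

definition generalized_cospectral :: "ngraph \<Rightarrow> ngraph \<Rightarrow> bool" where
  "generalized_cospectral G H \<longleftrightarrow>
    cospectral G H \<and> cospectral (complement G) (complement H)"

definition generalized_spectrally_closed :: "ngraph set \<Rightarrow> bool" where
  "generalized_spectrally_closed \<C> \<longleftrightarrow>
    (\<forall>G\<in>\<C>. \<forall>H. sgraph H \<and> generalized_cospectral H G \<longrightarrow> H \<in> \<C>)"

definition mat_trace :: "real mat \<Rightarrow> real" where
  "mat_trace A = (\<Sum>i<dim_row A. A $$ (i, i))"

text \<open>Binary words are lists of Booleans, \<open>True\<close> being the letter 1.\<close>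

definition letter_mat :: "ngraph \<Rightarrow> bool \<Rightarrow> real mat" where
  "letter_mat G b = (if b then adj_mat G else adj_mat (complement G))"

definition walk_count :: "bool list \<Rightarrow> ngraph \<Rightarrow> real" where
  "walk_count \<beta> G =
    mat_trace (foldr (\<lambda>b P. letter_mat G b * P) \<beta> (1\<^sub>m (card (pverts G))))"

definition iso_class :: "ngraph \<Rightarrow> ngraph set" where
  "iso_class H = {H'. sgraph H' \<and> H \<cong>\<^sub>g H'}"

definition iso_classes_upto :: "nat \<Rightarrow> ngraph set set" where
  "iso_classes_upto l = iso_class ` {H. sgraph H \<and> card (pverts H) \<le> l}"

definition ind :: "ngraph \<Rightarrow> ngraph \<Rightarrow> nat" where
  "ind H G = card {U. U \<subseteq> pverts G \<and> induced G U \<cong>\<^sub>g H}"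

text \<open>
  The coefficients are indexed by isomorphism classes; the value of \<open>ind\<close> does not depend
  on the representative chosen by \<open>SOME\<close>.
\<close>

definition supporter :: "ngraph set \<Rightarrow> nat \<Rightarrow> (ngraph \<Rightarrow> real) \<Rightarrow> bool" where
  "supporter \<F> l \<Phi> \<longleftrightarrow>
    (\<exists>d :: ngraph set \<Rightarrow> real.
      (\<forall>G. sgraph G \<longrightarrow>
        \<Phi> G = (\<Sum>c\<in>iso_classes_upto l. d c * real (ind (SOME H. H \<in> c) G))) \<and>
      (\<forall>c\<in>iso_classes_upto l. d c \<ge> 0) \<and>
      (\<forall>F\<in>\<F>. d (iso_class F) > 0) \<and>
      (\<forall>H. sgraph H \<and> card (pverts H) \<le> l \<and> H \<in> Forb \<F> \<longrightarrow> d (iso_class H) = 0))"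

definition walk_realizable :: "nat \<Rightarrow> (ngraph \<Rightarrow> real) \<Rightarrow> bool" where
  "walk_realizable l \<Phi> \<longleftrightarrow>
    (\<exists>a :: bool list \<Rightarrow> real. \<forall>G. sgraph G \<longrightarrow>
      \<Phi> G = (\<Sum>\<beta> | 1 \<le> length \<beta> \<and> length \<beta> \<le> l. a \<beta> * walk_count \<beta> G))"

lemma sgraph_arcs:
  assumes "sgraph G"
  shows "finite (pverts G)" "parcs G \<subseteq> pverts G \<times> pverts G"
    "(u, v) \<in> parcs G \<Longrightarrow> (v, u) \<in> parcs G" "(u, u) \<notin> parcs G"
proof -
  interpret pair_graph G using assms by (simp add: sgraph_def)
  show "finite (pverts G)" by (rule pair_finite_verts)
  show "parcs G \<subseteq> pverts G \<times> pverts G" by (auto dest: in_arcsD1 in_arcsD2)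
  show "(u, v) \<in> parcs G \<Longrightarrow> (v, u) \<in> parcs G"
    using pair_sym_arcs by (auto simp: symmetric_def sym_def)
  show "(u, u) \<notin> parcs G" using pair_no_loops by fastforce
qed

lemma sgraphI:
  assumes "finite (pverts G)" "pverts G \<noteq> {}" "parcs G \<subseteq> pverts G \<times> pverts G"
    "\<And>u v. (u, v) \<in> parcs G \<Longrightarrow> (v, u) \<in> parcs G" "\<And>u. (u, u) \<notin> parcs G"
  shows "sgraph G"
proof -
  have "finite (parcs G)" using assms(1,3) by (meson finite_SigmaI finite_subset)
  then have "pair_graph G"
    using assms by unfold_locales (auto simp: symmetric_def sym_def)
  then show ?thesis using assms(2) by (simp add: sgraph_def)
qed

lemma sgraph_two_K2: "sgraph two_K2"
  by (rule sgraphI) (auto simp: two_K2_def)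

lemma sgraph_cycle_graph: "r \<ge> 3 \<Longrightarrow> sgraph (cycle_graph r)"
  by (rule sgraphI) (auto simp: cycle_graph_def lessThan_empty_iff mod_Suc split: if_splits)

lemma sgraph_complement: "sgraph G \<Longrightarrow> sgraph (complement G)"
  using sgraph_arcs[of G]
  by (intro sgraphI) (auto simp: complement_def sgraph_def)

lemma sgraph_induced:
  "sgraph G \<Longrightarrow> U \<subseteq> pverts G \<Longrightarrow> U \<noteq> {} \<Longrightarrow> sgraph (induced G U)"
  using sgraph_arcs[of G]
  by (intro sgraphI) (auto simp: induced_def intro: finite_subset)

lemma with_proj_induced:
  "U \<subseteq> pverts G \<Longrightarrow> with_proj (induced G U) = with_proj G \<restriction> U"
  by (auto simp: with_proj_def induced_def induce_subgraph_def)

lemma graph_iso_iff: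
  assumes "parcs G \<subseteq> pverts G \<times> pverts G"
  shows "G \<cong>\<^sub>g H \<longleftrightarrow>
    (\<exists>f. bij_betw f (pverts G) (pverts H) \<and> parcs H = (\<lambda>(u, v). (f u, f v)) ` parcs G)"
proof
  assume "G \<cong>\<^sub>g H"
  then obtain h where h: "pre_digraph.digraph_isomorphism (with_proj G) h"
      "with_proj H = app_iso h (with_proj G)"
    by (auto simp: graph_iso_def digraph_iso_def)
  have eqs: "pverts H = iso_verts h ` pverts G" "parcs H = iso_arcs h ` parcs G"
    "fst = iso_tail h" "snd = iso_head h"
    using h(2) by (auto simp: with_proj_def app_iso_def)
  have "iso_arcs h (u, v) = (iso_verts h u, iso_verts h v)" if "(u, v) \<in> parcs G" for u v
    using h(1) that eqs(3,4) unfolding pre_digraph.digraph_isomorphism_def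
    by (metis fst_conv prod.collapse snd_conv with_proj_simps(2,4,5))
  then have "parcs H = (\<lambda>(u, v). (iso_verts h u, iso_verts h v)) ` parcs G"
    unfolding eqs(2) by (intro image_cong) auto
  moreover have "bij_betw (iso_verts h) (pverts G) (pverts H)"
    using h(1) eqs(1) unfolding pre_digraph.digraph_isomorphism_def bij_betw_def by simp
  ultimately show "\<exists>f. bij_betw f (pverts G) (pverts H) \<and>
      parcs H = (\<lambda>(u, v). (f u, f v)) ` parcs G"
    by blast
next
  assume "\<exists>f. bij_betw f (pverts G) (pverts H) \<and> parcs H = (\<lambda>(u, v). (f u, f v)) ` parcs G"
  then obtain f where f: "bij_betw f (pverts G) (pverts H)"
    "parcs H = (\<lambda>(u, v). (f u, f v)) ` parcs G" by blast
  let ?h = "\<lparr> iso_verts = f, iso_arcs = (\<lambda>(u, v). (f u, f v)), iso_head = snd, iso_tail = fst \<rparr>"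
  have inj: "inj_on f (pverts G)" using f(1) by (simp add: bij_betw_def)
  have wf: "wf_digraph (with_proj G)" using assms by unfold_locales auto
  have "inj_on (\<lambda>(u, v). (f u, f v)) (parcs G)"
    using assms inj by (auto simp: inj_on_def)
  then have "pre_digraph.digraph_isomorphism (with_proj G) ?h"
    using inj wf by (auto simp: pre_digraph.digraph_isomorphism_def)
  moreover have "with_proj H = app_iso ?h (with_proj G)"
    using f by (auto simp: with_proj_def app_iso_def bij_betw_def)
  ultimately show "G \<cong>\<^sub>g H" unfolding graph_iso_def digraph_iso_def by blast
qed

lemma graph_iso_refl: "sgraph G \<Longrightarrow> G \<cong>\<^sub>g G"
  using sgraph_arcs(2)[of G] by (subst graph_iso_iff) (auto intro!: exI[of _ id])

lemma graph_iso_sym: "sgraph G \<Longrightarrow> G \<cong>\<^sub>g H \<Longrightarrow> H \<cong>\<^sub>g G"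
  unfolding graph_iso_def
  by (rule digraph_iso_swap)
    (auto simp: wf_digraph_def dest: sgraph_arcs(2))

lemma graph_iso_trans: "G \<cong>\<^sub>g H \<Longrightarrow> H \<cong>\<^sub>g K \<Longrightarrow> G \<cong>\<^sub>g K"
  unfolding graph_iso_def by (rule digraph_iso_trans)

lemma iso_class_eq_iff:
  "sgraph G \<Longrightarrow> sgraph H \<Longrightarrow> iso_class G = iso_class H \<longleftrightarrow> G \<cong>\<^sub>g H"
  unfolding iso_class_def set_eq_iff mem_Collect_eq
  by (meson graph_iso_refl graph_iso_sym graph_iso_trans)

lemma finite_iso_classes_upto: "finite (iso_classes_upto l)"
proof -
  let ?R = "(\<lambda>(V, E). \<lparr> pverts = V, parcs = E \<rparr> :: ngraph) ` (Pow {..<l} \<times> Pow ({..<l} \<times> {..<l}))"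
  have "iso_classes_upto l \<subseteq> iso_class ` ?R"
  proof
    fix c assume "c \<in> iso_classes_upto l"
    then obtain H where H: "sgraph H" "card (pverts H) \<le> l" "c = iso_class H"
      by (auto simp: iso_classes_upto_def)
    obtain f where f: "bij_betw f (pverts H) {0..<card (pverts H)}"
      using ex_bij_betw_finite_nat sgraph_arcs(1)[OF H(1)] by blast
    let ?H = "\<lparr> pverts = {0..<card (pverts H)}, parcs = (\<lambda>(u, v). (f u, f v)) ` parcs H \<rparr>"
    have iso: "H \<cong>\<^sub>g ?H"
      using f by (subst graph_iso_iff[OF sgraph_arcs(2)[OF H(1)]]) auto
    have "iso_class H = iso_class ?H"
      unfolding iso_class_def using iso graph_iso_sym[OF H(1)] graph_iso_trans by blast
    moreover have "?H \<in> ?R"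
    proof -
      have "f u < l" if "u \<in> pverts H" for u
        using bij_betwE[OF f] that H(2) by auto
      then have "(\<lambda>(u, v). (f u, f v)) ` parcs H \<subseteq> {..<l} \<times> {..<l}"
        using sgraph_arcs(2)[OF H(1)] by auto
      then show ?thesis using H(2) by (intro image_eqI[of _ _ "(_, _)"]) auto
    qed
    ultimately show "c \<in> iso_class ` ?R" using H(3) by blast
  qed
  then show ?thesis by (rule finite_subset) auto
qed

lemma ind_cong_iso:
  assumes "sgraph H" "H \<cong>\<^sub>g H'"
  shows "ind H G = ind H' G"
  unfolding ind_def using graph_iso_trans assms(2) graph_iso_sym[OF assms]
  by (intro arg_cong[where f = card] Collect_cong) blast

end

theory Submission
  imports Defs "HOL-Library.Countable"
begin

text \<open>
  The theorem of Foeldes and Hammer is proved by an extremal choice of a maximum clique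
  (\<open>Forb_imp_split\<close>).

  \<^bold>\<open>Why split graphs are generalized spectrally closed.\<close> Let \<open>A\<close> and \<open>C\<close> be the adjacency matrices of
  a graph and its complement. Colouring the vertices by clique and independent set is an instance of
  2-satisfiability: an edge excludes two independent ends, a non-edge excludes two clique ends. The
  implications are followed by walks that alternate between edges and non-edges, and these are
  counted by \<open>A C\<close>. In a split graph, \<open>A C\<close> is block triangular, and its two diagonal blocks have the
  same nonzero spectrum, so its characteristic polynomial is a power of \<open>x\<close> times a square; it is
  nonnegative on the positive reals (\<open>split_graph_alternating_poly_nonneg\<close>). In any other graph the
  vertices that are forced to both sides form a core on which alternating walks are irreducible
  (\<open>minimal_core_irreducible\<close>). The core contributes one more factor, and the Perron root is a simple
  zero of it, where the sign changes
  (\<open>char_poly_neg_below_perron_root\<close>); the other factors again have one sign. Finally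
  \<open>A C = A (J - I - A)\<close> is a polynomial in \<open>A\<close> up to a matrix of rank one, and this is why its
  characteristic polynomial is a function of those of \<open>A\<close> and \<open>C\<close>
  (\<open>char_poly_product_complement\<close>).

  \<^bold>\<open>Why no supporter is walk-realizable.\<close> A supporter vanishes on all split graphs and is positive on
  \<open>2K\<^sub>2\<close>, so it suffices that a linear combination of walk counts of bounded length that vanishes on
  split graphs vanishes on every graph (\<open>walk_polynomial_zero_on_split_graphs\<close>). Every walk
  count is a polynomial in the numbers \<open>tr A\<^sup>j\<close> and \<open>1\<^sup>T A\<^sup>j 1\<close>. For a split graph with bipartite
  adjacency matrix \<open>B\<close> between clique and independent set these are polynomials in the moments
  \<open>1\<^sup>T (B B\<^sup>T)\<^sup>j 1\<close>, \<open>1\<^sup>T (B\<^sup>T B)\<^sup>j 1\<close>, \<open>1\<^sup>T (B B\<^sup>T)\<^sup>j B 1\<close> and \<open>tr (B B\<^sup>T)\<^sup>j\<close>, with a triangular dependence: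
  each new number brings in one new moment with a nonzero constant coefficient. Hence real moments can
  be found that reproduce the numbers of an arbitrary graph (\<open>split_moments_realize_walks\<close>). When \<open>B\<close> is a
  direct sum of copies of fixed matrices, the moments are linear in the multiplicities, and
  finitely many prescribed moments are reached by real multiplicities
  (\<open>real_moments_surjective\<close>). A polynomial in the multiplicities that vanishes at all positive
  integers vanishes at these real points too. The square root that distinguishes split graphs above
  is thus invisible to walks of bounded length.
\<close>

section \<open>Induced subgraphs and the theorem of Foeldes and Hammer\<close>

abbreviation adj :: "ngraph \<Rightarrow> nat \<Rightarrow> nat \<Rightarrow> bool" where
  "adj G u v \<equiv> (u, v) \<in> parcs G"

text \<open>
  Copies of a graph as maps rather than vertex sets: embeddings compose, and a copy can be given by
  naming its vertices.
\<close>

definition induced_embedding :: "(nat \<Rightarrow> nat) \<Rightarrow> ngraph \<Rightarrow> ngraph \<Rightarrow> bool" where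
  "induced_embedding g F G \<longleftrightarrow> inj_on g (pverts F) \<and> g ` pverts F \<subseteq> pverts G \<and>
     (\<forall>i\<in>pverts F. \<forall>j\<in>pverts F. adj G (g i) (g j) \<longleftrightarrow> adj F i j)"

lemma induced_copy_iff_embedding:
  assumes G: "sgraph G" and F: "sgraph F"
  shows "(\<exists>U\<subseteq>pverts G. induced G U \<cong>\<^sub>g F) \<longleftrightarrow> (\<exists>g. induced_embedding g F G)"
proof
  assume "\<exists>U\<subseteq>pverts G. induced G U \<cong>\<^sub>g F"
  then obtain U where U: "U \<subseteq> pverts G" "induced G U \<cong>\<^sub>g F" by blast
  have "parcs (induced G U) \<subseteq> pverts (induced G U) \<times> pverts (induced G U)"
    by (auto simp: induced_def)
  then obtain f where f: "bij_betw f U (pverts F)"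
    and arcs: "parcs F = (\<lambda>(u, v). (f u, f v)) ` (parcs G \<inter> U \<times> U)"
    using U(2) by (auto simp: graph_iso_iff) (auto simp: induced_def)
  let ?g = "inv_into U f"
  have g: "bij_betw ?g (pverts F) U" by (rule bij_betw_inv_into[OF f])
  have "adj G (?g i) (?g j) \<longleftrightarrow> adj F i j" if ij: "i \<in> pverts F" "j \<in> pverts F" for i j
  proof -
    have fg: "f (?g i) = i" "f (?g j) = j" using ij f bij_betw_inv_into_right by metis+
    have gU: "?g i \<in> U" "?g j \<in> U" using ij bij_betwE[OF g] by auto
    show ?thesis
    proof
      assume "adj G (?g i) (?g j)"
      then have "(?g i, ?g j) \<in> parcs G \<inter> U \<times> U" using gU by simp
      then have "(f (?g i), f (?g j)) \<in> parcs F" unfolding arcs by (rule image_eqI[rotated]) simp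
      then show "adj F i j" by (simp only: fg)
    next
      assume "adj F i j"
      then obtain u v where uv: "adj G u v" "u \<in> U" "v \<in> U" "i = f u" "j = f v"
        unfolding arcs by auto
      then have "?g i = u" "?g j = v" using f by (auto simp: bij_betw_def)
      then show "adj G (?g i) (?g j)" using uv(1) by (simp only:)
    qed
  qed
  then show "\<exists>g. induced_embedding g F G"
    using g U(1) by (intro exI[of _ ?g]) (auto simp: induced_embedding_def bij_betw_def)
next
  assume "\<exists>g. induced_embedding g F G"
  then obtain g where g: "inj_on g (pverts F)" "g ` pverts F \<subseteq> pverts G"
    and arcs: "\<And>i j. i \<in> pverts F \<Longrightarrow> j \<in> pverts F \<Longrightarrow> adj G (g i) (g j) \<longleftrightarrow> adj F i j"
    by (auto simp: induced_embedding_def)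
  have "F \<cong>\<^sub>g induced G (g ` pverts F)"
    unfolding graph_iso_iff[OF sgraph_arcs(2)[OF F]]
  proof (intro exI[of _ g] conjI)
    show "bij_betw g (pverts F) (pverts (induced G (g ` pverts F)))"
      using g(1) by (auto simp: bij_betw_def induced_def)
    show "parcs (induced G (g ` pverts F)) = (\<lambda>(u, v). (g u, g v)) ` parcs F"
    proof (intro subset_antisym subsetI)
      fix p assume "p \<in> parcs (induced G (g ` pverts F))"
      then obtain i j where ij: "p = (g i, g j)" "i \<in> pverts F" "j \<in> pverts F" "adj G (g i) (g j)"
        by (auto simp: induced_def)
      then have "adj F i j" using arcs by simp
      then show "p \<in> (\<lambda>(u, v). (g u, g v)) ` parcs F" using ij(1) by (intro image_eqI) auto
    next
      fix p assume "p \<in> (\<lambda>(u, v). (g u, g v)) ` parcs F"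
      then obtain i j where ij: "p = (g i, g j)" "adj F i j" by auto
      then have "i \<in> pverts F" "j \<in> pverts F" using sgraph_arcs(2)[OF F] by auto
      then show "p \<in> parcs (induced G (g ` pverts F))" using ij arcs by (simp add: induced_def)
    qed
  qed
  then have "induced G (g ` pverts F) \<cong>\<^sub>g F" by (rule graph_iso_sym[OF F])
  then show "\<exists>U\<subseteq>pverts G. induced G U \<cong>\<^sub>g F" using g(2) by blast
qed

lemma induced_embedding_trans:
  assumes g: "induced_embedding g F H" and h: "induced_embedding h H G"
  shows "induced_embedding (h \<circ> g) F G"
proof -
  have gi: "g i \<in> pverts H" if "i \<in> pverts F" for i
    using g that by (auto simp: induced_embedding_def)
  have "inj_on (h \<circ> g) (pverts F)"
    using g h unfolding induced_embedding_def by (metis comp_inj_on inj_on_subset)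
  moreover have "(h \<circ> g) ` pverts F \<subseteq> pverts G"
    using gi h by (auto simp: induced_embedding_def)
  ultimately show ?thesis
    using g h gi by (simp add: induced_embedding_def)
qed

lemma sgraph_split_obstruction:
  assumes "F \<in> split_obstructions"
  shows "sgraph F"
proof -
  have "F = two_K2 \<or> F = cycle_graph 4 \<or> F = cycle_graph 5"
    using assms unfolding split_obstructions_def by blast
  moreover have "sgraph (cycle_graph 4)" "sgraph (cycle_graph 5)"
    by (rule sgraph_cycle_graph, simp)+
  ultimately show ?thesis using sgraph_two_K2 by metis
qed

lemma Forb_split_obstructions_iff:
  "G \<in> Forb split_obstructions \<longleftrightarrow>
     sgraph G \<and> (\<forall>F\<in>split_obstructions. \<forall>g. \<not> induced_embedding g F G)"
  unfolding Forb_def mem_Collect_eq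
  using induced_copy_iff_embedding[OF _ sgraph_split_obstruction] by blast

lemma lessThan_4_5: "{..<4::nat} = {0, 1, 2, 3}" "{..<5::nat} = {0, 1, 2, 3, 4}"
  by (simp_all add: numeral_eq_Suc lessThan_Suc insert_commute)

lemma pverts_simps: "pverts two_K2 = {0, 1, 2, 3}" "pverts (cycle_graph 4) = {0, 1, 2, 3}"
  "pverts (cycle_graph 5) = {0, 1, 2, 3, 4}"
  unfolding two_K2_def cycle_graph_def pair_pre_digraph.select_convs lessThan_4_5
  by (rule refl)+

lemma two_K2_embedding:
  assumes G: "sgraph G" and V: "{a, b, c, d} \<subseteq> pverts G"
    and e: "adj G a b" "adj G c d"
    and ne: "\<not> adj G a c" "\<not> adj G a d" "\<not> adj G b c" "\<not> adj G b d"
  shows "\<exists>g. induced_embedding g two_K2 G"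
proof -
  note sym = sgraph_arcs(3,4)[OF G]
  have "a \<noteq> b" "c \<noteq> d" "a \<noteq> c" "a \<noteq> d" "b \<noteq> c" "b \<noteq> d" using e ne sym by metis+
  moreover have "adj G b a" "adj G d c" "\<not> adj G c a" "\<not> adj G d a" "\<not> adj G c b" "\<not> adj G d b"
    using e ne sym by metis+
  ultimately show ?thesis
    using V e ne sym(2)
    by (intro exI[of _ "\<lambda>i. [a, b, c, d] ! i"])
       (auto simp: induced_embedding_def two_K2_def numeral_2_eq_2 numeral_3_eq_3)
qed

lemma C4_embedding:
  assumes G: "sgraph G" and V: "{a, b, c, d} \<subseteq> pverts G"
    and e: "adj G a b" "adj G b c" "adj G c d" "adj G d a"
    and ne: "\<not> adj G a c" "\<not> adj G b d" "a \<noteq> c" "b \<noteq> d"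
  shows "\<exists>g. induced_embedding g (cycle_graph 4) G"
proof -
  note sym = sgraph_arcs(3,4)[OF G]
  have "a \<noteq> b" "c \<noteq> d" "a \<noteq> d" "b \<noteq> c" using e sym by metis+
  moreover have "adj G b a" "adj G c b" "adj G d c" "adj G a d" "\<not> adj G c a" "\<not> adj G d b"
    using e ne sym by metis+
  ultimately show ?thesis
    using V e ne sym(2)
    by (intro exI[of _ "\<lambda>i. [a, b, c, d] ! i"])
       (simp add: induced_embedding_def pverts_simps cycle_graph_def lessThan_4_5 inj_on_def)
qed

lemma C5_embedding:
  assumes G: "sgraph G" and V: "{a, b, c, d, x} \<subseteq> pverts G"
    and e: "adj G a b" "adj G b c" "adj G c d" "adj G d x" "adj G x a"
    and ne: "\<not> adj G a c" "\<not> adj G a d" "\<not> adj G b d" "\<not> adj G b x" "\<not> adj G c x"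
  shows "\<exists>g. induced_embedding g (cycle_graph 5) G"
proof -
  note sym = sgraph_arcs(3,4)[OF G]
  have "a \<noteq> b" "c \<noteq> d" "a \<noteq> d" "b \<noteq> c" "a \<noteq> c" "b \<noteq> d" "x \<noteq> a" "x \<noteq> b" "x \<noteq> c" "x \<noteq> d"
    using e ne sym by metis+
  moreover have "adj G b a" "adj G c b" "adj G d c" "adj G x d" "adj G a x"
    "\<not> adj G c a" "\<not> adj G d a" "\<not> adj G d b" "\<not> adj G x b" "\<not> adj G x c"
    using e ne sym by metis+
  ultimately show ?thesis
    using V e ne sym(2)
    by (intro exI[of _ "\<lambda>i. [a, b, c, d, x] ! i"])
       (simp add: induced_embedding_def pverts_simps cycle_graph_def lessThan_4_5 inj_on_def)
qed

text \<open>
  Colour the vertices of an induced copy by clique part or independent part. Every edge has an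
  endpoint in the clique and every non-edge has one in the independent set; no such colouring
  exists on any of the three obstructions.
\<close>

lemma split_imp_Forb:
  assumes "split_graph G"
  shows "G \<in> Forb split_obstructions"
proof -
  obtain K S where G: "sgraph G" and V: "pverts G = K \<union> S" "K \<inter> S = {}"
    and K: "\<And>u v. u \<in> K \<Longrightarrow> v \<in> K \<Longrightarrow> u \<noteq> v \<Longrightarrow> adj G u v"
    and S: "\<And>u v. u \<in> S \<Longrightarrow> v \<in> S \<Longrightarrow> \<not> adj G u v"
    using assms by (auto simp: split_graph_def)
  have False if F: "F \<in> split_obstructions" and g: "induced_embedding g F G" for F g
  proof -
    define c where "c i \<longleftrightarrow> g i \<in> K" for i
    have edge: "c i \<or> c j" if "i \<in> pverts F" "j \<in> pverts F" "adj F i j" for i j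
      using g that S V unfolding c_def induced_embedding_def by blast
    have non_edge: "\<not> c i \<or> \<not> c j"
      if "i \<in> pverts F" "j \<in> pverts F" "i \<noteq> j" "\<not> adj F i j" for i j
      using g that K V unfolding c_def induced_embedding_def inj_on_def by metis
    consider "F = two_K2" | "F = cycle_graph 4" | "F = cycle_graph 5"
      using F by (auto simp: split_obstructions_def)
    then show False
    proof cases
      case 1
      then show False
        using edge[of 0 1] edge[of 2 3] non_edge[of 0 2] non_edge[of 0 3] non_edge[of 1 2]
          non_edge[of 1 3]
        by (auto simp: two_K2_def)
    next
      case 2
      then show False
        using edge[of 0 1] edge[of 1 2] edge[of 2 3] edge[of 3 0] non_edge[of 0 2] non_edge[of 1 3]
        by (auto simp: cycle_graph_def)
    next
      case 3
      then show False
        using edge[of 0 1] edge[of 1 2] edge[of 2 3] edge[of 3 4] edge[of 4 0] non_edge[of 0 2]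
          non_edge[of 1 3] non_edge[of 2 4] non_edge[of 3 0] non_edge[of 4 1]
        by (auto simp: cycle_graph_def)
    qed
  qed
  then show ?thesis using G by (auto simp: Forb_split_obstructions_iff)
qed

definition clique :: "ngraph \<Rightarrow> nat set \<Rightarrow> bool" where
  "clique G K \<longleftrightarrow> K \<subseteq> pverts G \<and> (\<forall>u\<in>K. \<forall>v\<in>K. u \<noteq> v \<longrightarrow> adj G u v)"

definition arcs_outside :: "ngraph \<Rightarrow> nat set \<Rightarrow> nat" where
  "arcs_outside G K = card (parcs G \<inter> (pverts G - K) \<times> (pverts G - K))"

text \<open>
  Choose a maximum clique that leaves the fewest edges outside it. If an edge $xy$ is left, the
  non-neighbours of its ends in the clique are nested (else a \<open>C\<^sub>4\<close>), and the smaller set is a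
  single vertex $u$ (else a \<open>2K\<^sub>2\<close>). Exchanging $u$ for $x$ gives another maximum clique, so by
  the choice of the clique some outside neighbour $z$ of $u$ is not adjacent to $x$;
  the vertices $x, y, z, u$ and a second non-neighbour of $y$ then carry an obstruction.
\<close>

lemma Forb_imp_split:
  assumes "G \<in> Forb split_obstructions"
  shows "split_graph G"
proof -
  have G: "sgraph G" and free: "\<And>F g. F \<in> split_obstructions \<Longrightarrow> \<not> induced_embedding g F G"
    using assms by (auto simp: Forb_split_obstructions_iff)
  note sym = sgraph_arcs(3)[OF G] and irr = sgraph_arcs(4)[OF G] and V = sgraph_arcs(2)[OF G]
  have fin: "finite (pverts G)" by (rule sgraph_arcs(1)[OF G])
  have no2K2: "\<not> (adj G a b \<and> adj G c d \<and> \<not> adj G a c \<and> \<not> adj G a d \<and> \<not> adj G b c \<and> \<not> adj G b d)"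
    for a b c d
    using two_K2_embedding[OF G, of a b c d] free V by (auto simp: split_obstructions_def)
  have noC4: "\<not> (adj G a b \<and> adj G b c \<and> adj G c d \<and> adj G d a \<and> \<not> adj G a c \<and> \<not> adj G b d
      \<and> a \<noteq> c \<and> b \<noteq> d)" for a b c d
    using C4_embedding[OF G, of a b c d] free V by (auto simp: split_obstructions_def)
  have noC5: "\<not> (adj G a b \<and> adj G b c \<and> adj G c d \<and> adj G d x \<and> adj G x a \<and> \<not> adj G a c
      \<and> \<not> adj G a d \<and> \<not> adj G b d \<and> \<not> adj G b x \<and> \<not> adj G c x)" for a b c d x
    using C5_embedding[OF G, of a b c d x] free V by (auto simp: split_obstructions_def)
  have comm: "adj G u v \<longleftrightarrow> adj G v u" for u v using sym by metis
  have clique_insert: "clique G (insert z K)"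
    if "clique G K" "z \<in> pverts G" "\<And>u. u \<in> K \<Longrightarrow> adj G u z" for z K
    using that sym unfolding clique_def by (metis insert_iff insert_subset)
  have finK: "finite K" if "clique G K" for K
    using that fin by (auto simp: clique_def intro: finite_subset)
  have "\<exists>K. clique G K \<and> (\<forall>K'. clique G K' \<longrightarrow> card K' \<le> card K)"
  proof -
    have "clique G {}" by (simp add: clique_def)
    moreover have "\<forall>K. clique G K \<longrightarrow> card K < Suc (card (pverts G))"
      using fin by (auto simp: clique_def less_Suc_eq_le intro: card_mono)
    ultimately show ?thesis
      by (rule ex_has_greatest_nat)
  qed
  then obtain K0 where K0: "clique G K0" "\<And>K'. clique G K' \<Longrightarrow> card K' \<le> card K0" by blast
  define P where "P K \<longleftrightarrow> clique G K \<and> card K = card K0" for K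
  have "P K0" using K0 by (simp add: P_def)
  then obtain K where PK: "P K" and least: "\<And>K'. P K' \<Longrightarrow> arcs_outside G K \<le> arcs_outside G K'"
    using ex_has_least_nat[of P K0 "arcs_outside G"] by blast
  have K: "clique G K" and max: "\<And>K'. clique G K' \<Longrightarrow> card K' \<le> card K"
    using PK K0 by (auto simp: P_def)
  have KV: "K \<subseteq> pverts G" and Kadj: "\<And>u v. u \<in> K \<Longrightarrow> v \<in> K \<Longrightarrow> u \<noteq> v \<Longrightarrow> adj G u v"
    using K by (auto simp: clique_def)
  define S where "S = pverts G - K"
  have False if start: "x \<in> S" "y \<in> S" "adj G x y"
      "{u \<in> K. \<not> adj G u x} \<subseteq> {u \<in> K. \<not> adj G u y}" for x y
  proof -
    have nonnbr: "\<exists>u\<in>K. \<not> adj G u z" if "z \<in> S" for z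
    proof (rule ccontr)
      assume "\<not> ?thesis"
      then have "clique G (insert z K)"
        using that K by (intro clique_insert) (auto simp: S_def)
      then have "card (insert z K) \<le> card K" by (rule max)
      then show False using that finK[OF K] by (auto simp: S_def)
    qed
    obtain u where u: "u \<in> K" "\<not> adj G u x" using nonnbr start by blast
    then have uy: "\<not> adj G u y" using start by blast
    have uniq: "w = u" if "w \<in> K" "\<not> adj G w x" for w
    proof (rule ccontr)
      assume "w \<noteq> u"
      then have "adj G u w" using Kadj u that by auto
      moreover have "\<not> adj G w y" using that start by blast
      ultimately show False
        using no2K2[of x y u w] start(3) u(2) uy that comm[of u x] comm[of u y] comm[of w x]
          comm[of w y]
        by (simp only: simp_thms not_False_eq_True)
    qed
    let ?K = "insert x (K - {u})"
    have xu: "x \<noteq> u" "x \<notin> K" "u \<notin> S" "y \<noteq> u" "x \<noteq> y" using start u irr by (auto simp: S_def)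
    have cl: "clique G ?K"
      using K uniq start(1) by (intro clique_insert) (auto simp: clique_def S_def)
    have cardK: "card ?K = card K"
      using finK[OF K] xu u by (simp add: card_Suc_Diff1 del: card_Diff_insert)
    have "P ?K" using cl cardK PK by (simp add: P_def)
    then have le: "arcs_outside G K \<le> arcs_outside G ?K" by (rule least)
    have "\<exists>z\<in>S. adj G u z \<and> \<not> adj G x z"
    proof (rule ccontr)
      assume no: "\<not> ?thesis"
      then have nz: "\<And>z. z \<in> S \<Longrightarrow> adj G u z \<Longrightarrow> adj G x z" by blast
      \<comment> \<open>sending \<open>u\<close> to \<open>x\<close> maps the arcs left by the new clique into those left by \<open>K\<close>, missing \<open>xy\<close>\<close>
      define h where "h w = (if w = u then x else w)" for w
      let ?A = "parcs G \<inter> (pverts G - K) \<times> (pverts G - K)"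
      let ?B = "parcs G \<inter> (pverts G - ?K) \<times> (pverts G - ?K)"
      have out: "pverts G - ?K = insert u (S - {x})"
        using u xu KV by (auto simp: S_def)
      have inj: "inj_on (\<lambda>(v, w). (h v, h w)) ?B"
      proof -
        let ?O = "insert u (S - {x})"
        have "inj_on h ?O" using xu by (simp add: inj_on_def h_def)
        then have "inj_on (map_prod h h) (?O \<times> ?O)" by (rule map_prod_inj_on) fact
        then show ?thesis
          unfolding out map_prod_def by (rule inj_on_subset) (rule Int_lower2)
      qed
      have sub: "(\<lambda>(v, w). (h v, h w)) ` ?B \<subseteq> ?A - {(x, y)}"
      proof
        fix p assume "p \<in> (\<lambda>(v, w). (h v, h w)) ` ?B"
        then obtain v w where vw: "p = (h v, h w)" "adj G v w" "v \<in> insert u (S - {x})"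
          "w \<in> insert u (S - {x})" unfolding out by auto
        have hS: "h v \<in> S" "h w \<in> S" using vw start by (auto simp: h_def)
        have "adj G (h v) (h w)"
          using vw nz sym irr xu unfolding h_def by (metis insertE DiffE)
        moreover have "(h v, h w) \<noteq> (x, y)"
          using vw xu uy unfolding h_def by (auto split: if_splits)
        ultimately show "p \<in> ?A - {(x, y)}" using vw hS by (simp add: S_def)
      qed
      have finA: "finite ?A" using fin V by (meson finite_Int finite_SigmaI finite_subset)
      have "card ?B = card ((\<lambda>(v, w). (h v, h w)) ` ?B)" using card_image[OF inj] by simp
      also have "\<dots> \<le> card (?A - {(x, y)})" using sub finA by (intro card_mono) auto
      also have "\<dots> < card ?A" using start finA by (intro psubset_card_mono) (auto simp: S_def)
      finally show False using le by (simp add: arcs_outside_def)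
    qed
    then obtain z where z: "z \<in> S" "adj G u z" "\<not> adj G x z" by blast
    have zxy: "z \<noteq> x" "z \<noteq> y" using z uy u(2) by metis+
    have yz: "adj G y z"
      using no2K2[of x y u z] start(3) u(2) uy z(2,3) comm[of u x] comm[of u y]
      by (simp only: simp_thms not_False_eq_True)
    have "\<exists>w\<in>K. w \<noteq> u \<and> \<not> adj G w y"
    proof (rule ccontr)
      assume no: "\<not> ?thesis"
      then have "clique G (insert y ?K)"
        using cl start by (intro clique_insert[of ?K]) (auto simp: S_def)
      then have "card (insert y ?K) \<le> card K" by (rule max)
      moreover have "card (insert y ?K) = Suc (card ?K)"
        using finK[OF K] start xu by (intro card_insert_disjoint) (auto simp: S_def)
      ultimately show False using cardK by simp
    qed
    then obtain w where w: "w \<in> K" "w \<noteq> u" "\<not> adj G w y" by blast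
    have wx: "adj G w x" and wu: "adj G w u" using uniq w Kadj u by metis+
    have wy: "w \<noteq> y" "w \<noteq> x" using w start by (auto simp: S_def)
    show False
    proof (cases "adj G z w")
      case True
      then show False
        using noC4[of x y z w] start(3) yz wx z(3) w(3) wy(1)[symmetric] zxy(1)[symmetric] comm[of w x] comm[of w y]
        by (simp only: simp_thms not_False_eq_True)
    next
      case False
      then show False
        using noC5[of x y z u w] start(3) yz z(2,3) wu wx u(2) uy w(3)
          comm[of z u] comm[of w u] comm[of u x] comm[of u y] comm[of w y]
        by (simp only: simp_thms not_False_eq_True)
    qed
  qed
  note asym = this
  have "\<not> adj G x y" if xy: "x \<in> S" "y \<in> S" for x y
  proof
    assume e: "adj G x y"
    obtain u where u: "u \<in> K" "\<not> adj G u x" "adj G u y"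
      using asym[OF xy e] by blast
    obtain w where w: "w \<in> K" "\<not> adj G w y" "adj G w x"
      using asym[OF xy(2,1) sym[OF e]] by blast
    have "u \<noteq> w" using u(2) w(3) by metis
    then have "adj G u w" by (rule Kadj[OF u(1) w(1)])
    moreover have "x \<noteq> u" "y \<noteq> w" using u(1) w(1) xy by (auto simp: S_def)
    ultimately show False
      using noC4[of x y u w] u(2,3) w(2,3) e comm[of u x] comm[of u y] comm[of w y]
      by (simp only: simp_thms not_False_eq_True)
  qed
  then show ?thesis
    unfolding split_graph_def using G KV Kadj
    by (intro conjI exI[of _ K] exI[of _ S]) (simp_all add: S_def Un_absorb1)
qed

theorem Foeldes_Hammer: "Forb split_obstructions = {G. split_graph G}"
  using split_imp_Forb Forb_imp_split by blast

section \<open>A Perron argument\<close>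

definition apply_kernel :: "'a set \<Rightarrow> ('a \<Rightarrow> 'a \<Rightarrow> real) \<Rightarrow> ('a \<Rightarrow> real) \<Rightarrow> 'a \<Rightarrow> real" where
  "apply_kernel U f g = (\<lambda>u. \<Sum>w\<in>U. f u w * g w)"

definition support_rel :: "'a set \<Rightarrow> ('a \<Rightarrow> 'a \<Rightarrow> real) \<Rightarrow> ('a \<times> 'a) set" where
  "support_rel U f = {(u, w). u \<in> U \<and> w \<in> U \<and> f u w > 0}"

definition irreducible_kernel :: "'a set \<Rightarrow> ('a \<Rightarrow> 'a \<Rightarrow> real) \<Rightarrow> bool" where
  "irreducible_kernel U f \<longleftrightarrow> (\<forall>u\<in>U. \<forall>w\<in>U. (u, w) \<in> (support_rel U f)\<^sup>*)"

text \<open>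
  Bolzano--Weierstrass, one coordinate at a time.
\<close>

lemma bounded_family_convergent_subseq:
  fixes X :: "nat \<Rightarrow> 'a \<Rightarrow> real"
  assumes "finite U" and bounded: "\<And>n u. u \<in> U \<Longrightarrow> \<bar>X n u\<bar> \<le> B"
  shows "\<exists>l r. strict_mono (r :: nat \<Rightarrow> nat) \<and> (\<forall>u\<in>U. (\<lambda>n. X (r n) u) \<longlonglongrightarrow> l u)"
  using assms
proof (induction U rule: finite_induct)
  case empty
  then show ?case using strict_mono_id by auto
next
  case (insert u U)
  have "\<exists>l r. strict_mono (r :: nat \<Rightarrow> nat) \<and> (\<forall>u\<in>U. (\<lambda>n. X (r n) u) \<longlonglongrightarrow> l u)"
    by (rule insert.IH) (simp add: insert.prems)
  then obtain l r where r: "strict_mono (r :: nat \<Rightarrow> nat)"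
    and l: "\<And>u. u \<in> U \<Longrightarrow> (\<lambda>n. X (r n) u) \<longlonglongrightarrow> l u" by blast
  obtain s where s: "strict_mono s" "monoseq (\<lambda>n. X (r (s n)) u)"
    using seq_monosub[of "\<lambda>n. X (r n) u"] by (auto simp: o_def)
  have "Bseq (\<lambda>n. X (r (s n)) u)"
    using insert.prems by (intro BseqI'[of _ B]) auto
  then obtain L where L: "(\<lambda>n. X (r (s n)) u) \<longlonglongrightarrow> L"
    using Bseq_monoseq_convergent s(2) by (auto simp: convergent_def)
  have "(\<lambda>n. X ((r \<circ> s) n) w) \<longlonglongrightarrow> (l(u := L)) w" if "w \<in> insert u U" for w
  proof (cases "w = u")
    case True
    then show ?thesis using L by simp
  next
    case False
    then have "(\<lambda>n. X (r n) w) \<longlonglongrightarrow> l w" using that l by simp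
    then show ?thesis using LIMSEQ_subseq_LIMSEQ[OF _ s(1)] False by (simp add: o_def)
  qed
  then show ?case using strict_mono_o[OF r s(1)] by blast
qed

locale nonneg_irreducible =
  fixes U :: "'a set" and f :: "'a \<Rightarrow> 'a \<Rightarrow> real"
  assumes fin: "finite U" and nonempty: "U \<noteq> {}"
    and nonneg: "\<And>u w. u \<in> U \<Longrightarrow> w \<in> U \<Longrightarrow> f u w \<ge> 0"
    and irreducible: "irreducible_kernel U f"
begin

abbreviation F :: "('a \<Rightarrow> real) \<Rightarrow> 'a \<Rightarrow> real" where
  "F \<equiv> apply_kernel U f"

lemma F_pow_nonneg:
  assumes "\<And>w. w \<in> U \<Longrightarrow> g w \<ge> 0" "u \<in> U"
  shows "(F ^^ m) g u \<ge> 0"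
  using assms(2)
proof (induction m arbitrary: u)
  case (Suc m)
  then show ?case using nonneg by (auto simp: apply_kernel_def intro!: sum_nonneg)
qed (simp add: assms)

lemma F_pow_reaches:
  assumes g: "\<And>w. w \<in> U \<Longrightarrow> g w \<ge> 0" and w: "w \<in> U" "g w > 0" and u: "u \<in> U"
  shows "\<exists>m. (F ^^ m) g u > 0"
proof -
  have "(u, w) \<in> (support_rel U f)\<^sup>*" using irreducible u w by (simp add: irreducible_kernel_def)
  then show ?thesis
  proof (induction rule: converse_rtrancl_induct)
    case base
    then show ?case using w by (intro exI[of _ 0]) simp
  next
    case (step y z)
    then obtain m where m: "(F ^^ m) g z > 0" by blast
    have yz: "y \<in> U" "z \<in> U" "f y z > 0" using step by (auto simp: support_rel_def)
    have "0 < f y z * (F ^^ m) g z" using yz m by simp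
    also have "\<dots> \<le> F ((F ^^ m) g) y"
      unfolding apply_kernel_def[of U f "(F ^^ m) g"] using yz nonneg F_pow_nonneg[of g _ m] g
      by (intro member_le_sum[of z U "\<lambda>w. f y w * (F ^^ m) g w"]) (auto simp: fin)
    finally show ?case by (intro exI[of _ "Suc m"]) simp
  qed
qed

text \<open>
  The largest \<open>x\<close> with \<open>F v \<ge> x v\<close> for some distribution \<open>v\<close> is attained by compactness, and at a
  maximiser the inequality is an equality: otherwise applying powers of \<open>F\<close> spreads the surplus
  over all coordinates.
\<close>

lemma perron_vector:
  obtains \<rho> v where "\<And>u. u \<in> U \<Longrightarrow> v u > 0" "\<And>u. u \<in> U \<Longrightarrow> F v u = \<rho> * v u"
proof -
  define feasible where "feasible x v \<longleftrightarrow>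
    (\<forall>u\<in>U. v u \<ge> 0) \<and> sum v U = 1 \<and> (\<forall>u\<in>U. x * v u \<le> F v u)" for x v
  define X where "X = {x. \<exists>v. feasible x v}"
  have card: "card U > 0" using fin nonempty by (simp add: card_gt_0_iff)
  have "feasible 0 (\<lambda>_. 1 / card U)"
    unfolding feasible_def using card nonneg by (auto simp: apply_kernel_def intro!: sum_nonneg)
  then have X0: "0 \<in> X" by (auto simp: X_def)
  define C where "C = (\<Sum>u\<in>U. \<Sum>w\<in>U. f u w)"
  have le1: "v u \<le> 1" if "feasible x v" "u \<in> U" for x v u
    using that member_le_sum[of u U v] fin by (auto simp: feasible_def)
  have XC: "x \<le> C" if "x \<in> X" for x
  proof -
    obtain v where v: "feasible x v" using \<open>x \<in> X\<close> by (auto simp: X_def)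
    have "x = (\<Sum>u\<in>U. x * v u)" using v by (simp add: feasible_def sum_distrib_left[symmetric])
    also have "\<dots> \<le> (\<Sum>u\<in>U. F v u)" using v by (intro sum_mono) (simp add: feasible_def)
    also have "\<dots> \<le> C"
      unfolding C_def apply_kernel_def using le1[OF v] nonneg by (intro sum_mono mult_left_le)
    finally show ?thesis .
  qed
  then have bdd: "bdd_above X" by (rule bdd_aboveI)
  define \<rho> where "\<rho> = Sup X"
  have "\<exists>x v. feasible x v \<and> \<rho> - inverse (real (Suc n)) < x" for n
  proof -
    have "\<rho> - inverse (real (Suc n)) < Sup X" by (simp add: \<rho>_def)
    then obtain x where "x \<in> X" "\<rho> - inverse (real (Suc n)) < x"
      using less_cSup_iff[OF _ bdd] X0 by blast
    then show ?thesis by (auto simp: X_def)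
  qed
  then obtain xs vs where xv: "\<And>n. feasible (xs n) (vs n)" "\<And>n. \<rho> - inverse (real (Suc n)) < xs n"
    by metis
  have xs_le: "xs n \<le> \<rho>" for n
    unfolding \<rho>_def using xv(1) by (intro cSup_upper[OF _ bdd]) (auto simp: X_def)
  have xs_lim: "xs \<longlonglongrightarrow> \<rho>"
  proof (rule tendsto_sandwich)
    show "\<forall>\<^sub>F n in sequentially. \<rho> - inverse (real (Suc n)) \<le> xs n"
      using xv(2) by (intro always_eventually allI less_imp_le)
    show "\<forall>\<^sub>F n in sequentially. xs n \<le> \<rho>" using xs_le by simp
    show "(\<lambda>n. \<rho> - inverse (real (Suc n))) \<longlonglongrightarrow> \<rho>"
      using tendsto_diff[OF tendsto_const[of \<rho>] LIMSEQ_inverse_real_of_nat] by simp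
  qed simp
  have "\<bar>vs n u\<bar> \<le> 1" if "u \<in> U" for n u
    using le1[OF xv(1) that] xv(1)[of n] that by (auto simp: feasible_def)
  then have "\<exists>v r. strict_mono (r :: nat \<Rightarrow> nat) \<and> (\<forall>u\<in>U. (\<lambda>n. vs (r n) u) \<longlonglongrightarrow> v u)"
    by (rule bounded_family_convergent_subseq[OF fin])
  then obtain v r where r: "strict_mono r" and v: "\<And>u. u \<in> U \<Longrightarrow> (\<lambda>n. vs (r n) u) \<longlonglongrightarrow> v u"
    by blast
  have x_lim: "(\<lambda>n. xs (r n)) \<longlonglongrightarrow> \<rho>"
    using LIMSEQ_subseq_LIMSEQ[OF xs_lim r] by (simp add: o_def)
  have v_nonneg: "v u \<ge> 0" if "u \<in> U" for u
    using v[OF that] xv(1) that by (intro LIMSEQ_le_const) (auto simp: feasible_def)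
  have "(\<lambda>n. sum (vs (r n)) U) \<longlonglongrightarrow> sum v U" using v by (intro tendsto_sum)
  moreover have "sum (vs (r n)) U = 1" for n using xv(1) by (simp add: feasible_def)
  ultimately have v_sum: "sum v U = 1" by (simp add: LIMSEQ_const_iff)
  have sub: "\<rho> * v u \<le> F v u" if "u \<in> U" for u
  proof (rule LIMSEQ_le)
    show "(\<lambda>n. xs (r n) * vs (r n) u) \<longlonglongrightarrow> \<rho> * v u" using x_lim v[OF that] by (rule tendsto_mult)
    show "(\<lambda>n. F (vs (r n)) u) \<longlonglongrightarrow> F v u"
      unfolding apply_kernel_def using v by (intro tendsto_intros)
    show "\<exists>N. \<forall>n\<ge>N. xs (r n) * vs (r n) u \<le> F (vs (r n)) u"
      using xv(1) that by (auto simp: feasible_def)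
  qed
  have Z: "\<exists>M. \<forall>u\<in>U. (\<Sum>m\<le>M. (F ^^ m) g u) > 0"
    if g: "\<And>w. w \<in> U \<Longrightarrow> g w \<ge> 0" and w: "w \<in> U" "g w > 0" for g w
  proof -
    obtain m where m: "\<And>u. u \<in> U \<Longrightarrow> (F ^^ m u) g u > 0"
      using F_pow_reaches[of g w, OF g w] by metis
    have "(\<Sum>k\<le>Max (m ` U). (F ^^ k) g u) > 0" if u: "u \<in> U" for u
    proof -
      have "(F ^^ m u) g u \<le> (\<Sum>k\<le>Max (m ` U). (F ^^ k) g u)"
        using u fin F_pow_nonneg[OF g u] by (intro member_le_sum) auto
      then show ?thesis using m[OF u] by linarith
    qed
    then show ?thesis by blast
  qed
  have F_sum: "F (\<lambda>u. \<Sum>m\<le>M. (F ^^ m) g u) u = (\<Sum>m\<le>M. (F ^^ m) (F g) u)" for M g u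
    unfolding funpow_swap1[symmetric] apply_kernel_def[of U f "(F ^^ _) g"]
    unfolding apply_kernel_def[of U f "\<lambda>u. \<Sum>m\<le>M. (F ^^ m) g u"] sum_distrib_left by (rule sum.swap)
  have F_pow_diff: "(F ^^ m) (\<lambda>u. g u - c * h u) = (\<lambda>u. (F ^^ m) g u - c * (F ^^ m) h u)" for m g h c
    by (induction m) (simp_all add: apply_kernel_def right_diff_distrib sum_subtractf sum_distrib_left
        mult.left_commute)
  have eq: "F v u = \<rho> * v u" if "u \<in> U" for u
  proof (rule ccontr)
    assume "F v u \<noteq> \<rho> * v u"
    define g where "g u = F v u - \<rho> * v u" for u
    have "g w \<ge> 0" if "w \<in> U" for w using sub[OF that] by (simp add: g_def)
    moreover have "g u > 0" using sub[OF \<open>u \<in> U\<close>] \<open>F v u \<noteq> _\<close> by (simp add: g_def)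
    ultimately obtain M where M: "\<And>u. u \<in> U \<Longrightarrow> (\<Sum>m\<le>M. (F ^^ m) g u) > 0"
      using Z[of g u] \<open>u \<in> U\<close> by blast
    define w where "w u = (\<Sum>m\<le>M. (F ^^ m) v u)" for u
    define surplus where "surplus u = (\<Sum>m\<le>M. (F ^^ m) g u)" for u
    have surplus: "F w u = \<rho> * w u + surplus u" for u
      unfolding surplus_def g_def[abs_def] F_pow_diff w_def[abs_def] F_sum
      by (simp add: sum_subtractf sum_distrib_left)
    have w_nonneg: "w u \<ge> 0" if "u \<in> U" for u
      unfolding w_def using F_pow_nonneg[OF v_nonneg that] by (intro sum_nonneg) auto
    have w_pos: "sum w U > 0"
    proof -
      have "F w u > 0" if "u \<in> U" for u
      proof -
        have "0 \<le> \<rho>" unfolding \<rho>_def by (rule cSup_upper[OF X0 bdd])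
        then show ?thesis using surplus[of u] w_nonneg[OF that] M[OF that]
          by (simp add: surplus_def add_nonneg_pos)
      qed
      then have "\<exists>u\<in>U. w u \<noteq> 0"
        using nonempty unfolding apply_kernel_def by (metis (no_types, lifting) all_not_in_conv less_irrefl mult_zero_right sum.neutral)
      then obtain u where "u \<in> U" "w u > 0" using w_nonneg by (metis order_le_less)
      then show ?thesis using w_nonneg by (intro sum_pos2[OF fin]) auto
    qed
    define \<epsilon> where "\<epsilon> = Min (surplus ` U) / sum w U"
    have min_pos: "Min (surplus ` U) > 0" using M fin nonempty by (simp add: surplus_def)
    have "feasible (\<rho> + \<epsilon>) (\<lambda>u. w u / sum w U)"
    proof -
      have "(\<rho> + \<epsilon>) * (w u / sum w U) \<le> F (\<lambda>u. w u / sum w U) u" if u: "u \<in> U" for u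
      proof -
        have "w u \<le> sum w U" using u w_nonneg fin by (intro member_le_sum) auto
        then have "\<epsilon> * w u \<le> \<epsilon> * sum w U"
          using min_pos w_pos by (intro mult_left_mono) (simp_all add: \<epsilon>_def)
        also have "\<dots> = Min (surplus ` U)" using w_pos by (simp add: \<epsilon>_def)
        also have "\<dots> \<le> surplus u" using fin u by (intro Min_le) auto
        finally have "(\<rho> + \<epsilon>) * w u \<le> F w u" by (simp add: surplus distrib_right)
        moreover have "F (\<lambda>u. w u / sum w U) u = F w u / sum w U"
          by (simp add: apply_kernel_def sum_divide_distrib)
        ultimately show ?thesis using w_pos by (simp add: divide_right_mono)
      qed
      then show ?thesis
        using w_nonneg w_pos by (simp add: feasible_def sum_divide_distrib[symmetric])
    qed
    then have "\<rho> + \<epsilon> \<le> \<rho>" unfolding \<rho>_def by (intro cSup_upper[OF _ bdd]) (auto simp: X_def)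
    moreover have "\<epsilon> > 0" unfolding \<epsilon>_def using min_pos w_pos by (rule divide_pos_pos)
    ultimately show False by simp
  qed
  have pow: "(F ^^ m) v u = \<rho> ^ m * v u" if "u \<in> U" for m u
    using that
  proof (induction m arbitrary: u)
    case (Suc m)
    have "F ((F ^^ m) v) u = (\<Sum>w\<in>U. f u w * (\<rho> ^ m * v w))"
      unfolding apply_kernel_def[of U f "(F ^^ m) v"] using Suc.IH by simp
    also have "\<dots> = \<rho> ^ m * F v u" by (simp add: apply_kernel_def sum_distrib_left mult.left_commute)
    finally show ?case using eq[OF Suc.prems] by simp
  qed simp
  have "v u > 0" if u: "u \<in> U" for u
  proof -
    have "\<exists>w\<in>U. v w \<noteq> 0" using v_sum by (metis sum.neutral zero_neq_one)
    then obtain w where w: "w \<in> U" "v w > 0" using v_nonneg by (metis order_le_less)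
    obtain m where "(F ^^ m) v u > 0" using F_pow_reaches[of v w u, OF v_nonneg w u] by blast
    then have "v u \<noteq> 0" using pow[OF u] by auto
    then show ?thesis using v_nonneg[OF u] by simp
  qed
  then show ?thesis using eq by (rule that)
qed

end

section \<open>Matrices indexed by lists\<close>

text \<open>
  The rows and columns follow given lists, since the block structure of a matrix appears only after
  its index set has been put into a suitable order.
\<close>

definition list_mat :: "'a list \<Rightarrow> 'b list \<Rightarrow> ('a \<Rightarrow> 'b \<Rightarrow> real) \<Rightarrow> real mat" where
  "list_mat xs ys f = mat (length xs) (length ys) (\<lambda>(i, j). f (xs ! i) (ys ! j))"

abbreviation list_char_poly :: "'a list \<Rightarrow> ('a \<Rightarrow> 'a \<Rightarrow> real) \<Rightarrow> real poly" where
  "list_char_poly vs f \<equiv> char_poly (list_mat vs vs f)"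

lemma list_mat_carrier [simp]: "list_mat xs ys f \<in> carrier_mat (length xs) (length ys)"
  by (simp add: list_mat_def)

lemma list_mat_dim [simp]: "dim_row (list_mat xs ys f) = length xs" "dim_col (list_mat xs ys f) = length ys"
  by (simp_all add: list_mat_def)

lemma list_mat_index [simp]:
  "i < length xs \<Longrightarrow> j < length ys \<Longrightarrow> list_mat xs ys f $$ (i, j) = f (xs ! i) (ys ! j)"
  by (simp add: list_mat_def)

lemma sum_nth_distinct:
  assumes "distinct vs"
  shows "(\<Sum>i<length vs. g (vs ! i)) = sum g (set vs)"
  using sum.reindex_bij_betw[OF bij_betw_nth[OF assms refl refl], of g] .

lemma list_mat_cong:
  "(\<And>u v. u \<in> set xs \<Longrightarrow> v \<in> set ys \<Longrightarrow> f u v = g u v) \<Longrightarrow> list_mat xs ys f = list_mat xs ys g"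
  by (rule eq_matI) simp_all

lemma list_mat_mult:
  assumes "distinct ys"
  shows "list_mat xs ys f * list_mat ys zs g = list_mat xs zs (\<lambda>u w. \<Sum>v\<in>set ys. f u v * g v w)"
proof (rule eq_matI)
  fix i j assume ij: "i < dim_row (list_mat xs zs (\<lambda>u w. \<Sum>v\<in>set ys. f u v * g v w))"
    "j < dim_col (list_mat xs zs (\<lambda>u w. \<Sum>v\<in>set ys. f u v * g v w))"
  have "(list_mat xs ys f * list_mat ys zs g) $$ (i, j)
      = (\<Sum>k<length ys. f (xs ! i) (ys ! k) * g (ys ! k) (zs ! j))"
    using ij by (simp add: scalar_prod_def atLeast0LessThan)
  also have "\<dots> = (\<Sum>v\<in>set ys. f (xs ! i) v * g v (zs ! j))"
    by (rule sum_nth_distinct[OF assms])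
  finally show "(list_mat xs ys f * list_mat ys zs g) $$ (i, j)
      = list_mat xs zs (\<lambda>u w. \<Sum>v\<in>set ys. f u v * g v w) $$ (i, j)" using ij by simp
qed simp_all

lemma list_mat_one:
  assumes "distinct vs"
  shows "list_mat vs vs (\<lambda>u v. if u = v then 1 else 0) = 1\<^sub>m (length vs)"
  by (rule eq_matI) (simp_all add: nth_eq_iff_index_eq[OF assms])

lemma list_mat_append:
  "list_mat (xs @ ys) (xs @ ys) f = four_block_mat (list_mat xs xs f) (list_mat xs ys f)
     (list_mat ys xs f) (list_mat ys ys f)"
  by (rule eq_matI) (simp_all add: nth_append)

text \<open>
  Two orders of the index set give matrices that are conjugate by a permutation matrix.
\<close>

lemma list_char_poly_reorder:
  assumes vs: "distinct vs" and ws: "distinct ws" and eq: "set vs = set ws"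
  shows "list_char_poly vs f = list_char_poly ws f"
proof -
  let ?d = "\<lambda>u v. if u = v then 1 else (0::real)"
  let ?P = "list_mat vs ws ?d" and ?Q = "list_mat ws vs ?d"
  have len: "length vs = length ws" using distinct_card[OF vs] distinct_card[OF ws] eq by simp
  have d: "(\<Sum>v\<in>Z. ?d u v * h v) = h u" "(\<Sum>v\<in>Z. h v * ?d v u) = h u"
    if "finite Z" "u \<in> Z" for u h Z
  proof -
    have "(\<Sum>v\<in>Z. ?d u v * h v) = (\<Sum>v\<in>Z. if u = v then h v else 0)"
      "(\<Sum>v\<in>Z. h v * ?d v u) = (\<Sum>v\<in>Z. if u = v then h v else 0)"
      by (intro sum.cong refl; simp)+
    then show "(\<Sum>v\<in>Z. ?d u v * h v) = h u" "(\<Sum>v\<in>Z. h v * ?d v u) = h u"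
      using that by simp_all
  qed
  have delta: "list_mat xs zs ?d * list_mat zs ys g = list_mat xs ys g"
    if "distinct zs" "set xs = set zs" for xs ys zs g
    unfolding list_mat_mult[OF that(1)] using that(2) by (intro list_mat_cong d(1)) auto
  have delta': "list_mat xs zs g * list_mat zs ys ?d = list_mat xs ys g"
    if "distinct zs" "set ys = set zs" for xs ys zs g
    unfolding list_mat_mult[OF that(1)] using that(2) by (intro list_mat_cong d(2)) auto
  have PQ: "?P * ?Q = 1\<^sub>m (length ws)" "?Q * ?P = 1\<^sub>m (length ws)"
    unfolding delta[OF ws eq] delta[OF vs eq[symmetric]] list_mat_one[OF vs] list_mat_one[OF ws] len
    by (rule refl)+
  have conj: "?P * list_mat ws ws f * ?Q = list_mat vs vs f"
    by (simp only: delta[OF ws eq] delta'[OF ws eq])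
  have "{list_mat vs vs f, list_mat ws ws f, ?P, ?Q} \<subseteq> carrier_mat (length ws) (length ws)"
    using list_mat_carrier[of vs vs f] list_mat_carrier[of vs ws ?d] list_mat_carrier[of ws vs ?d]
    unfolding len by simp
  then have "similar_mat (list_mat vs vs f) (list_mat ws ws f)"
    by (rule similar_matI[OF _ PQ conj[symmetric]])
  then show ?thesis by (rule char_poly_similar)
qed

lemma poly_char_poly_det:
  assumes "(A :: real mat) \<in> carrier_mat n n"
  shows "poly (char_poly A) x = det (x \<cdot>\<^sub>m 1\<^sub>m n - A)"
  unfolding char_poly_matrix[OF assms]
  by (rule arg_cong[where f = det], rule eq_matI) (use assms in \<open>auto simp: char_matrix_def\<close>)

lemma list_char_poly_block:
  assumes zero: "\<And>u v. u \<in> set xs \<Longrightarrow> v \<in> set ys \<Longrightarrow> f u v = 0"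
  shows "poly (list_char_poly (xs @ ys) f) x
    = poly (list_char_poly xs f) x * poly (list_char_poly ys f) x"
proof -
  let ?n = "length xs" and ?m = "length ys"
  have eq: "x \<cdot>\<^sub>m 1\<^sub>m (?n + ?m) - list_mat (xs @ ys) (xs @ ys) f
      = four_block_mat (x \<cdot>\<^sub>m 1\<^sub>m ?n - list_mat xs xs f) (0\<^sub>m ?n ?m) (- list_mat ys xs f)
          (x \<cdot>\<^sub>m 1\<^sub>m ?m - list_mat ys ys f)"
  proof -
    have "f (xs ! i) (ys ! j) = 0" if "i < ?n" "j < ?m" for i j
      using that by (intro zero) simp_all
    then show ?thesis unfolding list_mat_append by (intro eq_matI) (simp_all, linarith)
  qed
  have carrier: "list_mat (xs @ ys) (xs @ ys) f \<in> carrier_mat (?n + ?m) (?n + ?m)"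
    using list_mat_carrier[of "xs @ ys" "xs @ ys" f] by simp
  have "poly (list_char_poly (xs @ ys) f) x
      = det (four_block_mat (x \<cdot>\<^sub>m 1\<^sub>m ?n - list_mat xs xs f) (0\<^sub>m ?n ?m) (- list_mat ys xs f)
          (x \<cdot>\<^sub>m 1\<^sub>m ?m - list_mat ys ys f))"
    unfolding poly_char_poly_det[OF carrier] eq ..
  also have "\<dots> = det (x \<cdot>\<^sub>m 1\<^sub>m ?n - list_mat xs xs f) * det (x \<cdot>\<^sub>m 1\<^sub>m ?m - list_mat ys ys f)"
    by (rule det_four_block_mat_upper_right_zero[of _ ?n _ ?m])
      (simp_all add: minus_carrier_mat)
  finally show ?thesis unfolding poly_char_poly_det[OF list_mat_carrier] .
qed

lemma list_char_poly_root_iff: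
  assumes "distinct vs"
  shows "poly (list_char_poly vs f) x = 0 \<longleftrightarrow>
    (\<exists>g. (\<exists>u\<in>set vs. g u \<noteq> 0) \<and> (\<forall>u\<in>set vs. apply_kernel (set vs) f g u = x * g u))"
proof -
  let ?A = "list_mat vs vs f" and ?n = "length vs"
  have mult: "(?A *\<^sub>v vec ?n (\<lambda>i. g (vs ! i))) $ i = apply_kernel (set vs) f g (vs ! i)"
    if "i < ?n" for g i
    using that sum_nth_distinct[OF assms, of "\<lambda>w. f (vs ! i) w * g w"]
    by (simp add: scalar_prod_def apply_kernel_def atLeast0LessThan)
  have ev: "eigenvector ?A (vec ?n (\<lambda>i. g (vs ! i))) x \<longleftrightarrow>
      (\<exists>u\<in>set vs. g u \<noteq> 0) \<and> (\<forall>u\<in>set vs. apply_kernel (set vs) f g u = x * g u)" for g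
  proof -
    have "vec ?n (\<lambda>i. g (vs ! i)) = 0\<^sub>v ?n \<longleftrightarrow> (\<forall>i<?n. g (vs ! i) = 0)"
      by (auto simp: vec_eq_iff)
    moreover have "?A *\<^sub>v vec ?n (\<lambda>i. g (vs ! i)) = x \<cdot>\<^sub>v vec ?n (\<lambda>i. g (vs ! i)) \<longleftrightarrow>
        (\<forall>i<?n. apply_kernel (set vs) f g (vs ! i) = x * g (vs ! i))"
      unfolding vec_eq_iff using mult by (auto simp del: index_mult_mat_vec)
    ultimately show ?thesis
      unfolding eigenvector_def by (simp add: all_set_conv_all_nth Bex_def) (metis in_set_conv_nth)
  qed
  have "eigenvalue ?A x \<longleftrightarrow> (\<exists>g. eigenvector ?A (vec ?n (\<lambda>i. g (vs ! i))) x)"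
  proof
    assume "eigenvalue ?A x"
    then obtain v where v: "eigenvector ?A v x" by (auto simp: eigenvalue_def)
    define g where "g u = v $ (THE i. i < ?n \<and> vs ! i = u)" for u
    have "g (vs ! i) = v $ i" if "i < ?n" for i
    proof -
      have "(THE j. j < ?n \<and> vs ! j = vs ! i) = i"
        using that assms by (intro the_equality) (auto simp: nth_eq_iff_index_eq)
      then show ?thesis by (simp add: g_def)
    qed
    then have "vec ?n (\<lambda>i. g (vs ! i)) = v"
      using v by (intro eq_vecI) (auto simp: eigenvector_def)
    then show "\<exists>g. eigenvector ?A (vec ?n (\<lambda>i. g (vs ! i))) x" using v by metis
  qed (auto simp: eigenvalue_def)
  then show ?thesis
    unfolding eigenvalue_root_char_poly[OF list_mat_carrier, symmetric] ev .
qed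

lemma monic_poly_pos:
  fixes p :: "real poly"
  assumes lead: "lead_coeff p > 0" and no_root: "\<And>x. x \<ge> \<rho> \<Longrightarrow> poly p x \<noteq> 0"
  shows "poly p \<rho> > 0"
proof (rule ccontr)
  assume "\<not> ?thesis"
  then have neg: "poly p \<rho> < 0" using no_root[of \<rho>] by simp
  obtain n where n: "\<And>x. x \<ge> n \<Longrightarrow> poly p x \<ge> lead_coeff p"
    using poly_pinfty_gt_lc[OF lead] by blast
  have "poly p (max n (\<rho> + 1)) > 0" using n[of "max n (\<rho> + 1)"] lead by simp
  moreover have "\<rho> < max n (\<rho> + 1)" by linarith
  ultimately obtain x where "\<rho> < x" "poly p x = 0"
    using poly_IVT_pos[OF _ neg] by blast
  then show False using no_root[of x] by simp
qed

context nonneg_irreducible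
begin

text \<open>
  Deleting a row and a column leaves no eigenvalue at or above the Perron root: the coordinates where
  an eigenvector is largest relative to the Perron vector would be closed under the relation,
  without containing the deleted index.
\<close>

lemma erased_no_root:
  assumes v: "\<And>u. u \<in> U \<Longrightarrow> v u > 0" "\<And>u. u \<in> U \<Longrightarrow> F v u = \<rho> * v u"
    and \<rho>: "\<rho> > 0" and vs: "distinct vs" "set vs = U" and i: "i \<in> U" and x: "x \<ge> \<rho>"
  shows "poly (list_char_poly vs (\<lambda>u w. if u = i \<or> w = i then 0 else f u w)) x \<noteq> 0"
proof
  let ?f = "\<lambda>u w. if u = i \<or> w = i then 0 else f u w"
  assume "poly (list_char_poly vs ?f) x = 0"
  then obtain g where g: "\<exists>u\<in>U. g u \<noteq> 0" "\<And>u. u \<in> U \<Longrightarrow> apply_kernel U ?f g u = x * g u"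
    unfolding list_char_poly_root_iff[OF vs(1)] vs(2) by blast
  define h where "h u = \<bar>g u\<bar> / v u" for u
  define c where "c = Max (h ` U)"
  have hc: "h u \<le> c" if "u \<in> U" for u unfolding c_def using fin that by (intro Max_ge) auto
  have g_le: "\<bar>g u\<bar> \<le> c * v u" if "u \<in> U" for u
    using hc[OF that] v(1)[OF that] by (simp add: h_def pos_divide_le_eq)
  have "c \<in> h ` U" unfolding c_def using fin nonempty by (intro Max_in) simp_all
  then obtain u0 where u0: "u0 \<in> U" "h u0 = c" by (metis imageE)
  have c_pos: "c > 0"
  proof -
    obtain u where "u \<in> U" "g u \<noteq> 0" using g(1) by blast
    then have "h u > 0" using v(1) by (simp add: h_def)
    then show ?thesis using hc[OF \<open>u \<in> U\<close>] by linarith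
  qed
  have closed: "u \<noteq> i \<and> f u i = 0 \<and> (\<forall>w\<in>U. f u w > 0 \<longrightarrow> h w = c)" if u: "u \<in> U" "h u = c" for u
  proof -
    have gu: "\<bar>g u\<bar> = c * v u"
      using u(2) v(1)[OF u(1)] by (simp add: h_def divide_eq_eq split: if_splits)
    have ne: "u \<noteq> i"
    proof
      assume "u = i"
      then have "x * g u = 0" using g(2)[OF u(1)] by (simp add: apply_kernel_def)
      then show False using gu c_pos v(1)[OF u(1)] x \<rho> by auto
    qed
    let ?gap = "\<lambda>w. f u w * (c * v w) - ?f u w * \<bar>g w\<bar>"
    have gap: "?gap w \<ge> 0" if "w \<in> U" for w
      using nonneg[OF u(1) that] g_le[OF that] v(1)[OF that] c_pos by (auto intro!: mult_left_mono)
    have "\<rho> * (c * v u) \<le> x * \<bar>g u\<bar>" using x c_pos v(1)[OF u(1)] by (simp add: gu mult_right_mono)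
    also have "\<dots> = \<bar>apply_kernel U ?f g u\<bar>" using g(2)[OF u(1)] x \<rho> by (simp add: abs_mult)
    also have "\<dots> \<le> (\<Sum>w\<in>U. \<bar>?f u w * g w\<bar>)" unfolding apply_kernel_def by (rule sum_abs)
    also have "\<dots> = (\<Sum>w\<in>U. ?f u w * \<bar>g w\<bar>)"
      using nonneg[OF u(1)] by (intro sum.cong) (auto simp: abs_mult)
    finally have "\<rho> * (c * v u) \<le> (\<Sum>w\<in>U. ?f u w * \<bar>g w\<bar>)" .
    moreover have "(\<Sum>w\<in>U. f u w * (c * v w)) = \<rho> * (c * v u)"
      using v(2)[OF u(1)] by (simp add: apply_kernel_def sum_distrib_left[symmetric] mult.left_commute)
    ultimately have "(\<Sum>w\<in>U. ?gap w) \<le> 0" by (simp add: sum_subtractf)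
    then have zero: "?gap w = 0" if "w \<in> U" for w
      using gap sum_nonneg_eq_0_iff[OF fin, of ?gap] that by (meson antisym sum_nonneg)
    have "f u i = 0" using zero[OF i] c_pos v(1)[OF i] by simp
    moreover have "h w = c" if w: "w \<in> U" "f u w > 0" for w
    proof -
      have "w \<noteq> i" using \<open>f u i = 0\<close> w by auto
      then have "\<bar>g w\<bar> = c * v w" using zero[OF w(1)] ne w(2) by simp
      then show ?thesis using v(1)[OF w(1)] by (simp add: h_def)
    qed
    ultimately show ?thesis using ne by blast
  qed
  have "(u0, i) \<in> (support_rel U f)\<^sup>*" using irreducible u0(1) i by (simp add: irreducible_kernel_def)
  then have "i \<in> U \<and> h i = c"
  proof (induction rule: rtrancl_induct)
    case base
    then show ?case using u0 by simp
  next
    case (step y z)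
    then show ?case using closed[of y] by (auto simp: support_rel_def)
  qed
  then show False using closed[of i] by blast
qed

text \<open>
  The derivative of the characteristic polynomial is, up to a factor \<open>x\<close>, the sum of the
  characteristic polynomials of the matrices with one index erased. All of these are positive at the
  Perron root, which therefore is a simple root.
\<close>

lemma char_poly_neg_below_perron_root:
  assumes vs: "distinct vs" "set vs = U" and card: "card U \<ge> 2"
  obtains \<rho> \<delta> where "\<rho> > 0" "\<delta> > 0"
    "\<And>x. \<rho> - \<delta> < x \<Longrightarrow> x < \<rho> \<Longrightarrow> poly (list_char_poly vs f) x < 0"
proof -
  obtain \<rho> v where v: "\<And>u. u \<in> U \<Longrightarrow> v u > 0" "\<And>u. u \<in> U \<Longrightarrow> F v u = \<rho> * v u"
    by (rule perron_vector) blast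
  have \<rho>: "\<rho> > 0"
  proof -
    obtain u w where uw: "u \<in> U" "w \<in> U" "u \<noteq> w"
      using card by (metis card_2_iff' card_le_Suc0_iff_eq fin not_less_eq_eq numeral_2_eq_2)
    then have "(u, w) \<in> (support_rel U f)\<^sup>*" using irreducible by (simp add: irreducible_kernel_def)
    then obtain z where "(u, z) \<in> support_rel U f" using uw(3) by (meson converse_rtranclE)
    then have z: "z \<in> U" "f u z > 0" by (simp_all add: support_rel_def)
    have "0 < f u z * v z" using z v(1) by simp
    also have "\<dots> \<le> F v u"
    proof -
      have "f u x * v x \<ge> 0" if "x \<in> U" for x
        using nonneg[OF uw(1) that] v(1)[OF that] by simp
      then show ?thesis
        unfolding apply_kernel_def using z fin by (intro member_le_sum[of z U "\<lambda>w. f u w * v w"]) auto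
    qed
    finally show ?thesis using v(2)[OF uw(1)] v(1)[OF uw(1)] by (simp add: zero_less_mult_iff)
  qed
  let ?p = "list_char_poly vs f"
  have root: "poly ?p \<rho> = 0"
    unfolding list_char_poly_root_iff[OF vs(1)] vs(2)
    using v nonempty by (intro exI[of _ v] conjI ballI) (metis all_not_in_conv less_irrefl, simp)
  have erase: "mat_erase (list_mat vs vs f) k k
      = list_mat vs vs (\<lambda>u w. if u = vs ! k \<or> w = vs ! k then 0 else f u w)" if "k < length vs" for k
    using that by (intro eq_matI) (auto simp: mat_erase_def nth_eq_iff_index_eq[OF vs(1)])
  have "poly (char_poly (mat_erase (list_mat vs vs f) k k)) \<rho> > 0" if k: "k < length vs" for k
  proof (rule monic_poly_pos)
    have "mat_erase (list_mat vs vs f) k k \<in> carrier_mat (length vs) (length vs)" by simp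
    from degree_monic_char_poly[OF this]
    show "lead_coeff (char_poly (mat_erase (list_mat vs vs f) k k)) > 0" by simp
    show "poly (char_poly (mat_erase (list_mat vs vs f) k k)) x \<noteq> 0" if "x \<ge> \<rho>" for x
      unfolding erase[OF k] using k vs(2) that by (intro erased_no_root[OF v \<rho> vs]) auto
  qed
  then have "(\<Sum>k<length vs. poly (char_poly (mat_erase (list_mat vs vs f) k k)) \<rho>) > 0"
    using nonempty vs(2) by (intro sum_pos) auto
  also have "(\<Sum>k<length vs. poly (char_poly (mat_erase (list_mat vs vs f) k k)) \<rho>)
      = poly (monom 1 1 * pderiv ?p) \<rho>"
    by (simp only: pderiv_char_poly_mat_erase[OF list_mat_carrier] poly_sum)
  finally have "poly (pderiv ?p) \<rho> > 0" using \<rho> by (simp add: poly_monom zero_less_mult_iff)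
  then obtain \<delta> where "\<delta> > 0" "\<And>h. 0 < h \<Longrightarrow> h < \<delta> \<Longrightarrow> poly ?p (\<rho> - h) < poly ?p \<rho>"
    using DERIV_pos_inc_left[OF poly_DERIV] by blast
  moreover have "poly ?p x < 0" if "\<rho> - \<delta> < x" "x < \<rho>" for x
    using calculation(2)[of "\<rho> - x"] that root by simp
  ultimately show ?thesis using that[of \<rho> \<delta>] \<rho> by blast
qed

end

section \<open>The generalized spectrum determines the characteristic polynomial of the product\<close>

lemma det_column_affine:
  fixes A :: "real mat"
  assumes carrier: "A \<in> carrier_mat n n" "B \<in> carrier_mat n n" "C \<in> carrier_mat n n" and j: "j < n"
    and column: "\<And>i. i < n \<Longrightarrow> A $$ (i, j) = a * B $$ (i, j) + b * C $$ (i, j)"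
    and rest: "\<And>i k. i < n \<Longrightarrow> k < n \<Longrightarrow> k \<noteq> j \<Longrightarrow> B $$ (i, k) = A $$ (i, k) \<and> C $$ (i, k) = A $$ (i, k)"
  shows "det A = a * det B + b * det C"
proof -
  have "mat_delete B i j = mat_delete A i j" "mat_delete C i j = mat_delete A i j" for i
    by (rule eq_matI; use carrier rest j in \<open>auto simp: mat_delete_def\<close>)+
  then have cof: "cofactor B i j = cofactor A i j" "cofactor C i j = cofactor A i j" for i
    by (simp_all add: cofactor_def)
  have "det A = (\<Sum>i<n. a * (B $$ (i, j) * cofactor A i j) + b * (C $$ (i, j) * cofactor A i j))"
    unfolding laplace_expansion_column[OF carrier(1) j]
    by (intro sum.cong refl) (simp add: column algebra_simps)
  also have "\<dots> = a * det B + b * det C"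
    unfolding laplace_expansion_column[OF carrier(2) j] laplace_expansion_column[OF carrier(3) j] cof
    by (simp add: sum.distrib sum_distrib_left)
  finally show ?thesis .
qed

lemma det_bordered:
  fixes X :: "real mat"
  assumes X: "X \<in> carrier_mat n n" and U: "U \<in> carrier_mat n 1" and E: "E \<in> carrier_mat 1 n"
  shows "det (four_block_mat (1\<^sub>m 1) E U X) = det (X - U * E)"
proof -
  let ?M = "four_block_mat (1\<^sub>m 1) E U X" and ?L = "four_block_mat (1\<^sub>m 1) (0\<^sub>m 1 n) (- U) (1\<^sub>m n)"
  have L: "?L \<in> carrier_mat (1 + n) (1 + n)" and M: "?M \<in> carrier_mat (1 + n) (1 + n)"
    by (rule four_block_carrier_mat; use X in simp)+
  have "?L * ?M = four_block_mat (1\<^sub>m 1 * 1\<^sub>m 1 + 0\<^sub>m 1 n * U) (1\<^sub>m 1 * E + 0\<^sub>m 1 n * X)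
      (- U * 1\<^sub>m 1 + 1\<^sub>m n * U) (- U * E + 1\<^sub>m n * X)"
    by (rule mult_four_block_mat) (use X U E in auto)
  also have "\<dots> = four_block_mat (1\<^sub>m 1) E (0\<^sub>m n 1) (X - U * E)"
    using X U E by (intro cong_four_block_mat) (auto intro!: eq_matI)
  finally have prod: "?L * ?M = four_block_mat (1\<^sub>m 1) E (0\<^sub>m n 1) (X - U * E)" .
  have "det ?L * det ?M = det (four_block_mat (1\<^sub>m 1) E (0\<^sub>m n 1) (X - U * E))"
    unfolding det_mult[OF L M, symmetric] prod ..
  moreover have "det ?L = 1"
    using U by (subst det_four_block_mat_upper_right_zero[of _ 1 _ n]) auto
  moreover have "det (four_block_mat (1\<^sub>m 1) E (0\<^sub>m n 1) (X - U * E)) = det (X - U * E)"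
    using X U E by (subst det_four_block_mat_lower_left_zero[of _ 1 _ n]) (auto intro: minus_carrier_mat)
  ultimately show ?thesis by simp
qed

text \<open>
  The determinant of \<open>X - u e\<^sup>T\<close> equals that of \<open>X\<close> bordered by the row \<open>(1, e\<^sup>T)\<close> and the column
  \<open>(1, u)\<^sup>T\<close>, which is linear in that column; the entry \<open>1\<close> is the reason for the weights to add up
  to \<open>1\<close>.
\<close>

lemma det_rank_one_affine:
  fixes X :: "real mat"
  assumes X: "X \<in> carrier_mat n n" and E: "E \<in> carrier_mat 1 n"
    and U: "U \<in> carrier_mat n 1" "U1 \<in> carrier_mat n 1" "U2 \<in> carrier_mat n 1"
    and comb: "U = a \<cdot>\<^sub>m U1 + b \<cdot>\<^sub>m U2" and ab: "a + b = 1"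
  shows "det (X - U * E) = a * det (X - U1 * E) + b * det (X - U2 * E)"
proof -
  have "det (four_block_mat (1\<^sub>m 1) E U X)
      = a * det (four_block_mat (1\<^sub>m 1) E U1 X) + b * det (four_block_mat (1\<^sub>m 1) E U2 X)"
  proof (rule det_column_affine[of _ "1 + n" _ _ 0])
    show "four_block_mat (1\<^sub>m 1) E U X $$ (i, 0)
        = a * four_block_mat (1\<^sub>m 1) E U1 X $$ (i, 0) + b * four_block_mat (1\<^sub>m 1) E U2 X $$ (i, 0)"
      if "i < 1 + n" for i
      using that X E U ab by (auto simp: comb)
    show "four_block_mat (1\<^sub>m 1) E U1 X $$ (i, k) = four_block_mat (1\<^sub>m 1) E U X $$ (i, k) \<and>
        four_block_mat (1\<^sub>m 1) E U2 X $$ (i, k) = four_block_mat (1\<^sub>m 1) E U X $$ (i, k)"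
      if "i < 1 + n" "k < 1 + n" "k \<noteq> 0" for i k
      using that X E U by auto
  qed (use X in \<open>auto intro!: four_block_carrier_mat\<close>)
  then show ?thesis unfolding det_bordered[OF X U(1) E] det_bordered[OF X U(2) E] det_bordered[OF X U(3) E] .
qed

lemma shifted_product:
  fixes A :: "real mat"
  assumes A: "A \<in> carrier_mat n n"
  shows "(A + s \<cdot>\<^sub>m 1\<^sub>m n) * (A + t \<cdot>\<^sub>m 1\<^sub>m n) = A * A + (s + t) \<cdot>\<^sub>m A + (s * t) \<cdot>\<^sub>m 1\<^sub>m n"
proof -
  have "(A + s \<cdot>\<^sub>m 1\<^sub>m n) * (A + t \<cdot>\<^sub>m 1\<^sub>m n) = A * (A + t \<cdot>\<^sub>m 1\<^sub>m n) + (s \<cdot>\<^sub>m 1\<^sub>m n) * (A + t \<cdot>\<^sub>m 1\<^sub>m n)"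
    using A by (intro add_mult_distrib_mat[of _ n n]) auto
  also have "A * (A + t \<cdot>\<^sub>m 1\<^sub>m n) = A * A + A * (t \<cdot>\<^sub>m 1\<^sub>m n)"
    using A by (intro mult_add_distrib_mat[of _ n n]) auto
  also have "A * (t \<cdot>\<^sub>m 1\<^sub>m n) = t \<cdot>\<^sub>m A"
    unfolding mult_smult_distrib[OF A one_carrier_mat] right_mult_one_mat[OF A] ..
  also have "(s \<cdot>\<^sub>m 1\<^sub>m n) * (A + t \<cdot>\<^sub>m 1\<^sub>m n) = s \<cdot>\<^sub>m (A + t \<cdot>\<^sub>m 1\<^sub>m n)"
  proof -
    have B: "A + t \<cdot>\<^sub>m 1\<^sub>m n \<in> carrier_mat n n" using A by simp
    show ?thesis unfolding mult_smult_assoc_mat[OF one_carrier_mat B] left_mult_one_mat[OF B] ..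
  qed
  also have "A * A + t \<cdot>\<^sub>m A + s \<cdot>\<^sub>m (A + t \<cdot>\<^sub>m 1\<^sub>m n) = A * A + (s + t) \<cdot>\<^sub>m A + (s * t) \<cdot>\<^sub>m 1\<^sub>m n"
    using A by (intro eq_matI) (auto simp: algebra_simps)
  finally show ?thesis .
qed

lemma det_negate:
  assumes "(M :: real mat) \<in> carrier_mat n n"
  shows "det (- M) = (- 1) ^ n * det M"
proof -
  have "- M = (- 1) \<cdot>\<^sub>m M" by (rule eq_matI) auto
  then show ?thesis using assms det_smult[of "- 1" M] by (simp only: carrier_matD)
qed

text \<open>
  Put \<open>P = A - y\<close> and \<open>Q = A + 1 + y\<close>. The all-ones matrix is \<open>e e\<^sup>T\<close>, and \<open>x - A C\<close> with
  \<open>x = - y (y + 1)\<close> equals \<open>P Q - (A e) e\<^sup>T\<close>. Replacing \<open>A e\<close> by \<open>P e\<close> or \<open>Q e\<close> gives the products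
  \<open>P (y - C)\<close> and \<open>Q (- 1 - y - C)\<close>, whose determinants are values of characteristic polynomials.
  As \<open>A\<close> is the combination of \<open>P\<close> and \<open>Q\<close> with weights \<open>(y + 1) / (2 y + 1)\<close> and \<open>y / (2 y + 1)\<close>, which
  add up to \<open>1\<close>, the determinant is the same combination.
\<close>

lemma char_poly_product_complement:
  fixes A C :: "real mat"
  assumes A: "A \<in> carrier_mat n n" and C: "C = mat n n (\<lambda>_. 1) - 1\<^sub>m n - A"
  shows "(2 * y + 1) * poly (char_poly (A * C)) (- (y * (y + 1)))
    = (- 1) ^ n * ((y + 1) * (poly (char_poly A) y * poly (char_poly C) y)
        + y * (poly (char_poly A) (- 1 - y) * poly (char_poly C) (- 1 - y)))"
proof (cases "2 * y + 1 = 0")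
  case True
  then have "y = - 1 / 2" by simp
  then show ?thesis by simp
next
  case False
  define e where "e = mat n 1 (\<lambda>_. 1 :: real)"
  define E where "E = mat 1 n (\<lambda>_. 1 :: real)"
  define x where "x = - (y * (y + 1))"
  define P where "P = A + (- y) \<cdot>\<^sub>m 1\<^sub>m n"
  define Q where "Q = A + (1 + y) \<cdot>\<^sub>m 1\<^sub>m n"
  define X where "X = P * Q"
  have carrier: "e \<in> carrier_mat n 1" "E \<in> carrier_mat 1 n" "P \<in> carrier_mat n n" "Q \<in> carrier_mat n n"
    "C \<in> carrier_mat n n" "X \<in> carrier_mat n n"
    using A by (auto simp: e_def E_def P_def Q_def C X_def)
  have J: "mat n n (\<lambda>_. 1) = e * E"
    by (rule eq_matI) (auto simp: e_def E_def scalar_prod_def)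
  have eE: "e * E \<in> carrier_mat n n" using carrier by simp
  have X: "X = A * A + A + x \<cdot>\<^sub>m 1\<^sub>m n" "Q * P = X"
    unfolding X_def P_def Q_def shifted_product[OF A] x_def
    by (rule eq_matI; use A in \<open>auto simp: algebra_simps\<close>)+
  have "A * C = A * (e * E - 1\<^sub>m n) - A * A"
    unfolding C J by (rule mult_minus_distrib_mat[OF A minus_carrier_mat[OF one_carrier_mat] A])
  also have "A * (e * E - 1\<^sub>m n) = A * (e * E) - A"
    unfolding mult_minus_distrib_mat[OF A eE one_carrier_mat] right_mult_one_mat[OF A] ..
  also have "A * (e * E) = A * e * E" by (rule assoc_mult_mat[OF A carrier(1,2), symmetric])
  finally have AC: "A * C = A * e * E - A - A * A" .
  have "A * e * E \<in> carrier_mat n n" "A * A \<in> carrier_mat n n" using A carrier by auto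
  then have main: "X - A * e * E = x \<cdot>\<^sub>m 1\<^sub>m n - A * C"
    unfolding X(1) AC using A by (intro eq_matI) auto
  have neg: "det (A + (- z) \<cdot>\<^sub>m 1\<^sub>m n) = (- 1) ^ n * poly (char_poly A) z" for z
  proof -
    have "A + (- z) \<cdot>\<^sub>m 1\<^sub>m n = - (z \<cdot>\<^sub>m 1\<^sub>m n - A)" using A by (intro eq_matI) auto
    then show ?thesis
      using det_negate[OF minus_carrier_mat[OF A]] poly_char_poly_det[OF A] by metis
  qed
  have "X - P * e * E = P * (Q - e * E)"
    unfolding X_def mult_minus_distrib_mat[OF carrier(3,4) eE] assoc_mult_mat[OF carrier(3,1,2)] ..
  also have "Q - e * E = y \<cdot>\<^sub>m 1\<^sub>m n - C"
    unfolding Q_def C J[symmetric] using A by (intro eq_matI) auto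
  finally have detP: "det (X - P * e * E) = (- 1) ^ n * (poly (char_poly A) y * poly (char_poly C) y)"
    using det_mult[OF carrier(3) minus_carrier_mat[OF carrier(5)]] neg[of y]
    by (simp add: P_def poly_char_poly_det[OF carrier(5)])
  have "X - Q * e * E = Q * (P - e * E)"
    unfolding X(2)[symmetric] mult_minus_distrib_mat[OF carrier(4,3) eE] assoc_mult_mat[OF carrier(4,1,2)] ..
  also have "P - e * E = (- 1 - y) \<cdot>\<^sub>m 1\<^sub>m n - C"
    unfolding P_def C J[symmetric] using A by (intro eq_matI) auto
  finally have XQ: "X - Q * e * E = Q * ((- 1 - y) \<cdot>\<^sub>m 1\<^sub>m n - C)" .
  have detQ: "det (X - Q * e * E)
      = (- 1) ^ n * (poly (char_poly A) (- 1 - y) * poly (char_poly C) (- 1 - y))"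
  proof -
    have "det Q = (- 1) ^ n * poly (char_poly A) (- 1 - y)"
      using neg[of "- 1 - y"] by (simp add: Q_def add.commute)
    then show ?thesis
      unfolding XQ det_mult[OF carrier(4) minus_carrier_mat[OF carrier(5)]] poly_char_poly_det[OF carrier(5)]
      by simp
  qed
  define a where "a = (y + 1) / (2 * y + 1)"
  define b where "b = y / (2 * y + 1)"
  have scaled: "(2 * y + 1) * a = y + 1" "(2 * y + 1) * b = y" using False by (simp_all add: a_def b_def)
  have "(2 * y + 1) * (a + b) = (2 * y + 1) * 1" using scaled by (simp add: distrib_left)
  then have ab: "a + b = 1" using False mult_left_cancel by blast
  have comb0: "a * (t - y) + b * (t + (1 + y)) = t" for t
  proof -
    have "a * (t - y) + b * (t + (1 + y)) = (a + b) * t + ((1 + y) * b - y * a)"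
      by (simp add: algebra_simps)
    also have "(1 + y) * b = y * a" by (simp add: a_def b_def)
    finally show ?thesis by (simp add: ab)
  qed
  have "A = a \<cdot>\<^sub>m P + b \<cdot>\<^sub>m Q"
  proof (rule eq_matI)
    fix i j assume "i < dim_row (a \<cdot>\<^sub>m P + b \<cdot>\<^sub>m Q)" "j < dim_col (a \<cdot>\<^sub>m P + b \<cdot>\<^sub>m Q)"
    then have ij: "i < n" "j < n" using carrier by auto
    have "a * A $$ (i, j) + b * A $$ (i, j) = A $$ (i, j)"
      unfolding distrib_right[symmetric] ab by simp
    then show "A $$ (i, j) = (a \<cdot>\<^sub>m P + b \<cdot>\<^sub>m Q) $$ (i, j)"
      using ij A carrier comb0[of "A $$ (i, j)"] by (cases "i = j") (simp_all add: P_def Q_def)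
  qed (use A carrier in auto)
  then have "A * e = (a \<cdot>\<^sub>m P + b \<cdot>\<^sub>m Q) * e" by simp
  also have "\<dots> = (a \<cdot>\<^sub>m P) * e + (b \<cdot>\<^sub>m Q) * e"
    using carrier by (intro add_mult_distrib_mat[of _ n n]) auto
  finally have comb: "A * e = a \<cdot>\<^sub>m (P * e) + b \<cdot>\<^sub>m (Q * e)"
    unfolding mult_smult_assoc_mat[OF carrier(3,1)] mult_smult_assoc_mat[OF carrier(4,1)] .
  have "A * e \<in> carrier_mat n 1" "P * e \<in> carrier_mat n 1" "Q * e \<in> carrier_mat n 1"
    using A carrier by auto
  from det_rank_one_affine[OF carrier(6,2) this comb ab]
  have "poly (char_poly (A * C)) x = a * det (X - P * e * E) + b * det (X - Q * e * E)"
    unfolding main poly_char_poly_det[OF mult_carrier_mat[OF A carrier(5)]] .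
  then have "(2 * y + 1) * poly (char_poly (A * C)) x
      = (2 * y + 1) * a * det (X - P * e * E) + (2 * y + 1) * b * det (X - Q * e * E)"
    by (simp only: distrib_left mult.assoc)
  then show ?thesis unfolding detP detQ scaled x_def[symmetric] by (simp add: algebra_simps)
qed

lemma char_poly_product_complement_eq:
  fixes A C A' C' :: "real mat"
  assumes A: "A \<in> carrier_mat n n" "C = mat n n (\<lambda>_. 1) - 1\<^sub>m n - A"
    and A': "A' \<in> carrier_mat n n" "C' = mat n n (\<lambda>_. 1) - 1\<^sub>m n - A'"
    and eq: "char_poly A = char_poly A'" "char_poly C = char_poly C'"
  shows "char_poly (A * C) = char_poly (A' * C')"
proof (rule ccontr)
  assume ne: "char_poly (A * C) \<noteq> char_poly (A' * C')"
  let ?d = "char_poly (A * C) - char_poly (A' * C')"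
  have "poly ?d (- (real m * (real m + 1))) = 0" for m
  proof -
    have "(2 * real m + 1) * poly (char_poly (A * C)) (- (real m * (real m + 1)))
        = (2 * real m + 1) * poly (char_poly (A' * C')) (- (real m * (real m + 1)))"
      unfolding char_poly_product_complement[OF A] char_poly_product_complement[OF A'] eq ..
    moreover have "2 * real m + 1 \<noteq> 0" by linarith
    ultimately show ?thesis by simp
  qed
  then have "range (\<lambda>m. - (real m * (real m + 1))) \<subseteq> {x. poly ?d x = 0}" by auto
  moreover have "inj (\<lambda>m. - (real m * (real m + 1)))"
  proof (rule linorder_injI)
    fix k m :: nat assume "k < m"
    then have "real k * (real k + 1) < real m * (real m + 1)" by (intro mult_strict_mono) auto
    then show "- (real k * (real k + 1)) \<noteq> - (real m * (real m + 1))" by simp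
  qed
  then have "infinite (range (\<lambda>m. - (real m * (real m + 1))))" by (rule range_inj_infinite)
  ultimately have "?d = 0" using poly_roots_finite finite_subset by blast
  then show False using ne by simp
qed

text \<open>
  Both sides are the determinant of the block matrix with rows \<open>(x, X)\<close> and \<open>(Y, 1)\<close>, multiplied by
  \<open>x ^ k\<close>; it is computed by eliminating either block.
\<close>

lemma sylvester_char_poly:
  fixes X Y :: "real mat"
  assumes X: "X \<in> carrier_mat s k" and Y: "Y \<in> carrier_mat k s"
  shows "x ^ k * poly (char_poly (X * Y)) x = x ^ s * poly (char_poly (Y * X)) x"
proof -
  let ?M = "four_block_mat (x \<cdot>\<^sub>m 1\<^sub>m s) X Y (1\<^sub>m k)"
  let ?L = "four_block_mat (1\<^sub>m s) (- X) (0\<^sub>m k s) (1\<^sub>m k)"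
  let ?R = "four_block_mat (1\<^sub>m s) (0\<^sub>m s k) (- Y) (x \<cdot>\<^sub>m 1\<^sub>m k)"
  have M: "?M \<in> carrier_mat (s + k) (s + k)" and L: "?L \<in> carrier_mat (s + k) (s + k)"
    and R: "?R \<in> carrier_mat (s + k) (s + k)"
    by (intro four_block_carrier_mat; simp)+
  have "?L * ?M = four_block_mat (1\<^sub>m s * (x \<cdot>\<^sub>m 1\<^sub>m s) + (- X) * Y) (1\<^sub>m s * X + (- X) * 1\<^sub>m k)
      (0\<^sub>m k s * (x \<cdot>\<^sub>m 1\<^sub>m s) + 1\<^sub>m k * Y) (0\<^sub>m k s * X + 1\<^sub>m k * 1\<^sub>m k)"
    by (rule mult_four_block_mat) (use X Y in auto)
  also have "\<dots> = four_block_mat (x \<cdot>\<^sub>m 1\<^sub>m s - X * Y) (0\<^sub>m s k) Y (1\<^sub>m k)"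
    using X Y by (intro cong_four_block_mat) (auto intro!: eq_matI)
  finally have "det ?L * det ?M = det (x \<cdot>\<^sub>m 1\<^sub>m s - X * Y)"
    using X Y det_mult[OF L M]
    by (simp add: det_four_block_mat_upper_right_zero[of _ s _ k] minus_carrier_mat)
  moreover have "det ?L = 1"
    using X by (subst det_four_block_mat_lower_left_zero[of _ s _ k]) auto
  ultimately have "det ?M = poly (char_poly (X * Y)) x"
    using X Y by (simp add: poly_char_poly_det[of "X * Y" s])
  moreover have "det ?R * det ?M = x ^ s * poly (char_poly (Y * X)) x"
  proof -
    have "?R * ?M = four_block_mat (1\<^sub>m s * (x \<cdot>\<^sub>m 1\<^sub>m s) + 0\<^sub>m s k * Y) (1\<^sub>m s * X + 0\<^sub>m s k * 1\<^sub>m k)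
      (- Y * (x \<cdot>\<^sub>m 1\<^sub>m s) + (x \<cdot>\<^sub>m 1\<^sub>m k) * Y) (- Y * X + (x \<cdot>\<^sub>m 1\<^sub>m k) * 1\<^sub>m k)"
      by (rule mult_four_block_mat) (use X Y in auto)
    also have "- Y * (x \<cdot>\<^sub>m 1\<^sub>m s) + (x \<cdot>\<^sub>m 1\<^sub>m k) * Y = 0\<^sub>m k s"
      using Y by (simp add: mult_smult_distrib[of _ k s] mult_smult_assoc_mat[of _ k k])
        (auto intro!: eq_matI)
    also have "- Y * X + (x \<cdot>\<^sub>m 1\<^sub>m k) * 1\<^sub>m k = x \<cdot>\<^sub>m 1\<^sub>m k - Y * X"
      using X Y by (intro eq_matI) auto
    also have "1\<^sub>m s * (x \<cdot>\<^sub>m 1\<^sub>m s) + 0\<^sub>m s k * Y = x \<cdot>\<^sub>m 1\<^sub>m s"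
      using Y by (intro eq_matI) auto
    also have "1\<^sub>m s * X + 0\<^sub>m s k * 1\<^sub>m k = X"
      using X by (intro eq_matI) auto
    finally have "det ?R * det ?M = det (x \<cdot>\<^sub>m 1\<^sub>m s) * det (x \<cdot>\<^sub>m 1\<^sub>m k - Y * X)"
      using X Y det_mult[OF R M]
      by (simp add: det_four_block_mat_lower_left_zero[of _ s _ k] minus_carrier_mat)
    then show ?thesis using X Y by (simp add: poly_char_poly_det[of "Y * X" k])
  qed
  moreover have "det ?R = x ^ k"
    using Y by (subst det_four_block_mat_upper_right_zero[of _ s _ k]) auto
  ultimately show ?thesis by simp
qed

section \<open>Split graphs and the spectrum of the product\<close>

definition edge_weight :: "ngraph \<Rightarrow> nat \<Rightarrow> nat \<Rightarrow> real" where
  "edge_weight G u v = (if (u, v) \<in> parcs G then 1 else 0)"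

lemma adj_mat_carrier: "adj_mat G \<in> carrier_mat (card (pverts G)) (card (pverts G))"
  by (simp add: adj_mat_def Let_def)

lemma edge_weight_complement:
  assumes "sgraph G" "u \<in> pverts G" "w \<in> pverts G"
  shows "edge_weight (complement G) u w = 1 - (if u = w then 1 else 0) - edge_weight G u w"
  using assms sgraph_arcs(4)[OF assms(1)] by (auto simp: edge_weight_def complement_def)

text \<open>
  The composition of the split graph on \<open>K \<union> S\<close> with the graph on \<open>U\<close>. A graph is split if it has
  such a partition with empty core \<open>U\<close>.
\<close>

definition core_partition :: "ngraph \<Rightarrow> nat set \<Rightarrow> nat set \<Rightarrow> nat set \<Rightarrow> bool" where
  "core_partition G K S U \<longleftrightarrow> pverts G = K \<union> S \<union> U \<and> K \<inter> S = {} \<and> K \<inter> U = {} \<and> S \<inter> U = {} \<and>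
    (\<forall>u\<in>K. \<forall>v\<in>K \<union> U. u \<noteq> v \<longrightarrow> adj G u v) \<and> (\<forall>u\<in>S. \<forall>v\<in>S \<union> U. \<not> adj G u v)"

abbreviation co_weight :: "ngraph \<Rightarrow> nat \<Rightarrow> nat \<Rightarrow> real" where
  "co_weight G \<equiv> edge_weight (complement G)"

text \<open>
  The number of walks in \<open>U\<close> from \<open>u\<close> to \<open>v\<close> that follow an edge and then a non-edge. For the full
  vertex set this is the product of the adjacency matrices of the graph and its complement.
\<close>

definition alternating :: "ngraph \<Rightarrow> nat set \<Rightarrow> nat \<Rightarrow> nat \<Rightarrow> real" where
  "alternating G U u v = (\<Sum>w\<in>U. edge_weight G u w * co_weight G w v)"

definition alternating_poly :: "ngraph \<Rightarrow> nat set \<Rightarrow> real poly" where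
  "alternating_poly G U = list_char_poly (sorted_list_of_set U) (alternating G U)"

lemma adj_mat_eq_list_mat:
  "adj_mat G = list_mat (sorted_list_of_set (pverts G)) (sorted_list_of_set (pverts G)) (edge_weight G)"
  by (auto simp: adj_mat_def list_mat_def edge_weight_def Let_def)

lemma char_poly_adj_mat_product:
  "sgraph G \<Longrightarrow> char_poly (adj_mat G * adj_mat (complement G)) = alternating_poly G (pverts G)"
  using sgraph_arcs(1)[of G]
  by (simp add: adj_mat_eq_list_mat alternating_poly_def complement_def[of G, THEN arg_cong[where f = pverts]]
      list_mat_mult alternating_def[abs_def])

lemma alternating_nonneg: "alternating G U u v \<ge> 0"
  unfolding alternating_def by (intro sum_nonneg) (simp add: edge_weight_def)

lemma edge_weight_commute: "sgraph G \<Longrightarrow> edge_weight G u v = edge_weight G v u"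
  using sgraph_arcs(3)[of G] by (auto simp: edge_weight_def)

text \<open>
  Order the vertices as \<open>S\<close>, \<open>U\<close>, \<open>K\<close>. A walk along an edge and then a non-edge can leave \<open>K\<close> for
  \<open>U\<close> or \<open>S\<close> and \<open>U\<close> for \<open>S\<close>, but not the other way, so the product matrix is block triangular.
  The two outer blocks are \<open>B\<^sup>T C\<close> and \<open>B C\<^sup>T\<close> for the two bipartite adjacency matrices between
  \<open>K\<close> and \<open>S\<close>, and these have the same nonzero spectrum.
\<close>

lemma alternating_poly_core_partition:
  assumes G: "sgraph G" and core: "core_partition G K S U" and x: "x > 0"
  obtains c where "c \<ge> 0" "poly (alternating_poly G (pverts G)) x = c * poly (alternating_poly G U) x"
proof -
  have V: "pverts G = K \<union> S \<union> U" and disj: "K \<inter> S = {}" "K \<inter> U = {}" "S \<inter> U = {}"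
    and K: "\<And>u v. u \<in> K \<Longrightarrow> v \<in> K \<union> U \<Longrightarrow> u \<noteq> v \<Longrightarrow> adj G u v"
    and S: "\<And>u v. u \<in> S \<Longrightarrow> v \<in> S \<union> U \<Longrightarrow> \<not> adj G u v"
    using core unfolding core_partition_def by blast+
  note Gc = sgraph_complement[OF G]
  have fin: "finite K" "finite S" "finite U" using sgraph_arcs(1)[OF G] V by auto
  let ?e = "edge_weight G" and ?c = "co_weight G"
  have K_c: "?c u v = 0" "?c v u = 0" if "u \<in> K" "v \<in> K \<union> U" for u v
    using K[OF that] sgraph_arcs(3)[OF G, of u v] by (auto simp: edge_weight_def complement_def)
  have S_e: "?e u v = 0" "?e v u = 0" if "u \<in> S" "v \<in> S \<union> U" for u v
    using S[OF that] sgraph_arcs(3)[OF G, of v u] by (auto simp: edge_weight_def)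
  have sum: "alternating G (pverts G) u v
      = (\<Sum>w\<in>K. ?e u w * ?c w v) + (\<Sum>w\<in>S. ?e u w * ?c w v) + (\<Sum>w\<in>U. ?e u w * ?c w v)" for u v
    unfolding alternating_def V using fin disj by (subst sum.union_disjoint; auto)+
  have SS: "alternating G (pverts G) u v = (\<Sum>w\<in>K. ?e u w * ?c w v)" if "u \<in> S" for u v
    unfolding sum using S_e[OF that] by simp
  have KK: "alternating G (pverts G) u v = (\<Sum>w\<in>S. ?e u w * ?c w v)" if "v \<in> K" for u v
    unfolding sum using K_c[OF that] by simp
  have UU: "alternating G (pverts G) u v = alternating G U u v" if "u \<in> U" "v \<in> U" for u v
    unfolding sum using K_c(1)[of _ v] S_e(2)[of _ u] that by (simp add: alternating_def)
  have zero: "alternating G (pverts G) u v = 0" if "u \<in> S \<and> v \<in> U \<union> K \<or> u \<in> U \<and> v \<in> K" for u v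
    using that
  proof
    assume "u \<in> S \<and> v \<in> U \<union> K"
    then show ?thesis using SS[of u v] K_c(1)[of _ v] by auto
  next
    assume "u \<in> U \<and> v \<in> K"
    then show ?thesis using KK[of v u] S_e(2)[of _ u] by auto
  qed
  let ?ks = "sorted_list_of_set K" and ?ss = "sorted_list_of_set S" and ?us = "sorted_list_of_set U"
  let ?N = "alternating G (pverts G)"
  have "alternating_poly G (pverts G) = list_char_poly (?ss @ (?us @ ?ks)) ?N"
    unfolding alternating_poly_def using fin disj sgraph_arcs(1)[OF G]
    by (intro list_char_poly_reorder) (auto simp: V)
  then have split: "poly (alternating_poly G (pverts G)) x
      = poly (list_char_poly ?ss ?N) x * (poly (list_char_poly ?us ?N) x * poly (list_char_poly ?ks ?N) x)"
    using fin zero list_char_poly_block[of ?ss "?us @ ?ks" ?N x] list_char_poly_block[of ?us ?ks ?N x]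
    by simp
  have U: "list_char_poly ?us ?N = alternating_poly G U"
    unfolding alternating_poly_def using fin UU by (intro arg_cong[of _ _ char_poly] list_mat_cong) simp
  define X where "X = list_mat ?ss ?ks ?e"
  define Y where "Y = list_mat ?ks ?ss ?c"
  have carrier: "X \<in> carrier_mat (card S) (card K)" "Y \<in> carrier_mat (card K) (card S)"
    using list_mat_carrier[of ?ss ?ks ?e] list_mat_carrier[of ?ks ?ss ?c] fin by (simp_all add: X_def Y_def)
  have "list_mat ?ss ?ss ?N = X * Y"
    unfolding X_def Y_def using fin SS by (subst list_mat_mult) (auto intro!: list_mat_cong)
  then have pS: "list_char_poly ?ss ?N = char_poly (X * Y)" by simp
  have "transpose_mat (list_mat ?ks ?ks ?N) = list_mat ?ks ?ks (\<lambda>u v. ?N v u)"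
    by (intro eq_matI) auto
  also have "\<dots> = Y * X"
    unfolding X_def Y_def using fin KK edge_weight_commute[OF G] edge_weight_commute[OF Gc]
    by (subst list_mat_mult) (auto intro!: list_mat_cong sum.cong)
  finally have pK: "list_char_poly ?ks ?N = char_poly (Y * X)"
    using char_poly_transpose_mat[OF list_mat_carrier, of ?ks ?N] by simp
  let ?c = "poly (char_poly (X * Y)) x * poly (char_poly (Y * X)) x"
  have "x ^ card K * ?c = x ^ card S * (poly (char_poly (Y * X)) x) ^ 2"
    using sylvester_char_poly[OF carrier, of x] by (simp add: power2_eq_square)
  moreover have "x ^ card S * (poly (char_poly (Y * X)) x) ^ 2 \<ge> 0" using x by simp
  ultimately have "x ^ card K * ?c \<ge> 0" by simp
  moreover have "x ^ card K > 0" using x by simp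
  ultimately have "?c \<ge> 0" using zero_le_mult_iff[of "x ^ card K" ?c] by linarith
  then show ?thesis using split unfolding U pS pK by (intro that[of ?c]) simp_all
qed

lemma alternating_poly_empty: "alternating_poly G {} = 1"
  by (simp add: alternating_poly_def char_poly_def char_poly_matrix_def list_mat_def det_def)

text \<open>
  Let the core be as small as possible. If it were not irreducible, the vertices reachable from some
  vertex by alternating walks would enlarge the clique and the independent set: after an edge a
  vertex is forced into the clique once its neighbour is in the independent set, after a non-edge
  conversely. When a vertex is forced to both sides, the states that are not reachable are
  consistent instead, by reversing walks.
\<close>

lemma minimal_core_irreducible:
  assumes G: "sgraph G" and core: "core_partition G K S U"
    and min: "\<And>K' S' U'. core_partition G K' S' U' \<Longrightarrow> card U \<le> card U'"
  shows "irreducible_kernel U (alternating G U)"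
  unfolding irreducible_kernel_def
proof (intro ballI)
  fix v w assume v: "v \<in> U" and w: "w \<in> U"
  note sym = sgraph_arcs(3)[OF G] and irr = sgraph_arcs(4)[OF G]
  have V: "pverts G = K \<union> S \<union> U" and disj: "K \<inter> S = {}" "K \<inter> U = {}" "S \<inter> U = {}"
    and K: "\<And>u v. u \<in> K \<Longrightarrow> v \<in> K \<union> U \<Longrightarrow> u \<noteq> v \<Longrightarrow> adj G u v"
    and S: "\<And>u v. u \<in> S \<Longrightarrow> v \<in> S \<union> U \<Longrightarrow> \<not> adj G u v"
    using core unfolding core_partition_def by blast+
  have finU: "finite U" using sgraph_arcs(1)[OF G] V by auto
  define closed where "closed R1 R0 \<longleftrightarrow> R1 \<subseteq> U \<and> R0 \<subseteq> U \<and>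
    (\<forall>y\<in>R1. \<forall>z\<in>U. adj G y z \<longrightarrow> z \<in> R0) \<and> (\<forall>z\<in>R0. \<forall>y\<in>U. z \<noteq> y \<and> \<not> adj G z y \<longrightarrow> y \<in> R1)" for R1 R0
  have no_consistent: "R1 = {} \<and> R0 = {}" if c: "closed R1 R0" and d: "R1 \<inter> R0 = {}" for R1 R0
  proof (rule ccontr)
    assume ne: "\<not> ?thesis"
    let ?U = "U - (R0 \<union> R1)"
    have sub: "R1 \<subseteq> U" "R0 \<subseteq> U"
      and R1: "\<And>y z. y \<in> R1 \<Longrightarrow> z \<in> U \<Longrightarrow> adj G y z \<Longrightarrow> z \<in> R0"
      and R0: "\<And>z y. z \<in> R0 \<Longrightarrow> y \<in> U \<Longrightarrow> z \<noteq> y \<Longrightarrow> \<not> adj G z y \<Longrightarrow> y \<in> R1"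
      using c unfolding closed_def by blast+
    have "adj G u z" if uz: "u \<in> K \<union> R0" "z \<in> (K \<union> R0) \<union> ?U" "u \<noteq> z" for u z
    proof -
      consider "u \<in> K" | "u \<in> R0" "z \<in> K" | "u \<in> R0" "z \<in> U" "z \<notin> R1"
        using uz sub d by blast
      then show ?thesis
      proof cases
        case 1
        moreover have "z \<in> K \<union> U" using uz(2) sub by blast
        ultimately show ?thesis using uz(3) by (rule K)
      next
        case 2
        then have "adj G z u" using sub uz(3) by (intro K) auto
        then show ?thesis by (rule sym)
      next
        case 3
        then show ?thesis using R0[of u z] uz(3) by metis
      qed
    qed
    moreover have "\<not> adj G u z" if uz: "u \<in> S \<union> R1" "z \<in> (S \<union> R1) \<union> ?U" for u z
    proof -
      consider "u \<in> S" | "u \<in> R1" "z \<in> S" | "u \<in> R1" "z \<in> U" "z \<notin> R0"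
        using uz sub d by blast
      then show ?thesis
      proof cases
        case 1
        moreover have "z \<in> S \<union> U" using uz(2) sub by blast
        ultimately show ?thesis by (rule S)
      next
        case 2
        then have "\<not> adj G z u" using sub by (intro S) auto
        then show ?thesis using sym by metis
      next
        case 3
        then show ?thesis using R1[of u z] by metis
      qed
    qed
    ultimately have "core_partition G (K \<union> R0) (S \<union> R1) ?U"
      unfolding core_partition_def
    proof (intro conjI ballI impI)
      show "pverts G = (K \<union> R0) \<union> (S \<union> R1) \<union> ?U" using V sub by auto
      show "(K \<union> R0) \<inter> (S \<union> R1) = {}" using disj sub d by auto
    qed (use disj in auto)
    then have "card U \<le> card ?U" by (rule min)
    moreover have "?U \<subset> U" using ne sub by blast
    then have "card ?U < card U" by (rule psubset_card_mono[OF finU])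
    ultimately show False by simp
  qed
  define R1 where "R1 = {y. (v, y) \<in> (support_rel U (alternating G U))\<^sup>*}"
  define R0 where "R0 = {z \<in> U. \<exists>y\<in>R1. adj G y z}"
  have R1U: "R1 \<subseteq> U"
  proof
    fix y assume "y \<in> R1"
    then have "(v, y) \<in> (support_rel U (alternating G U))\<^sup>*" by (simp add: R1_def)
    then show "y \<in> U" by (cases rule: rtranclE) (use v in \<open>auto simp: support_rel_def\<close>)
  qed
  have step: "y' \<in> R1" if "y \<in> R1" "z \<in> U" "adj G y z" "y' \<in> U" "z \<noteq> y'" "\<not> adj G z y'" for y z y'
  proof -
    have "0 < edge_weight G y z * co_weight G z y'"
      using that V by (auto simp: edge_weight_def complement_def)
    also have "\<dots> \<le> alternating G U y y'"
      unfolding alternating_def using that finU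
      by (intro member_le_sum[of z U "\<lambda>z. edge_weight G y z * co_weight G z y'"])
        (auto simp: edge_weight_def)
    finally have "(y, y') \<in> support_rel U (alternating G U)"
      using that R1U by (auto simp: support_rel_def)
    then show ?thesis using that(1) by (simp add: R1_def)
  qed
  have cl: "closed R1 R0"
    unfolding closed_def using R1U step by (auto simp: R0_def)
  have "R1 = U"
  proof (rule ccontr)
    assume proper: "R1 \<noteq> U"
    have "v \<in> R1" by (simp add: R1_def)
    then have "R1 \<inter> R0 \<noteq> {}" using no_consistent[OF cl] by blast
    then obtain x where x: "x \<in> R1" "x \<in> R0" by blast
    have "closed (U - R0) (U - R1)"
      unfolding closed_def
    proof (intro conjI ballI impI)
      fix y z assume y: "y \<in> U - R0" and z: "z \<in> U" "adj G y z"
      have "z \<notin> R1" using cl y sym[OF z(2)] unfolding closed_def by auto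
      then show "z \<in> U - R1" using z(1) by simp
    next
      fix z y assume z: "z \<in> U - R1" and y: "y \<in> U" "z \<noteq> y \<and> \<not> adj G z y"
      have "\<not> adj G y z" using y(2) sym by metis
      then have "y \<notin> R0" using cl z y(2) unfolding closed_def by auto
      then show "y \<in> U - R0" using y(1) by simp
    qed auto
    moreover have "(U - R0) \<inter> (U - R1) = {}"
    proof (rule ccontr)
      assume "\<not> ?thesis"
      then obtain y where y: "y \<in> U" "y \<notin> R0" "y \<notin> R1" by blast
      then have "x \<noteq> y" using x by blast
      then show False using cl x y unfolding closed_def by blast
    qed
    ultimately have "U - R1 = {}" using no_consistent by blast
    then show False using proper R1U by blast
  qed
  then have "w \<in> R1" using w by simp
  then show "(v, w) \<in> (support_rel U (alternating G U))\<^sup>*" by (simp only: R1_def mem_Collect_eq)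
qed

text \<open>
  A core with a single vertex could be added to the clique.
\<close>

lemma not_split_core:
  assumes G: "sgraph G" and ns: "\<not> split_graph G" and core: "core_partition G K S U"
  shows "card U \<ge> 2"
proof (rule ccontr)
  assume small: "\<not> card U \<ge> 2"
  have V: "pverts G = K \<union> S \<union> U" and disj: "K \<inter> S = {}" "K \<inter> U = {}" "S \<inter> U = {}"
    and K: "\<And>u v. u \<in> K \<Longrightarrow> v \<in> K \<union> U \<Longrightarrow> u \<noteq> v \<Longrightarrow> adj G u v"
    and S: "\<And>u v. u \<in> S \<Longrightarrow> v \<in> S \<union> U \<Longrightarrow> \<not> adj G u v"
    using core unfolding core_partition_def by blast+
  have finU: "finite U" using sgraph_arcs(1)[OF G] V by auto
  have "card U \<le> Suc 0" using small by simp
  then have single: "u = v" if "u \<in> U" "v \<in> U" for u v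
    using that card_le_Suc0_iff_eq[OF finU] by blast
  have "split_graph G"
  unfolding split_graph_def
  proof (rule conjI[OF G], rule exI[of _ "K \<union> U"], rule exI[of _ S], intro conjI ballI impI)
    show "adj G u v" if uv: "u \<in> K \<union> U" "v \<in> K \<union> U" "u \<noteq> v" for u v
    proof (cases "u \<in> K")
      case True
      then show ?thesis using uv(2,3) by (rule K)
    next
      case False
      then have "v \<in> K" using uv single[of u v] by auto
      then have "adj G v u" using uv by (intro K) auto
      then show ?thesis by (rule sgraph_arcs(3)[OF G])
    qed
    show "\<not> adj G u v" if "u \<in> S" "v \<in> S" for u v
      using that by (intro S) auto
    show "pverts G = K \<union> U \<union> S" "(K \<union> U) \<inter> S = {}" using V disj by auto
  qed
  then show False using ns by simp
qed

text \<open>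
  Just below the Perron root of a minimal core, the factor of the core is negative and the remaining
  factor is nonnegative, so the product can only be nonnegative if it vanishes on an interval.
\<close>

theorem split_graph_if_alternating_poly_nonneg:
  assumes G: "sgraph G" and pos: "\<And>x. x > 0 \<Longrightarrow> poly (alternating_poly G (pverts G)) x \<ge> 0"
  shows "split_graph G"
proof (rule ccontr)
  assume ns: "\<not> split_graph G"
  define P where "P U \<longleftrightarrow> (\<exists>K S. core_partition G K S U)" for U
  have "P (pverts G)" unfolding P_def core_partition_def by (intro exI[of _ "{}"]) simp
  then obtain U where U: "P U" "\<And>U'. P U' \<Longrightarrow> card U \<le> card U'"
    using ex_has_least_nat[of P "pverts G" card] by blast
  then obtain K S where core: "core_partition G K S U" by (auto simp: P_def)
  have "finite U" using sgraph_arcs(1)[OF G] core unfolding core_partition_def by (metis finite_Un)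
  have card: "card U \<ge> 2" by (rule not_split_core[OF G ns core])
  have irred: "irreducible_kernel U (alternating G U)"
    using U(2) by (intro minimal_core_irreducible[OF G core]) (auto simp: P_def)
  interpret nonneg_irreducible U "alternating G U"
    using \<open>finite U\<close> card irred alternating_nonneg by unfold_locales auto
  obtain \<rho> \<delta> where rho: "\<rho> > 0" "\<delta> > 0"
    and neg: "\<And>x. \<rho> - \<delta> < x \<Longrightarrow> x < \<rho> \<Longrightarrow> poly (alternating_poly G U) x < 0"
    unfolding alternating_poly_def
    by (rule char_poly_neg_below_perron_root[of "sorted_list_of_set U"]) (use \<open>finite U\<close> card in auto)
  have "poly (alternating_poly G (pverts G)) x = 0" if x: "max 0 (\<rho> - \<delta>) < x" "x < \<rho>" for x
  proof -
    obtain c where c: "c \<ge> 0" "poly (alternating_poly G (pverts G)) x = c * poly (alternating_poly G U) x"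
      by (rule alternating_poly_core_partition[OF G core, of x]) (use x in auto)
    have "c * poly (alternating_poly G U) x \<le> 0"
      using c(1) neg[of x] x by (intro mult_nonneg_nonpos) auto
    then show ?thesis using pos[of x] x c(2) by simp
  qed
  then have "{max 0 (\<rho> - \<delta>)<..<\<rho>} \<subseteq> {x. poly (alternating_poly G (pverts G)) x = 0}" by auto
  moreover have "infinite {max 0 (\<rho> - \<delta>)<..<\<rho>}" using rho by (intro infinite_Ioo) simp
  ultimately have "alternating_poly G (pverts G) = 0" using poly_roots_finite finite_subset by blast
  moreover have "lead_coeff (alternating_poly G (pverts G)) = 1"
    unfolding alternating_poly_def using degree_monic_char_poly[OF list_mat_carrier] by metis
  ultimately show False by simp
qed

lemma split_graph_alternating_poly_nonneg:
  assumes "split_graph G" "x > 0"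
  shows "poly (alternating_poly G (pverts G)) x \<ge> 0"
proof -
  obtain K S where G: "sgraph G" and core: "core_partition G K S {}"
    using assms(1) unfolding split_graph_def core_partition_def by auto
  obtain c where "c \<ge> 0" "poly (alternating_poly G (pverts G)) x = c * poly (alternating_poly G {}) x"
    by (rule alternating_poly_core_partition[OF G core assms(2)])
  then show ?thesis by (simp add: alternating_poly_empty)
qed

lemma adj_mat_complement:
  assumes "sgraph G"
  shows "adj_mat (complement G)
    = mat (card (pverts G)) (card (pverts G)) (\<lambda>_. 1) - 1\<^sub>m (card (pverts G)) - adj_mat G"
proof -
  let ?vs = "sorted_list_of_set (pverts G)"
  have fin: "finite (pverts G)" by (rule sgraph_arcs(1)[OF assms])
  have nth: "?vs ! i \<in> pverts G" if "i < card (pverts G)" for i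
    using nth_mem[of i ?vs] that fin by simp
  have eq: "?vs ! i = ?vs ! j \<longleftrightarrow> i = j" if "i < card (pverts G)" "j < card (pverts G)" for i j
    using that fin by (simp add: nth_eq_iff_index_eq)
  have "pverts (complement G) = pverts G" by (simp add: complement_def)
  then show ?thesis
    unfolding adj_mat_eq_list_mat using fin
    by (intro eq_matI) (simp_all add: edge_weight_complement[OF assms] nth eq)
qed

theorem split_graphs_generalized_spectrally_closed:
  "generalized_spectrally_closed {G. split_graph G}"
  unfolding generalized_spectrally_closed_def
proof (intro ballI allI impI)
  fix G H assume "G \<in> {G. split_graph G}" and H: "sgraph H \<and> generalized_cospectral H G"
  then have split: "split_graph G" by simp
  then have G: "sgraph G" by (simp add: split_graph_def)
  have sH: "sgraph H" and eq: "char_poly (adj_mat H) = char_poly (adj_mat G)"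
    "char_poly (adj_mat (complement H)) = char_poly (adj_mat (complement G))"
    using H by (simp_all add: generalized_cospectral_def cospectral_def)
  have card: "card (pverts H) = card (pverts G)"
    using degree_monic_char_poly[OF adj_mat_carrier, of H] degree_monic_char_poly[OF adj_mat_carrier, of G]
      eq(1) by simp
  have "char_poly (adj_mat H * adj_mat (complement H)) = char_poly (adj_mat G * adj_mat (complement G))"
    by (rule char_poly_product_complement_eq[of _ "card (pverts G)"])
      (use adj_mat_carrier[of G] adj_mat_carrier[of H] adj_mat_complement[OF G]
        adj_mat_complement[OF sH] eq card in simp_all)
  then have "alternating_poly H (pverts H) = alternating_poly G (pverts G)"
    unfolding char_poly_adj_mat_product[OF sH] char_poly_adj_mat_product[OF G] .
  then have "split_graph H"
    using split_graph_alternating_poly_nonneg[OF split]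
    by (intro split_graph_if_alternating_poly_nonneg[OF sH]) simp
  then show "H \<in> {G. split_graph G}" by simp
qed

section \<open>Walks in a graph\<close>

definition indic :: "'a set \<Rightarrow> 'a \<Rightarrow> real" where
  "indic U = (\<lambda>u. if u \<in> U then 1 else 0)"

definition point :: "'a \<Rightarrow> 'a \<Rightarrow> real" where
  "point v = (\<lambda>u. if u = v then 1 else 0)"

text \<open>
  Closed forms for \<open>1\<^sup>T A\<^sup>i M A\<^sup>r 1\<close> and for the trace of \<open>A\<^sup>r M\<close>, where \<open>M\<close> is the product of a word,
  in terms of \<open>W j = 1\<^sup>T A\<^sup>j 1\<close> and \<open>t j = tr A\<^sup>j\<close>. A letter \<open>0\<close> stands for \<open>J - I - A\<close>, and the all-ones
  matrix \<open>J\<close> splits a product into two factors.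
\<close>

primrec walk_form :: "(nat \<Rightarrow> real) \<Rightarrow> bool list \<Rightarrow> nat \<Rightarrow> nat \<Rightarrow> real" where
  "walk_form W [] i r = W (i + r)"
| "walk_form W (b # \<beta>) i r =
     (if b then walk_form W \<beta> (Suc i) r
      else W i * walk_form W \<beta> 0 r - walk_form W \<beta> i r - walk_form W \<beta> (Suc i) r)"

primrec word_trace :: "(nat \<Rightarrow> real) \<Rightarrow> (nat \<Rightarrow> real) \<Rightarrow> bool list \<Rightarrow> nat \<Rightarrow> real" where
  "word_trace t W [] r = t r"
| "word_trace t W (b # \<beta>) r =
     (if b then word_trace t W \<beta> (Suc r)
      else walk_form W \<beta> 0 r - word_trace t W \<beta> r - word_trace t W \<beta> (Suc r))"

locale weighted_graph =
  fixes V :: "'a set" and a :: "'a \<Rightarrow> 'a \<Rightarrow> real"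
  assumes fin: "finite V"
    and sym: "a u w = a w u"
    and outside: "u \<notin> V \<Longrightarrow> a u w = 0"
begin

definition A :: "('a \<Rightarrow> real) \<Rightarrow> 'a \<Rightarrow> real" where
  "A f = (\<lambda>u. \<Sum>w\<in>V. a u w * f w)"

definition inner :: "('a \<Rightarrow> real) \<Rightarrow> ('a \<Rightarrow> real) \<Rightarrow> real" (infix \<open>\<bullet>\<bullet>\<close> 70) where
  "f \<bullet>\<bullet> g = (\<Sum>v\<in>V. f v * g v)"

definition closed_walks :: "nat \<Rightarrow> real" where
  "closed_walks j = (\<Sum>v\<in>V. (A ^^ j) (point v) v)"

definition walks :: "nat \<Rightarrow> real" where
  "walks j = indic V \<bullet>\<bullet> (A ^^ j) (indic V)"

primrec word_op :: "bool list \<Rightarrow> ('a \<Rightarrow> real) \<Rightarrow> 'a \<Rightarrow> real" where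
  "word_op [] f = f"
| "word_op (b # \<beta>) f =
     (if b then A (word_op \<beta> f)
      else (\<lambda>u. (indic V \<bullet>\<bullet> word_op \<beta> f) * indic V u - word_op \<beta> f u - A (word_op \<beta> f) u))"

lemma A_linear: "A (\<lambda>u. c * f u - g u - h u) = (\<lambda>u. c * A f u - A g u - A h u)"
  by (simp add: A_def sum_subtractf sum_distrib_left right_diff_distrib mult.left_commute)

lemma A_sum: "A (\<lambda>u. \<Sum>x\<in>X. c x * f x u) = (\<lambda>u. \<Sum>x\<in>X. c x * A (f x) u)"
  unfolding A_def sum_distrib_left by (subst sum.swap) (simp add: mult_ac)

lemma A_pow_linear:
  "(A ^^ i) (\<lambda>u. c * f u - g u - h u) = (\<lambda>u. c * (A ^^ i) f u - (A ^^ i) g u - (A ^^ i) h u)"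
  by (induction i) (simp_all add: A_linear)

lemma A_pow_sum: "(A ^^ i) (\<lambda>u. \<Sum>x\<in>X. c x * f x u) = (\<lambda>u. \<Sum>x\<in>X. c x * (A ^^ i) (f x) u)"
  by (induction i) (simp_all add: A_sum)

lemma A_pow_Suc: "(A ^^ i) (A f) = (A ^^ Suc i) f"
  by (simp add: funpow_swap1)

lemma inner_commute: "f \<bullet>\<bullet> g = g \<bullet>\<bullet> f"
  by (simp add: inner_def mult.commute)

lemma inner_linear: "f \<bullet>\<bullet> (\<lambda>u. c * g u - h u - k u) = c * (f \<bullet>\<bullet> g) - f \<bullet>\<bullet> h - f \<bullet>\<bullet> k"
  by (simp add: inner_def sum_subtractf sum_distrib_left right_diff_distrib mult.left_commute)

lemma inner_sum: "f \<bullet>\<bullet> (\<lambda>u. \<Sum>x\<in>X. c x * g x u) = (\<Sum>x\<in>X. c x * (f \<bullet>\<bullet> g x))"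
  unfolding inner_def sum_distrib_left by (subst sum.swap) (simp add: mult_ac)

lemma A_selfadjoint: "A f \<bullet>\<bullet> g = f \<bullet>\<bullet> A g"
  unfolding inner_def A_def sum_distrib_left sum_distrib_right
  by (subst sum.swap) (simp add: sym mult_ac)

lemma A_outside: "u \<notin> V \<Longrightarrow> A f u = 0"
  by (simp add: A_def outside)

lemma A_pow_outside: "u \<notin> V \<Longrightarrow> f u = 0 \<Longrightarrow> (A ^^ j) f u = 0"
  by (cases j) (simp_all add: A_outside)

lemma point_expansion:
  assumes "\<And>u. u \<notin> U \<Longrightarrow> f u = 0" "finite U"
  shows "(\<lambda>u. \<Sum>v\<in>U. f v * point v u) = f"
proof
  fix u
  show "(\<Sum>v\<in>U. f v * point v u) = f u"
    using assms by (cases "u \<in> U") (simp_all add: point_def if_distrib sum.delta cong: if_cong)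
qed

lemma inner_point: "v \<in> V \<Longrightarrow> f \<bullet>\<bullet> point v = f v"
  using fin by (simp add: inner_def point_def if_distrib sum.delta cong: if_cong)

lemma word_op_sum:
  "word_op \<beta> (\<lambda>u. \<Sum>x\<in>X. c x * f x u) = (\<lambda>u. \<Sum>x\<in>X. c x * word_op \<beta> (f x) u)"
proof (induction \<beta>)
  case (Cons b \<beta>)
  then show ?case
    by (simp add: A_sum inner_sum sum_subtractf sum_distrib_right right_diff_distrib mult.assoc)
qed simp

lemma inner_word_op:
  "indic V \<bullet>\<bullet> (A ^^ i) (word_op \<beta> ((A ^^ r) (indic V))) = walk_form walks \<beta> i r"
proof (induction \<beta> arbitrary: i)
  case Nil
  then show ?case by (simp add: walks_def funpow_add)
next
  case (Cons b \<beta>)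
  show ?case
  proof (cases b)
    case True
    then show ?thesis using Cons[of "Suc i"] by (simp add: funpow_swap1)
  next
    case False
    then show ?thesis
      using Cons[of "Suc i"] Cons[of i] Cons[of 0]
      by (simp add: A_pow_linear inner_linear A_pow_Suc del: funpow.simps)
         (simp add: walks_def)
  qed
qed

lemma trace_word_op:
  "(\<Sum>v\<in>V. (A ^^ r) (word_op \<beta> (point v)) v) = word_trace closed_walks walks \<beta> r"
proof (induction \<beta> arbitrary: r)
  case Nil
  then show ?case by (simp add: closed_walks_def)
next
  case (Cons b \<beta>)
  show ?case
  proof (cases b)
    case True
    then show ?thesis using Cons[of "Suc r"] by (simp add: funpow_swap1)
  next
    case False
    let ?e = "(A ^^ r) (indic V)"
    have "(\<Sum>v\<in>V. (indic V \<bullet>\<bullet> word_op \<beta> (point v)) * ?e v)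
        = indic V \<bullet>\<bullet> word_op \<beta> (\<lambda>u. \<Sum>v\<in>V. ?e v * point v u)"
      unfolding word_op_sum inner_sum by (simp add: mult.commute)
    also have "(\<lambda>u. \<Sum>v\<in>V. ?e v * point v u) = ?e"
      by (rule point_expansion) (auto simp: A_pow_outside indic_def fin)
    also have "indic V \<bullet>\<bullet> word_op \<beta> ?e = walk_form walks \<beta> 0 r"
      using inner_word_op[of 0] by simp
    finally show ?thesis
      using False Cons[of "Suc r"] Cons[of r]
      by (simp add: A_pow_linear A_pow_Suc sum_subtractf del: funpow.simps)
  qed
qed

end

subsection \<open>Words in the adjacency matrix of a graph\<close>

lemma weighted_graph_edge_weight:
  assumes "sgraph G"
  shows "weighted_graph (pverts G) (edge_weight G)"
  using sgraph_arcs[OF assms] by unfold_locales (auto simp: edge_weight_def)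

lemma sum_sorted_list_nth:
  fixes V :: "nat set"
  assumes "finite V"
  shows "(\<Sum>i<card V. f (sorted_list_of_set V ! i)) = sum f V"
proof -
  have "bij_betw ((!) (sorted_list_of_set V)) {..<card V} V"
    using assms by (intro bij_betw_nth) auto
  then show ?thesis by (rule sum.reindex_bij_betw)
qed

lemma letter_mat_carrier: "letter_mat G b \<in> carrier_mat (card (pverts G)) (card (pverts G))"
  using adj_mat_carrier[of G] adj_mat_carrier[of "complement G"]
  by (simp add: letter_mat_def complement_def)

lemma letter_mat_index:
  assumes "i < card (pverts G)" "j < card (pverts G)"
  defines "vs \<equiv> sorted_list_of_set (pverts G)"
  shows "letter_mat G b $$ (i, j) = edge_weight (if b then G else complement G) (vs ! i) (vs ! j)"
  using assms by (auto simp: letter_mat_def adj_mat_def edge_weight_def Let_def complement_def)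

lemma walk_count_eq_word_trace:
  assumes G: "sgraph G"
  defines "V \<equiv> pverts G" and "a \<equiv> edge_weight G"
  shows "walk_count \<beta> G
    = word_trace (weighted_graph.closed_walks V a) (weighted_graph.walks V a) \<beta> 0"
proof -
  interpret weighted_graph V a
    unfolding V_def a_def by (rule weighted_graph_edge_weight[OF G])
  define vs where "vs = sorted_list_of_set V"
  define n where "n = card V"
  have vs: "vs ! i \<in> V" if "i < n" for i
    using that fin nth_mem[of i vs] by (simp add: vs_def n_def)
  let ?P = "\<lambda>\<beta>. foldr (\<lambda>b P. letter_mat G b * P) \<beta> (1\<^sub>m n)"
  have carrier: "?P \<beta> \<in> carrier_mat n n" for \<beta>
    using letter_mat_carrier[of G] unfolding n_def V_def
    by (induction \<beta>) (simp_all add: mult_carrier_mat[of _ _ "card (pverts G)"])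
  have entry: "?P \<beta> $$ (i, j) = word_op \<beta> (point (vs ! j)) (vs ! i)" if "i < n" "j < n" for \<beta> i j
    using that
  proof (induction \<beta> arbitrary: i)
    case Nil
    then show ?case using fin
      by (auto simp: point_def vs_def n_def nth_eq_iff_index_eq)
  next
    case (Cons b \<beta>)
    let ?f = "word_op \<beta> (point (vs ! j))"
    let ?L = "edge_weight (if b then G else complement G)"
    have "?P (b # \<beta>) $$ (i, j) = (\<Sum>k<n. letter_mat G b $$ (i, k) * ?P \<beta> $$ (k, j))"
      using Cons.prems carrier[of \<beta>] letter_mat_carrier[of G b]
      by (simp add: scalar_prod_def n_def V_def atLeast0LessThan)
    also have "\<dots> = (\<Sum>k<n. ?L (vs ! i) (vs ! k) * ?f (vs ! k))"
      using Cons by (intro sum.cong) (auto simp: letter_mat_index n_def V_def vs_def)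
    also have "\<dots> = (\<Sum>w\<in>V. ?L (vs ! i) w * ?f w)"
      unfolding n_def vs_def by (rule sum_sorted_list_nth[OF fin])
    also have "\<dots> = word_op (b # \<beta>) (point (vs ! j)) (vs ! i)"
    proof (cases b)
      case True
      then show ?thesis by (simp add: A_def) (simp add: a_def)
    next
      case False
      have compl: "?L (vs ! i) w = 1 - (if vs ! i = w then 1 else 0) - a (vs ! i) w" if "w \<in> V" for w
        using False vs[OF Cons.prems(1)] that unfolding a_def V_def
        by (simp add: edge_weight_complement[OF G])
      have "(\<Sum>w\<in>V. ?L (vs ! i) w * ?f w)
          = (\<Sum>w\<in>V. ?f w - (if vs ! i = w then ?f w else 0) - a (vs ! i) w * ?f w)"
        by (intro sum.cong refl) (simp only: compl, simp add: algebra_simps)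
      then show ?thesis
        using False vs[OF Cons.prems(1)] fin
        by (simp add: sum_subtractf A_def inner_def indic_def cong: if_cong)
    qed
    finally show ?case .
  qed
  have "walk_count \<beta> G = (\<Sum>i<n. ?P \<beta> $$ (i, i))"
    using carrier[of \<beta>] by (simp add: walk_count_def mat_trace_def n_def V_def)
  also have "\<dots> = (\<Sum>i<n. word_op \<beta> (point (vs ! i)) (vs ! i))" by (simp add: entry)
  also have "\<dots> = (\<Sum>v\<in>V. word_op \<beta> (point v) v)"
    using sum_sorted_list_nth[OF fin, of "\<lambda>v. word_op \<beta> (point v) v"] by (simp add: n_def vs_def)
  also have "\<dots> = word_trace closed_walks walks \<beta> 0" using trace_word_op[of 0] by simp
  finally show ?thesis .
qed

section \<open>Walks in a split graph\<close>

text \<open>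
  Let \<open>B\<close> be the bipartite adjacency matrix between the clique and the independent set of a split
  graph, let \<open>M = B B\<^sup>T\<close>, and extend vectors by zero to all vertices. With the moments
  \<open>\<beta> r = 1\<^sup>T M\<^sup>r 1\<close>, \<open>\<tau> r = tr M\<^sup>r\<close>, \<open>\<gamma> r = 1\<^sup>T M\<^sup>r B 1\<close> and \<open>\<alpha> r = 1\<^sup>T (B\<^sup>T B)\<^sup>r 1\<close>, the following recursions
  compute \<open>(M\<^sup>i 1)\<^sup>T A\<^sup>j (M\<^sup>r 1)\<close>, the trace of \<open>M\<^sup>i A\<^sup>j\<close> on the clique, \<open>(M\<^sup>r 1)\<^sup>T A\<^sup>j 1\<close> and
  \<open>(M\<^sup>r B 1)\<^sup>T A\<^sup>j 1\<close>. All of them use that, for \<open>f\<close> on the clique, \<open>A f\<close> is the sum of \<open>f\<close> times \<open>1\<close>, minus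
  \<open>f\<close>, plus \<open>B\<^sup>T f\<close>, and that \<open>A B\<^sup>T f = M f\<close>; hence two steps of \<open>A\<close> raise the power of \<open>M\<close> by one.
\<close>

fun clique_walks :: "(nat \<Rightarrow> real) \<Rightarrow> nat \<Rightarrow> nat \<Rightarrow> nat \<Rightarrow> real" where
  "clique_walks \<beta> 0 i r = \<beta> (i + r)"
| "clique_walks \<beta> (Suc 0) i r = \<beta> i * \<beta> r - \<beta> (i + r)"
| "clique_walks \<beta> (Suc (Suc j)) i r =
     \<beta> i * clique_walks \<beta> (Suc j) 0 r - clique_walks \<beta> (Suc j) i r + clique_walks \<beta> j (Suc i) r"

fun clique_trace :: "(nat \<Rightarrow> real) \<Rightarrow> (nat \<Rightarrow> real) \<Rightarrow> nat \<Rightarrow> nat \<Rightarrow> real" where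
  "clique_trace \<beta> \<tau> 0 i = \<tau> i"
| "clique_trace \<beta> \<tau> (Suc 0) i = \<beta> i - \<tau> i"
| "clique_trace \<beta> \<tau> (Suc (Suc j)) i =
     clique_walks \<beta> (Suc j) 0 i - clique_trace \<beta> \<tau> (Suc j) i + clique_trace \<beta> \<tau> j (Suc i)"

fun clique_row :: "(nat \<Rightarrow> real) \<Rightarrow> (nat \<Rightarrow> real) \<Rightarrow> nat \<Rightarrow> nat \<Rightarrow> real" where
  "clique_row \<beta> \<gamma> 0 r = \<beta> r"
| "clique_row \<beta> \<gamma> (Suc 0) r = \<beta> r * \<beta> 0 - \<beta> r + \<gamma> r"
| "clique_row \<beta> \<gamma> (Suc (Suc j)) r =
     \<beta> r * clique_row \<beta> \<gamma> (Suc j) 0 - clique_row \<beta> \<gamma> (Suc j) r + clique_row \<beta> \<gamma> j (Suc r)"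

fun cross_row ::
  "(nat \<Rightarrow> real) \<Rightarrow> (nat \<Rightarrow> real) \<Rightarrow> (nat \<Rightarrow> real) \<Rightarrow> nat \<Rightarrow> nat \<Rightarrow> real" where
  "cross_row \<alpha> \<beta> \<gamma> 0 r = \<gamma> r"
| "cross_row \<alpha> \<beta> \<gamma> (Suc 0) r = \<gamma> r * \<beta> 0 - \<gamma> r + \<alpha> (Suc r)"
| "cross_row \<alpha> \<beta> \<gamma> (Suc (Suc j)) r =
     \<gamma> r * clique_row \<beta> \<gamma> (Suc j) 0 - cross_row \<alpha> \<beta> \<gamma> (Suc j) r + cross_row \<alpha> \<beta> \<gamma> j (Suc r)"

fun split_closed_walks :: "(nat \<Rightarrow> real) \<Rightarrow> (nat \<Rightarrow> real) \<Rightarrow> (nat \<Rightarrow> real) \<Rightarrow> nat \<Rightarrow> real" where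
  "split_closed_walks \<alpha> \<beta> \<tau> 0 = \<beta> 0 + \<alpha> 0"
| "split_closed_walks \<alpha> \<beta> \<tau> (Suc 0) = \<beta> 0 - \<tau> 0"
| "split_closed_walks \<alpha> \<beta> \<tau> (Suc (Suc j)) =
     clique_trace \<beta> \<tau> (Suc (Suc j)) 0 + clique_trace \<beta> \<tau> j 1"

fun split_walks :: "(nat \<Rightarrow> real) \<Rightarrow> (nat \<Rightarrow> real) \<Rightarrow> (nat \<Rightarrow> real) \<Rightarrow> nat \<Rightarrow> real" where
  "split_walks \<alpha> \<beta> \<gamma> 0 = \<beta> 0 + \<alpha> 0"
| "split_walks \<alpha> \<beta> \<gamma> (Suc j) = clique_row \<beta> \<gamma> (Suc j) 0 + cross_row \<alpha> \<beta> \<gamma> j 0"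

definition restrict_to :: "'a set \<Rightarrow> ('a \<Rightarrow> real) \<Rightarrow> 'a \<Rightarrow> real" where
  "restrict_to U f = (\<lambda>u. if u \<in> U then f u else 0)"

definition supported :: "'a set \<Rightarrow> ('a \<Rightarrow> real) \<Rightarrow> bool" where
  "supported U f \<longleftrightarrow> (\<forall>u. u \<notin> U \<longrightarrow> f u = 0)"

locale split_weighted = weighted_graph V a
  for V :: "'a set" and a :: "'a \<Rightarrow> 'a \<Rightarrow> real" +
  fixes K S :: "'a set"
  assumes V_eq: "V = K \<union> S" and disjoint: "K \<inter> S = {}"
    and clique: "\<And>u w. u \<in> K \<Longrightarrow> w \<in> K \<Longrightarrow> a u w = (if u = w then 0 else 1)"
    and indep: "\<And>u w. u \<in> S \<Longrightarrow> w \<in> S \<Longrightarrow> a u w = 0"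
begin

definition down :: "('a \<Rightarrow> real) \<Rightarrow> 'a \<Rightarrow> real" where
  "down f = restrict_to S (A f)"

definition gram :: "('a \<Rightarrow> real) \<Rightarrow> 'a \<Rightarrow> real" where
  "gram f = A (down f)"

definition cogram :: "('a \<Rightarrow> real) \<Rightarrow> 'a \<Rightarrow> real" where
  "cogram f = restrict_to S (A (A f))"

definition clique_moment :: "nat \<Rightarrow> real" where
  "clique_moment r = sum ((gram ^^ r) (indic K)) K"

definition indep_moment :: "nat \<Rightarrow> real" where
  "indep_moment r = sum ((cogram ^^ r) (indic S)) S"

definition cross_moment :: "nat \<Rightarrow> real" where
  "cross_moment r = sum (down ((gram ^^ r) (indic K))) S"

definition trace_moment :: "nat \<Rightarrow> real" where
  "trace_moment r = (\<Sum>v\<in>K. (gram ^^ r) (point v) v)"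

lemma finKS: "finite K" "finite S"
  using fin V_eq by auto

lemma sum_V: "sum f V = sum f K + sum f S"
  unfolding V_eq using finKS disjoint by (rule sum.union_disjoint)

lemma in_V: "v \<in> K \<Longrightarrow> v \<in> V" "v \<in> S \<Longrightarrow> v \<in> V"
  by (simp_all add: V_eq)

lemma inner_K: "supported K f \<Longrightarrow> f \<bullet>\<bullet> g = (\<Sum>v\<in>K. f v * g v)"
proof -
  assume "supported K f"
  then have "(\<Sum>v\<in>S. f v * g v) = 0"
    using disjoint by (intro sum.neutral) (auto simp: supported_def)
  then show ?thesis by (simp add: inner_def sum_V)
qed

lemma inner_S: "supported S f \<Longrightarrow> f \<bullet>\<bullet> g = (\<Sum>v\<in>S. f v * g v)"
proof -
  assume "supported S f"
  then have "(\<Sum>v\<in>K. f v * g v) = 0"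
    using disjoint by (intro sum.neutral) (auto simp: supported_def)
  then show ?thesis by (simp add: inner_def sum_V)
qed

lemma supported_indic: "supported U (indic U)"
  by (simp add: supported_def indic_def)

lemma inner_indic_K: "indic K \<bullet>\<bullet> g = sum g K"
  unfolding inner_K[OF supported_indic] by (simp add: indic_def)

lemma inner_indic_V_K: "supported K f \<Longrightarrow> f \<bullet>\<bullet> indic V = sum f K"
  by (simp add: inner_K indic_def in_V)

lemma inner_indic_V_S: "supported S f \<Longrightarrow> f \<bullet>\<bullet> indic V = sum f S"
  by (simp add: inner_S indic_def in_V)

lemma supported_point: "v \<in> U \<Longrightarrow> supported U (point v)"
  by (auto simp: supported_def point_def)

lemma supported_restrict: "supported U (restrict_to U f)"
  by (simp add: supported_def restrict_to_def)

lemma supported_down: "supported S (down f)"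
  by (simp add: down_def supported_restrict)

lemma supported_A: "supported S g \<Longrightarrow> supported K (A g)"
  unfolding supported_def
proof (intro allI impI)
  fix u assume g: "\<forall>u. u \<notin> S \<longrightarrow> g u = 0" and u: "u \<notin> K"
  show "A g u = 0"
  proof (cases "u \<in> V")
    case True
    then have "u \<in> S" using u V_eq by auto
    then have "a u w * g w = 0" for w using g indep by (cases "w \<in> S") auto
    then show ?thesis unfolding A_def by (intro sum.neutral ballI)
  qed (rule A_outside)
qed

lemma supported_gram_pow: "supported K f \<Longrightarrow> supported K ((gram ^^ r) f)"
  by (cases r) (simp_all add: gram_def supported_A supported_down)

lemma supported_cogram_pow: "supported S f \<Longrightarrow> supported S ((cogram ^^ r) f)"
  by (cases r) (simp_all add: cogram_def supported_restrict)

lemma down_adjoint: "supported S g \<Longrightarrow> down f \<bullet>\<bullet> g = f \<bullet>\<bullet> A g"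
proof -
  assume g: "supported S g"
  have "down f \<bullet>\<bullet> g = g \<bullet>\<bullet> A f"
    unfolding inner_commute[of "down f"] inner_S[OF g] by (simp add: down_def restrict_to_def)
  then show ?thesis using A_selfadjoint[of g f] inner_commute by metis
qed

lemma restrict_S_inner: "supported S g \<Longrightarrow> g \<bullet>\<bullet> restrict_to S f = g \<bullet>\<bullet> f"
  by (simp add: inner_S restrict_to_def)

text \<open>
  The operator \<open>gram\<close> acts as \<open>B B\<^sup>T\<close> on functions on the clique; \<open>cogram\<close> acts as \<open>B\<^sup>T B\<close> on
  functions on the independent set.
\<close>

lemma gram_selfadjoint: "gram f \<bullet>\<bullet> g = f \<bullet>\<bullet> gram g"
proof -
  have "gram f \<bullet>\<bullet> g = down g \<bullet>\<bullet> down f"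
    unfolding gram_def A_selfadjoint down_def[of g] inner_commute[of _ "down f"]
    by (simp add: restrict_S_inner supported_down inner_commute[of "restrict_to S (A g)"])
  also have "\<dots> = down f \<bullet>\<bullet> down g" by (rule inner_commute)
  also have "\<dots> = f \<bullet>\<bullet> gram g" unfolding gram_def by (rule down_adjoint[OF supported_down])
  finally show ?thesis .
qed

lemma gram_pow_selfadjoint: "(gram ^^ r) f \<bullet>\<bullet> g = f \<bullet>\<bullet> (gram ^^ r) g"
  by (induction r arbitrary: f) (simp_all add: gram_selfadjoint funpow_swap1)

text \<open>
  On a function supported on the clique, the adjacency operator is the all-ones operator of the
  clique minus the identity plus the part that goes down to the independent set.
\<close>

lemma inner_A_clique:
  assumes f: "supported K f"
  shows "f \<bullet>\<bullet> A g = sum f K * (indic K \<bullet>\<bullet> g) - f \<bullet>\<bullet> g + down f \<bullet>\<bullet> g"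
proof -
  have "A f u = sum f K - f u" if "u \<in> K" for u
  proof -
    have "A f u = (\<Sum>w\<in>K. a u w * f w)"
      unfolding A_def using f disjoint
      by (subst sum_V) (auto simp: supported_def intro!: sum.neutral)
    also have "\<dots> = (\<Sum>w\<in>K. f w - (if u = w then f w else 0))"
      using that by (intro sum.cong) (auto simp: clique)
    finally show ?thesis using that finKS by (simp add: sum_subtractf)
  qed
  then have "(\<Sum>u\<in>K. A f u * g u) = sum f K * (\<Sum>u\<in>K. g u) - (\<Sum>u\<in>K. f u * g u)"
    by (simp add: left_diff_distrib sum_subtractf sum_distrib_left)
  moreover have "(\<Sum>u\<in>S. A f u * g u) = down f \<bullet>\<bullet> g"
    unfolding inner_S[OF supported_down] by (simp add: down_def restrict_to_def)
  moreover have "indic K \<bullet>\<bullet> g = (\<Sum>u\<in>K. g u)"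
    by (rule inner_indic_K)
  ultimately show ?thesis
    unfolding A_selfadjoint[symmetric] inner_K[OF f] by (simp add: inner_def sum_V)
qed

lemma inner_A_down: "down f \<bullet>\<bullet> A g = gram f \<bullet>\<bullet> g"
  by (simp add: gram_def A_selfadjoint)

lemma down_inner_clique: "supported K g \<Longrightarrow> down f \<bullet>\<bullet> g = 0"
  using disjoint by (auto simp: inner_S[OF supported_down] supported_def intro!: sum.neutral)

abbreviation p :: "nat \<Rightarrow> 'a \<Rightarrow> real" where
  "p r \<equiv> (gram ^^ r) (indic K)"

lemma supported_p: "supported K (p r)"
  by (rule supported_gram_pow[OF supported_indic])

lemma clique_walks_eq: "p i \<bullet>\<bullet> (A ^^ j) (p r) = clique_walks clique_moment j i r"
proof (induction clique_moment j i r rule: clique_walks.induct)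
  case (1 i r)
  show ?case
    by (simp add: clique_moment_def inner_indic_K gram_pow_selfadjoint funpow_add)
next
  case (2 i r)
  have "p i \<bullet>\<bullet> p r = clique_moment (i + r)"
    by (simp add: clique_moment_def inner_indic_K gram_pow_selfadjoint funpow_add)
  then show ?case
    by (simp add: inner_A_clique[OF supported_p] down_inner_clique[OF supported_p])
       (simp add: clique_moment_def inner_indic_K)
next
  case (3 j i r)
  have "p i \<bullet>\<bullet> (A ^^ Suc (Suc j)) (p r) = sum (p i) K * (p 0 \<bullet>\<bullet> (A ^^ Suc j) (p r))
      - p i \<bullet>\<bullet> (A ^^ Suc j) (p r) + gram (p i) \<bullet>\<bullet> (A ^^ j) (p r)"
    by (simp add: inner_A_clique[OF supported_p] inner_A_down)
  then show ?case using 3 by (simp add: clique_moment_def)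
qed

lemma clique_trace_eq:
  "(\<Sum>v\<in>K. (gram ^^ i) (point v) \<bullet>\<bullet> (A ^^ j) (point v)) = clique_trace clique_moment trace_moment j i"
proof (induction clique_moment trace_moment j i rule: clique_trace.induct)
  case (1 i)
  have "(gram ^^ i) (point v) \<bullet>\<bullet> point v = (gram ^^ i) (point v) v" if "v \<in> K" for v
    using that by (intro inner_point in_V)
  then show ?case by (simp add: trace_moment_def)
next
  case (2 i)
  have "(gram ^^ i) (point v) \<bullet>\<bullet> A (point v) = p i v - (gram ^^ i) (point v) v" if v: "v \<in> K" for v
  proof -
    note s = supported_gram_pow[OF supported_point[OF v], of i]
    have vV: "v \<in> V" using v by (rule in_V)
    have "sum ((gram ^^ i) (point v)) K = p i v"
      using gram_pow_selfadjoint[of i "indic K" "point v"]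
      by (simp add: inner_indic_K inner_point vV)
    then show ?thesis
      using v by (simp add: inner_A_clique[OF s] down_inner_clique[OF supported_point[OF v]]
          inner_point vV indic_def)
  qed
  then show ?case by (simp add: clique_moment_def trace_moment_def sum_subtractf)
next
  case (3 j i)
  have "(gram ^^ i) (point v) \<bullet>\<bullet> (A ^^ Suc (Suc j)) (point v)
      = p i v * (indic K \<bullet>\<bullet> (A ^^ Suc j) (point v)) - (gram ^^ i) (point v) \<bullet>\<bullet> (A ^^ Suc j) (point v)
        + (gram ^^ Suc i) (point v) \<bullet>\<bullet> (A ^^ j) (point v)" if v: "v \<in> K" for v
  proof -
    note s = supported_gram_pow[OF supported_point[OF v], of i]
    have "sum ((gram ^^ i) (point v)) K = p i v"
      using gram_pow_selfadjoint[of i "indic K" "point v"] v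
      by (simp add: inner_indic_K inner_point in_V)
    then show ?thesis by (simp add: inner_A_clique[OF s] inner_A_down)
  qed
  moreover have "(\<Sum>v\<in>K. p i v * (indic K \<bullet>\<bullet> (A ^^ Suc j) (point v))) = clique_walks clique_moment (Suc j) 0 i"
  proof -
    have "(\<Sum>v\<in>K. p i v * (indic K \<bullet>\<bullet> (A ^^ Suc j) (point v)))
        = indic K \<bullet>\<bullet> (A ^^ Suc j) (\<lambda>u. \<Sum>v\<in>K. p i v * point v u)"
      unfolding A_pow_sum inner_sum ..
    also have "(\<lambda>u. \<Sum>v\<in>K. p i v * point v u) = p i"
      using supported_p[of i] by (intro point_expansion) (auto simp: supported_def finKS)
    finally show ?thesis using clique_walks_eq[of 0 "Suc j" i] by simp
  qed
  ultimately show ?case using 3 by (simp add: sum.distrib sum_subtractf)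
qed

text \<open>
  A point of the independent set is moved into the clique by the first and the last step of a
  closed walk, which turns its contribution into a trace over the clique with two steps less.
\<close>

lemma closed_walks_eq:
  "closed_walks j = split_closed_walks indep_moment clique_moment trace_moment j"
proof (cases "(indep_moment, clique_moment, trace_moment, j)" rule: split_closed_walks.cases)
  case (1 \<alpha> \<beta> \<tau>)
  have "closed_walks 0 = (\<Sum>v\<in>K. 1) + (\<Sum>v\<in>S. 1)"
    by (simp only: closed_walks_def sum_V) (simp add: point_def)
  moreover have "clique_moment 0 = (\<Sum>v\<in>K. 1)" "indep_moment 0 = (\<Sum>v\<in>S. 1)"
    by (simp_all add: clique_moment_def indep_moment_def indic_def)
  ultimately show ?thesis using 1 by auto
next
  case (2 \<alpha> \<beta> \<tau>)
  have A_point: "A (point v) u = a u v" if "v \<in> V" for u v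
    using that fin by (simp add: A_def point_def if_distrib cong: if_cong)
  have "A (point v) v = 0" if "v \<in> V" for v
  proof -
    have "v \<in> K \<or> v \<in> S" using that by (simp add: V_eq)
    then show ?thesis using A_point[OF that] clique[of v v] indep[of v v] by auto
  qed
  then have "closed_walks 1 = 0" by (simp add: closed_walks_def)
  moreover have "clique_moment 0 = trace_moment 0"
    by (simp add: clique_moment_def trace_moment_def indic_def point_def)
  ultimately show ?thesis using 2 by auto
next
  case (3 \<alpha> \<beta> \<tau> i)
  have "(\<Sum>v\<in>K. (A ^^ Suc (Suc i)) (point v) v) = clique_trace clique_moment trace_moment (Suc (Suc i)) 0"
  proof -
    have "(A ^^ Suc (Suc i)) (point v) v = (gram ^^ 0) (point v) \<bullet>\<bullet> (A ^^ Suc (Suc i)) (point v)" if "v \<in> K" for v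
      using that inner_commute[of "point v"] by (simp add: inner_point in_V)
    then show ?thesis unfolding clique_trace_eq[symmetric] by (intro sum.cong refl) metis
  qed
  moreover have "(\<Sum>s\<in>S. (A ^^ Suc (Suc i)) (point s) s) = clique_trace clique_moment trace_moment i 1"
  proof -
    have col: "A (point s) = (\<lambda>u. \<Sum>v\<in>K. a v s * point v u)" if s: "s \<in> S" for s
    proof -
      have "A (point s) v = a v s" for v
        using in_V(2)[OF s] fin by (simp add: A_def point_def if_distrib cong: if_cong)
      moreover have "supported K (A (point s))" by (rule supported_A[OF supported_point[OF s]])
      then have "(\<lambda>u. \<Sum>v\<in>K. A (point s) v * point v u) = A (point s)"
        by (intro point_expansion) (auto simp: supported_def finKS)
      ultimately show ?thesis by simp
    qed
    have "(A ^^ Suc (Suc i)) (point s) s = (\<Sum>v\<in>K. a v s * (A (point s) \<bullet>\<bullet> (A ^^ i) (point v)))"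
      if s: "s \<in> S" for s
    proof -
      have "(A ^^ Suc (Suc i)) (point s) s = point s \<bullet>\<bullet> A ((A ^^ i) (A (point s)))"
        using in_V(2)[OF s] inner_commute[of "point s"] by (simp add: inner_point funpow_swap1)
      also have "\<dots> = A (point s) \<bullet>\<bullet> (A ^^ i) (A (point s))" by (simp add: A_selfadjoint)
      also have "\<dots> = A (point s) \<bullet>\<bullet> (A ^^ i) (\<lambda>u. \<Sum>v\<in>K. a v s * point v u)"
        by (simp only: col[OF s])
      finally show ?thesis unfolding A_pow_sum inner_sum .
    qed
    then have "(\<Sum>s\<in>S. (A ^^ Suc (Suc i)) (point s) s)
        = (\<Sum>v\<in>K. \<Sum>s\<in>S. a v s * ((A ^^ i) (point v) \<bullet>\<bullet> A (point s)))"
      by (simp add: inner_commute del: funpow.simps) (rule sum.swap)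
    also have "\<dots> = (\<Sum>v\<in>K. gram (point v) \<bullet>\<bullet> (A ^^ i) (point v))"
    proof (intro sum.cong refl)
      fix v assume v: "v \<in> K"
      have "down (point v) s = a v s" if "s \<in> S" for s
        using that in_V(1)[OF v] fin
        by (simp add: down_def restrict_to_def A_def point_def sym if_distrib cong: if_cong)
      then have "(\<lambda>u. \<Sum>s\<in>S. a v s * point s u) = (\<lambda>u. \<Sum>s\<in>S. down (point v) s * point s u)" by simp
      also have "\<dots> = down (point v)"
        using supported_down by (intro point_expansion) (auto simp: supported_def finKS)
      finally have "(\<lambda>u. \<Sum>s\<in>S. a v s * A (point s) u) = gram (point v)"
        unfolding gram_def A_sum[symmetric] by (rule arg_cong)
      then show "(\<Sum>s\<in>S. a v s * ((A ^^ i) (point v) \<bullet>\<bullet> A (point s))) = gram (point v) \<bullet>\<bullet> (A ^^ i) (point v)"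
        unfolding inner_sum[symmetric] by (simp add: inner_commute)
    qed
    finally show ?thesis using clique_trace_eq[of 1 i] by simp
  qed
  ultimately show ?thesis using 3 by (simp add: closed_walks_def sum_V del: funpow.simps)
qed

abbreviation q :: "nat \<Rightarrow> 'a \<Rightarrow> real" where
  "q r \<equiv> A ((cogram ^^ r) (indic S))"

lemma supported_n: "supported S ((cogram ^^ r) (indic S))"
  by (rule supported_cogram_pow[OF supported_indic])

lemma supported_q: "supported K (q r)"
  by (rule supported_A[OF supported_n])

lemma down_gram_pow_adjoint:
  "supported S g \<Longrightarrow> f \<bullet>\<bullet> A ((cogram ^^ r) g) = down ((gram ^^ r) f) \<bullet>\<bullet> g"
proof (induction r arbitrary: g)
  case 0
  then show ?case by (simp add: down_adjoint)
next
  case (Suc r)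
  let ?h = "(gram ^^ r) f"
  have "f \<bullet>\<bullet> A ((cogram ^^ Suc r) g) = down ?h \<bullet>\<bullet> cogram g"
    using Suc.IH[of "cogram g"] supported_restrict[of S "A (A g)"]
    by (simp add: funpow_swap1 cogram_def[of g])
  also have "\<dots> = down ?h \<bullet>\<bullet> A (A g)"
    by (simp add: cogram_def restrict_S_inner supported_down)
  also have "\<dots> = down (gram ?h) \<bullet>\<bullet> g"
    using Suc.prems by (simp add: inner_A_down down_adjoint)
  finally show ?case by simp
qed

lemma sum_q: "sum (q r) K = cross_moment r"
proof -
  have "sum (q r) K = indic K \<bullet>\<bullet> q r"
    by (rule inner_indic_K[symmetric])
  also have "\<dots> = down (p r) \<bullet>\<bullet> indic S"
    by (rule down_gram_pow_adjoint[OF supported_indic])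
  finally show ?thesis
    unfolding cross_moment_def inner_S[OF supported_down] by (simp add: indic_def)
qed

lemma down_q: "down (q r) = (cogram ^^ Suc r) (indic S)"
  by (simp add: down_def cogram_def)

lemma clique_row_eq: "p r \<bullet>\<bullet> (A ^^ j) (indic V) = clique_row clique_moment cross_moment j r"
proof (induction clique_moment cross_moment j r rule: clique_row.induct)
  case (1 r)
  then show ?case by (simp add: inner_indic_V_K[OF supported_p] clique_moment_def)
next
  case (2 r)
  have "p r \<bullet>\<bullet> indic V = clique_moment r" for r
    by (simp add: inner_indic_V_K[OF supported_p] clique_moment_def)
  from this[of r] this[of 0]
  have "p r \<bullet>\<bullet> indic V = clique_moment r" "indic K \<bullet>\<bullet> indic V = clique_moment 0"
    by simp_all
  moreover have "down (p r) \<bullet>\<bullet> indic V = cross_moment r"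
    by (simp add: inner_indic_V_S[OF supported_down] cross_moment_def)
  ultimately show ?case by (simp add: inner_A_clique[OF supported_p]) (simp add: clique_moment_def)
next
  case (3 j r)
  have "p r \<bullet>\<bullet> (A ^^ Suc (Suc j)) (indic V) = sum (p r) K * (p 0 \<bullet>\<bullet> (A ^^ Suc j) (indic V))
      - p r \<bullet>\<bullet> (A ^^ Suc j) (indic V) + gram (p r) \<bullet>\<bullet> (A ^^ j) (indic V)"
    by (simp add: inner_A_clique[OF supported_p] inner_A_down)
  then show ?case using 3 by (simp add: clique_moment_def)
qed

lemma cross_row_eq:
  "q r \<bullet>\<bullet> (A ^^ j) (indic V) = cross_row indep_moment clique_moment cross_moment j r"
proof (induction indep_moment clique_moment cross_moment j r rule: cross_row.induct)
  case (1 r)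
  then show ?case by (simp add: inner_indic_V_K[OF supported_q] sum_q)
next
  case (2 r)
  have "q r \<bullet>\<bullet> indic V = cross_moment r"
    by (simp add: inner_indic_V_K[OF supported_q] sum_q)
  moreover have "indic K \<bullet>\<bullet> indic V = clique_moment 0"
    by (simp add: inner_indic_V_K[OF supported_indic] clique_moment_def)
  moreover have "down (q r) \<bullet>\<bullet> indic V = indep_moment (Suc r)"
    unfolding down_q indep_moment_def by (rule inner_indic_V_S[OF supported_n])
  ultimately show ?case by (simp add: inner_A_clique[OF supported_q] sum_q)
next
  case (3 j r)
  have "q r \<bullet>\<bullet> (A ^^ Suc (Suc j)) (indic V) = sum (q r) K * (p 0 \<bullet>\<bullet> (A ^^ Suc j) (indic V))
      - q r \<bullet>\<bullet> (A ^^ Suc j) (indic V) + down (q r) \<bullet>\<bullet> A ((A ^^ j) (indic V))"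
    by (simp add: inner_A_clique[OF supported_q])
  also have "down (q r) \<bullet>\<bullet> A ((A ^^ j) (indic V)) = q (Suc r) \<bullet>\<bullet> (A ^^ j) (indic V)"
    unfolding A_selfadjoint[symmetric] down_q ..
  finally show ?case using 3 clique_row_eq[of 0 "Suc j"] by (simp add: sum_q)
qed

lemma walks_eq: "walks j = split_walks indep_moment clique_moment cross_moment j"
proof (cases j)
  case 0
  have "walks 0 = sum (indic K) K + sum (indic S) S"
    unfolding walks_def inner_def sum_V using V_eq by (simp add: indic_def)
  then show ?thesis using 0 by (simp add: clique_moment_def indep_moment_def)
next
  case (Suc i)
  have "indic V = (\<lambda>u. indic K u + indic S u)"
    using V_eq disjoint by (auto simp: indic_def fun_eq_iff)
  then have "indic V \<bullet>\<bullet> f = indic K \<bullet>\<bullet> f + indic S \<bullet>\<bullet> f" for f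
    by (simp add: inner_def distrib_right sum.distrib)
  then have "walks j = p 0 \<bullet>\<bullet> (A ^^ j) (indic V) + q 0 \<bullet>\<bullet> (A ^^ i) (indic V)"
    by (simp add: walks_def Suc A_selfadjoint)
  then show ?thesis unfolding clique_row_eq cross_row_eq by (simp add: Suc)
qed

end

section \<open>Realising walk numbers by split moments\<close>

text \<open>
  Solve for one unknown after the other; the later ones do not disturb the equations that already hold.
\<close>

lemma triangular_system_solvable:
  fixes F :: "(nat \<Rightarrow> real) \<Rightarrow> nat \<Rightarrow> real"
  assumes diff: "\<And>s s' n. (\<And>i. i < n \<Longrightarrow> s' i = s i) \<Longrightarrow> F s' n - F s n = c n * (s' n - s n)"
    and c: "\<And>n. c n \<noteq> 0"
  obtains s where "\<And>n. F s n = target n"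
proof -
  define g where "g = rec_nat (\<lambda>_. 0) (\<lambda>n f. f(n := f n + (target n - F f n) / c n))"
  have g_Suc: "g (Suc n) = (g n)(n := g n n + (target n - F (g n) n) / c n)" for n
    by (simp add: g_def)
  define s where "s i = g (Suc i) i" for i
  have stable: "g n i = s i" if "i < n" for i n
    using that
  proof (induction n)
    case (Suc n)
    then show ?case by (cases "i = n") (simp_all add: s_def, simp add: g_Suc)
  qed simp
  have "F s n = target n" for n
  proof -
    have "F s n - F (g n) n = c n * (s n - g n n)"
      by (rule diff) (simp add: stable)
    then show ?thesis using c[of n] by (simp add: s_def g_Suc)
  qed
  then show ?thesis by (rule that)
qed

text \<open>
  The differences below express that the recursions are homogeneous: a moment with index \<open>r\<close> has weight
  \<open>2 r\<close> (or \<open>2 r + 1\<close> for the mixed moments), each step of \<open>A\<close> has weight \<open>1\<close>, and changing one moment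
  has no effect below its weight and a constant effect at its weight.
\<close>

lemma clique_walks_diff:
  assumes "\<And>i. i < m \<Longrightarrow> \<beta>' i = \<beta> i"
  shows "(2 * (i + r) + j < 2 * m \<longrightarrow> clique_walks \<beta>' j i r = clique_walks \<beta> j i r) \<and>
    (2 * (i + r) + j = 2 * m \<longrightarrow> clique_walks \<beta>' j i r - clique_walks \<beta> j i r = \<beta>' m - \<beta> m)"
proof (induction j arbitrary: i r rule: induct_nat_012)
  case 0
  show ?case
  proof (cases "i + r = m")
    case False
    then have "2 * (i + r) \<noteq> 2 * m" by simp
    then show ?thesis using assms[of "i + r"] by auto
  qed simp
next
  case 1
  have "\<beta>' i = \<beta> i" "\<beta>' r = \<beta> r" "\<beta>' (i + r) = \<beta> (i + r)" if "2 * (i + r) + Suc 0 < 2 * m"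
    using that by (auto intro!: assms)
  moreover have "2 * (i + r) + Suc 0 \<noteq> 2 * m" by presburger
  ultimately show ?case by auto
next
  case (ge2 j)
  have "\<beta>' i = \<beta> i" if "2 * (i + r) + Suc (Suc j) \<le> 2 * m" using that by (simp add: assms)
  then show ?case using ge2.IH(1)[of "Suc i" r] ge2.IH(2)[of 0 r] ge2.IH(2)[of i r]
    by (simp add: algebra_simps)
qed

lemma clique_trace_diff_even:
  assumes "\<And>i. i < m \<Longrightarrow> \<beta>' i = \<beta> i" "\<And>i. i < m \<Longrightarrow> \<tau>' i = \<tau> i"
  shows "(2 * i + j < 2 * m \<longrightarrow> clique_trace \<beta>' \<tau>' j i = clique_trace \<beta> \<tau> j i) \<and>
    (2 * i + j = 2 * m \<longrightarrow> clique_trace \<beta>' \<tau>' j i - clique_trace \<beta> \<tau> j i = \<tau>' m - \<tau> m)"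
proof (induction j arbitrary: i rule: induct_nat_012)
  case 0
  then show ?case using assms by auto
next
  case 1
  have "2 * i + Suc 0 \<noteq> 2 * m" by presburger
  then show ?case using assms(1)[of i] assms(2)[of i] by auto
next
  case (ge2 j)
  then show ?case
    using ge2.IH(1)[of "Suc i"] ge2.IH(2)[of i]
      clique_walks_diff[of m \<beta>' \<beta> 0 i "Suc j", OF assms(1)]
    by (simp add: algebra_simps)
qed

lemma clique_trace_diff_odd:
  assumes "\<And>i. i < m \<Longrightarrow> \<beta>' i = \<beta> i" "\<And>i. i \<le> m \<Longrightarrow> \<tau>' i = \<tau> i"
    and "i + k = m"
  shows "clique_trace \<beta>' \<tau>' (2 * k + 1) i - clique_trace \<beta> \<tau> (2 * k + 1) i
    = (real k + 1) * (\<beta>' m - \<beta> m)"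
  using assms(3)
proof (induction k arbitrary: i)
  case 0
  then show ?case using assms(2)[of m] by simp
next
  case (Suc k)
  have "clique_trace \<beta>' \<tau>' (2 * k + 2) i = clique_trace \<beta> \<tau> (2 * k + 2) i"
    using clique_trace_diff_even[of m \<beta>' \<beta> \<tau>' \<tau> i "2 * k + 2"] assms Suc.prems by simp
  moreover have "clique_walks \<beta>' (2 * k + 2) 0 i - clique_walks \<beta> (2 * k + 2) 0 i = \<beta>' m - \<beta> m"
    using clique_walks_diff[of m \<beta>' \<beta> 0 i "2 * k + 2"] assms Suc.prems by simp
  ultimately show ?case
    using Suc.IH[of "Suc i"] Suc.prems by (simp add: algebra_simps)
qed

lemma split_closed_walks_diff_even:
  assumes "\<And>i. i < Suc m \<Longrightarrow> \<beta>' i = \<beta> i" "\<And>i. i < Suc m \<Longrightarrow> \<tau>' i = \<tau> i"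
  shows "split_closed_walks \<alpha> \<beta>' \<tau>' (2 * Suc m) - split_closed_walks \<alpha> \<beta> \<tau> (2 * Suc m)
    = 2 * (\<tau>' (Suc m) - \<tau> (Suc m))"
  using clique_trace_diff_even[of "Suc m" \<beta>' \<beta> \<tau>' \<tau> 0 "2 * Suc m"]
    clique_trace_diff_even[of "Suc m" \<beta>' \<beta> \<tau>' \<tau> 1 "2 * m"] assms
  by (simp del: clique_trace.simps add: numeral_2_eq_2)

lemma split_closed_walks_diff_odd:
  assumes "\<And>i. i < Suc m \<Longrightarrow> \<beta>' i = \<beta> i" "\<And>i. i \<le> Suc m \<Longrightarrow> \<tau>' i = \<tau> i"
  shows "split_closed_walks \<alpha> \<beta>' \<tau>' (2 * Suc m + 1) - split_closed_walks \<alpha> \<beta> \<tau> (2 * Suc m + 1)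
    = (2 * real (Suc m) + 1) * (\<beta>' (Suc m) - \<beta> (Suc m))"
  using clique_trace_diff_odd[of "Suc m" \<beta>' \<beta> \<tau>' \<tau> 0 "Suc m"]
    clique_trace_diff_odd[of "Suc m" \<beta>' \<beta> \<tau>' \<tau> 1 m] assms
  by (simp del: clique_trace.simps add: algebra_simps)

lemma clique_row_diff:
  assumes "\<And>i. i < m \<Longrightarrow> \<gamma>' i = \<gamma> i"
  shows "(2 * r + j < 2 * m + 1 \<longrightarrow> clique_row \<beta> \<gamma>' j r = clique_row \<beta> \<gamma> j r) \<and>
    (2 * r + j = 2 * m + 1 \<longrightarrow> clique_row \<beta> \<gamma>' j r - clique_row \<beta> \<gamma> j r = \<gamma>' m - \<gamma> m)"
proof (induction j arbitrary: r rule: induct_nat_012)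
  case 0
  have "2 * r \<noteq> 2 * m + 1" by presburger
  then show ?case by auto
next
  case 1
  then show ?case using assms by auto
next
  case (ge2 j)
  then show ?case using ge2.IH(1)[of "Suc r"] ge2.IH(2)[of r] ge2.IH(2)[of 0]
    by (simp add: algebra_simps)
qed

lemma cross_row_diff_even:
  assumes "\<And>i. i < m \<Longrightarrow> \<alpha>' i = \<alpha> i" "\<And>i. i < m \<Longrightarrow> \<gamma>' i = \<gamma> i"
  shows "(2 * r + 1 + j < 2 * m \<longrightarrow> cross_row \<alpha>' \<beta> \<gamma>' j r = cross_row \<alpha> \<beta> \<gamma> j r) \<and>
    (2 * r + 1 + j = 2 * m \<longrightarrow>
      cross_row \<alpha>' \<beta> \<gamma>' j r - cross_row \<alpha> \<beta> \<gamma> j r = \<alpha>' m - \<alpha> m)"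
proof (induction j arbitrary: r rule: induct_nat_012)
  case 0
  have "2 * r + 1 \<noteq> 2 * m" by presburger
  then show ?case using assms(2)[of r] by auto
next
  case 1
  have "\<gamma>' r = \<gamma> r" if "2 * r + 2 \<le> 2 * m" using that by (simp add: assms(2))
  moreover have "2 * r + 1 + Suc 0 \<noteq> 2 * m" if "Suc r \<noteq> m" using that by presburger
  ultimately show ?case using assms(1)[of "Suc r"] by (cases "Suc r = m") auto
next
  case (ge2 j)
  have "\<gamma>' r = \<gamma> r" if "2 * r + 1 + Suc (Suc j) \<le> 2 * m" using that by (simp add: assms(2))
  then show ?case
    using ge2.IH(1)[of "Suc r"] ge2.IH(2)[of r]
      clique_row_diff[of m \<gamma>' \<gamma> 0 "Suc j" \<beta>, OF assms(2)]
    by (simp add: algebra_simps)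
qed

lemma cross_row_diff_odd:
  assumes "\<And>i. i \<le> m \<Longrightarrow> \<alpha>' i = \<alpha> i" "\<And>i. i < m \<Longrightarrow> \<gamma>' i = \<gamma> i" and "r + k = m"
  shows "cross_row \<alpha>' \<beta> \<gamma>' (2 * k) r - cross_row \<alpha> \<beta> \<gamma> (2 * k) r = \<gamma>' m - \<gamma> m"
  using assms(3)
proof (induction k arbitrary: r)
  case (Suc k)
  have "cross_row \<alpha>' \<beta> \<gamma>' (Suc (2 * k)) r = cross_row \<alpha> \<beta> \<gamma> (Suc (2 * k)) r"
    using cross_row_diff_even[of m \<alpha>' \<alpha> \<gamma>' \<gamma> r "Suc (2 * k)" \<beta>] assms Suc.prems by simp
  moreover have "clique_row \<beta> \<gamma>' (Suc (2 * k)) 0 = clique_row \<beta> \<gamma> (Suc (2 * k)) 0"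
    using clique_row_diff[of m \<gamma>' \<gamma> 0 "Suc (2 * k)" \<beta>] assms Suc.prems by simp
  moreover have "\<gamma>' r = \<gamma> r" using assms(2)[of r] Suc.prems by simp
  ultimately show ?case using Suc.IH[of "Suc r"] Suc.prems by simp
qed simp

lemma split_walks_diff_even:
  assumes "\<And>i. i < m \<Longrightarrow> \<alpha>' i = \<alpha> i" "\<And>i. i < m \<Longrightarrow> \<gamma>' i = \<gamma> i"
  shows "split_walks \<alpha>' \<beta> \<gamma>' (2 * m) - split_walks \<alpha> \<beta> \<gamma> (2 * m) = \<alpha>' m - \<alpha> m"
proof (cases m)
  case (Suc k)
  then show ?thesis
    using clique_row_diff[of m \<gamma>' \<gamma> 0 "2 * m" \<beta>] assms
      cross_row_diff_even[of m \<alpha>' \<alpha> \<gamma>' \<gamma> 0 "Suc (2 * k)" \<beta>]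
    by (simp del: clique_row.simps cross_row.simps)
qed simp

lemma split_walks_diff_odd:
  assumes "\<And>i. i \<le> m \<Longrightarrow> \<alpha>' i = \<alpha> i" "\<And>i. i < m \<Longrightarrow> \<gamma>' i = \<gamma> i"
  shows "split_walks \<alpha>' \<beta> \<gamma>' (2 * m + 1) - split_walks \<alpha> \<beta> \<gamma> (2 * m + 1) = 2 * (\<gamma>' m - \<gamma> m)"
  using clique_row_diff[of m \<gamma>' \<gamma> 0 "2 * m + 1" \<beta>] assms
    cross_row_diff_odd[of m \<alpha>' \<alpha> \<gamma>' \<gamma> 0 m \<beta>]
  by (simp del: clique_row.simps cross_row.simps)

text \<open>
  The numbers \<open>t (2 m)\<close>, \<open>t (2 m + 1)\<close>, \<open>W (2 m)\<close>, \<open>W (2 m + 1)\<close> determine \<open>\<tau> m\<close>, \<open>\<beta> m\<close>, \<open>\<alpha> m\<close>,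
  \<open>\<gamma> m\<close> in turn. The clique size \<open>\<beta> 0 = \<tau> 0\<close> remains free and is put to \<open>0\<close>. The relation
  \<open>\<tau> 1 = \<gamma> 0\<close>, true for all 0/1 matrices \<open>B\<close>, follows from \<open>t 2 = W 1\<close>, which holds for all graphs.
\<close>

lemma split_moments_realize_walks:
  fixes t W :: "nat \<Rightarrow> real"
  assumes "t 0 = W 0" "t 1 = 0" "t 2 = W 1"
  obtains \<alpha> \<beta> \<gamma> \<tau> where "\<tau> 0 = \<beta> 0" "\<tau> 1 = \<gamma> 0"
    "split_closed_walks \<alpha> \<beta> \<tau> = t" "split_walks \<alpha> \<beta> \<gamma> = W"
proof -
  define F where "F s n = (if n < 2 then s n
      else split_closed_walks (\<lambda>_. 0) (\<lambda>i. s (2 * i + 1)) (\<lambda>i. s (2 * i)) n)"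
    for s :: "nat \<Rightarrow> real" and n
  define c :: "nat \<Rightarrow> real" where "c n = (if n < 2 then 1 else if even n then 2 else real n)" for n
  have "F s' n - F s n = c n * (s' n - s n)" if eq: "\<And>i. i < n \<Longrightarrow> s' i = s i" for s s' n
  proof -
    consider "n < 2" | m where "n = 2 * Suc m" | m where "n = 2 * Suc m + 1"
      by (metis One_nat_def Suc_1 add.commute dvdE even_Suc lessI less_Suc_eq nat.exhaust odd_two_times_div_two_succ
          old.nat.exhaust plus_1_eq_Suc mult_0_right zero_less_Suc)
    then show ?thesis
    proof cases
      case 1
      then show ?thesis by (simp add: F_def c_def)
    next
      case 2
      then show ?thesis
        using split_closed_walks_diff_even[of m "\<lambda>i. s' (2 * i + 1)" "\<lambda>i. s (2 * i + 1)"
            "\<lambda>i. s' (2 * i)" "\<lambda>i. s (2 * i)" "\<lambda>_. 0"] eq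
        by (simp add: F_def c_def)
    next
      case 3
      then show ?thesis
        using split_closed_walks_diff_odd[of m "\<lambda>i. s' (2 * i + 1)" "\<lambda>i. s (2 * i + 1)"
            "\<lambda>i. s' (2 * i)" "\<lambda>i. s (2 * i)" "\<lambda>_. 0"] eq
        by (simp add: F_def c_def)
    qed
  qed
  moreover have "c n \<noteq> 0" for n by (auto simp: c_def)
  ultimately obtain s where s: "\<And>n. F s n = (if n < 2 then 0 else t n)"
    using triangular_system_solvable[where F = F and c = c and target = "\<lambda>n. if n < 2 then 0 else t n"]
    by blast
  define \<beta> \<tau> where "\<beta> i = s (2 * i + 1)" and "\<tau> i = s (2 * i)" for i
  have \<beta>0: "\<beta> 0 = 0" "\<tau> 0 = 0" using s[of 0] s[of 1] by (simp_all add: F_def \<beta>_def \<tau>_def)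
  have closed: "split_closed_walks (\<lambda>_. 0) \<beta> \<tau> n = t n" if "n \<ge> 2" for n
    using s[of n] that by (simp add: F_def \<beta>_def[abs_def] \<tau>_def[abs_def])
  define F' where "F' s n = split_walks (\<lambda>i. s (2 * i)) \<beta> (\<lambda>i. s (2 * i + 1)) n"
    for s :: "nat \<Rightarrow> real" and n
  define c' :: "nat \<Rightarrow> real" where "c' n = (if even n then 1 else 2)" for n
  have "F' s' n - F' s n = c' n * (s' n - s n)" if eq: "\<And>i. i < n \<Longrightarrow> s' i = s i" for s s' n
  proof -
    consider m where "n = 2 * m" | m where "n = 2 * m + 1" by (meson oddE evenE)
    then show ?thesis
    proof cases
      case 1
      then show ?thesis
        using split_walks_diff_even[of m "\<lambda>i. s' (2 * i)" "\<lambda>i. s (2 * i)"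
            "\<lambda>i. s' (2 * i + 1)" "\<lambda>i. s (2 * i + 1)" \<beta>] eq
        by (simp add: F'_def c'_def)
    next
      case 2
      then show ?thesis
        using split_walks_diff_odd[of m "\<lambda>i. s' (2 * i)" "\<lambda>i. s (2 * i)"
            "\<lambda>i. s' (2 * i + 1)" "\<lambda>i. s (2 * i + 1)" \<beta>] eq
        by (simp add: F'_def c'_def)
    qed
  qed
  moreover have "c' n \<noteq> 0" for n by (auto simp: c'_def)
  ultimately obtain s' where s': "\<And>n. F' s' n = W n"
    using triangular_system_solvable[where F = F' and c = c' and target = W] by blast
  define \<alpha> \<gamma> where "\<alpha> i = s' (2 * i)" and "\<gamma> i = s' (2 * i + 1)" for i
  have walks: "split_walks \<alpha> \<beta> \<gamma> n = W n" for n
    using s'[of n] by (simp add: F'_def \<alpha>_def[abs_def] \<gamma>_def[abs_def])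
  have "split_closed_walks \<alpha> \<beta> \<tau> n = t n" for n
  proof (cases "(\<alpha>, \<beta>, \<tau>, n)" rule: split_closed_walks.cases)
    case 1
    then show ?thesis using walks[of 0] assms(1) by simp
  next
    case 2
    then show ?thesis using \<beta>0 assms(2) by simp
  next
    case (3 _ _ _ j)
    then show ?thesis using closed[of n] by simp
  qed
  moreover have "\<tau> 1 = \<gamma> 0"
    using closed[of 2] walks[of 1] assms(3) \<beta>0 by (simp add: numeral_2_eq_2)
  ultimately show ?thesis using that[of \<tau> \<beta> \<gamma> \<alpha>] \<beta>0 walks by (simp add: fun_eq_iff)
qed

subsection \<open>Interpolation of power moments\<close>

text \<open>
  A coefficient of a polynomial of degree at most \<open>n\<close> is a linear combination of its values at
  \<open>0, \<dots>, n\<close>, by Lagrange interpolation.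
\<close>

lemma dual_power_functionals:
  obtains \<psi> :: "nat \<Rightarrow> nat \<Rightarrow> real" where
    "\<And>a b. b \<le> n \<Longrightarrow> (\<Sum>p\<le>n. \<psi> a p * real p ^ b) = (if a = b then 1 else 0)"
proof -
  define l :: "nat \<Rightarrow> real poly" where
    "l p = (\<Prod>m\<in>{..n} - {p}. [:inverse (real p - real m):] * [:- real m, 1:])" for p
  have deg: "degree (l p) \<le> n" if "p \<le> n" for p
  proof -
    have "degree (l p) \<le> (\<Sum>m\<in>{..n} - {p}. degree ([:inverse (real p - real m):] * [:- real m, 1:]))"
      using degree_prod_sum_le[of "{..n} - {p}"] unfolding l_def comp_def by blast
    also have "\<dots> \<le> (\<Sum>m\<in>{..n} - {p}. 1)" by (rule sum_mono) simp
    also have "\<dots> = n" using that by simp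
    finally show ?thesis .
  qed
  have val: "poly (l p) (real k) = (if k = p then 1 else 0)" if "k \<le> n" for k p
  proof (cases "k = p")
    case True
    then show ?thesis by (simp add: l_def poly_prod) (intro prod.neutral, auto simp: left_diff_distrib[symmetric])
  next
    case False
    then have "k \<in> {..n} - {p}" using that by simp
    then show ?thesis using False unfolding l_def poly_prod by (intro trans[OF prod_zero]) auto
  qed
  have "monom 1 b = (\<Sum>p\<le>n. [:real p ^ b:] * l p)" if b: "b \<le> n" for b
  proof (rule poly_eqI_degree[of "real ` {..n}"])
    fix x assume "x \<in> real ` {..n}"
    then obtain k where "k \<le> n" "x = real k" by auto
    then show "poly (monom 1 b) x = poly (\<Sum>p\<le>n. [:real p ^ b:] * l p) x"
      by (simp add: poly_monom poly_sum val if_distrib cong: if_cong)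
  next
    have "card (real ` {..n}) = Suc n" by (subst card_image) (auto simp: inj_on_def)
    moreover have "degree (\<Sum>p\<le>n. [:real p ^ b:] * l p) \<le> n"
      by (intro degree_sum_le) (auto intro: order.trans[OF degree_mult_le] deg)
    ultimately show "degree (monom 1 b :: real poly) < card (real ` {..n})"
      "degree (\<Sum>p\<le>n. [:real p ^ b:] * l p) < card (real ` {..n})"
      using b by (simp_all add: degree_monom_eq)
  qed
  then have coeffs: "coeff (monom 1 b) a = (\<Sum>p\<le>n. coeff (l p) a * real p ^ b)"
    if "b \<le> n" for a b
    using that by (simp add: coeff_sum mult.commute)
  then have "(\<Sum>p\<le>n. coeff (l p) a * real p ^ b) = (if a = b then 1 else 0)" if "b \<le> n" for a b
    unfolding coeffs[OF that, symmetric] coeff_monom by auto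
  then show ?thesis by (intro that[of "\<lambda>a p. coeff (l p) a"])
qed

lemma power_moments_surjective:
  obtains x :: "nat \<Rightarrow> nat \<Rightarrow> real" where
    "\<And>a b. a \<le> n \<Longrightarrow> b \<le> n \<Longrightarrow> (\<Sum>p\<le>n. \<Sum>q\<le>n. x p q * (real p ^ a * real q ^ b)) = c a b"
proof -
  obtain \<psi> :: "nat \<Rightarrow> nat \<Rightarrow> real" where
    \<psi>: "\<And>a b. b \<le> n \<Longrightarrow> (\<Sum>p\<le>n. \<psi> a p * real p ^ b) = (if a = b then 1 else 0)"
    by (rule dual_power_functionals) blast
  have one: "(\<Sum>p\<le>n. (\<Sum>i\<le>n. y i * \<psi> i p) * real p ^ a) = y a" if "a \<le> n" for y a
  proof -
    have "(\<Sum>p\<le>n. (\<Sum>i\<le>n. y i * \<psi> i p) * real p ^ a)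
        = (\<Sum>i\<le>n. y i * (\<Sum>p\<le>n. \<psi> i p * real p ^ a))"
      unfolding sum_distrib_right sum_distrib_left by (subst sum.swap) (simp add: mult.assoc)
    then show ?thesis using that by (simp add: \<psi> if_distrib cong: if_cong)
  qed
  define z where "z a q = (\<Sum>j\<le>n. c a j * \<psi> j q)" for a q
  define x where "x p q = (\<Sum>i\<le>n. z i q * \<psi> i p)" for p q
  have "(\<Sum>p\<le>n. \<Sum>q\<le>n. x p q * (real p ^ a * real q ^ b)) = c a b" if ab: "a \<le> n" "b \<le> n" for a b
  proof -
    have "(\<Sum>p\<le>n. \<Sum>q\<le>n. x p q * (real p ^ a * real q ^ b))
        = (\<Sum>q\<le>n. (\<Sum>p\<le>n. x p q * real p ^ a) * real q ^ b)"
      unfolding sum_distrib_right by (subst sum.swap) (simp add: mult.assoc)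
    also have "\<dots> = (\<Sum>q\<le>n. z a q * real q ^ b)"
      using one[OF ab(1)] by (simp add: x_def)
    also have "\<dots> = c a b" using one[OF ab(2)] by (simp add: z_def)
    finally show ?thesis .
  qed
  then show ?thesis by (rule that)
qed

section \<open>Split graphs with prescribed moments\<close>

text \<open>
  A module \<open>(e, w, d)\<close> is a bipartite graph with three classes of \<open>w\<close> clique vertices and three
  classes of \<open>d\<close> independent vertices. Two classes \<open>i\<close> and \<open>j\<close> are completely joined, except that for
  \<open>e = True\<close> (a blown-up crown) classes with \<open>i = j\<close> are not joined. The two kinds have the same
  moments up to a rescaling, apart from the traces, which are affected by the second eigenvalue of
  the crown. A vertex is given by its module, the number of the copy, the side, the class and
  the position in the class.
\<close>

type_synonym module = "bool \<times> nat \<times> nat"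
type_synonym mvertex = "(module \<times> nat) \<times> bool \<times> nat \<times> nat"

definition width :: "module \<Rightarrow> nat" where "width \<iota> = fst (snd \<iota>)"
definition depth :: "module \<Rightarrow> nat" where "depth \<iota> = snd (snd \<iota>)"
definition valency :: "module \<Rightarrow> nat" where "valency \<iota> = (if fst \<iota> then 2 else 3)"

text \<open>
  The eigenvalue of \<open>N N\<^sup>T\<close> besides \<open>(valency \<iota>)\<^sup>2\<close>, where \<open>N\<close> is the 3 by 3 matrix \<open>cross \<iota>\<close>.
\<close>

definition defect :: "module \<Rightarrow> real" where
  "defect \<iota> = (if fst \<iota> then 1 else 0)"

abbreviation growth :: "module \<Rightarrow> real" where
  "growth \<iota> \<equiv> real (width \<iota>) * real (depth \<iota>) * real (valency \<iota>) ^ 2"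

definition cross :: "module \<Rightarrow> nat \<Rightarrow> nat \<Rightarrow> real" where
  "cross \<iota> i j = (if fst \<iota> \<and> i = j then 0 else 1)"

definition clique_part :: "(module \<times> nat) set \<Rightarrow> mvertex set" where
  "clique_part Z = (SIGMA z:Z. {True} \<times> {..<3} \<times> {..<width (fst z)})"

definition indep_part :: "(module \<times> nat) set \<Rightarrow> mvertex set" where
  "indep_part Z = (SIGMA z:Z. {False} \<times> {..<3} \<times> {..<depth (fst z)})"

definition module_weight :: "(module \<times> nat) set \<Rightarrow> mvertex \<Rightarrow> mvertex \<Rightarrow> real" where
  "module_weight Z u v =
    (if u \<in> clique_part Z \<and> v \<in> clique_part Z then (if u = v then 0 else 1)
     else if u \<in> clique_part Z \<and> v \<in> indep_part Z \<or> u \<in> indep_part Z \<and> v \<in> clique_part Z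
       then (if fst u = fst v then cross (fst (fst u)) (fst (snd (snd u))) (fst (snd (snd v))) else 0)
     else 0)"

lemma cross_commute: "cross \<iota> i j = cross \<iota> j i"
  by (auto simp: cross_def)

lemma clique_part_iff: "(z, b, i, x) \<in> clique_part Z \<longleftrightarrow> z \<in> Z \<and> b \<and> i < 3 \<and> x < width (fst z)"
  by (auto simp: clique_part_def)

lemma indep_part_iff: "(z, b, i, x) \<in> indep_part Z \<longleftrightarrow> z \<in> Z \<and> \<not> b \<and> i < 3 \<and> x < depth (fst z)"
  by (auto simp: indep_part_def)

lemma finite_parts: "finite Z \<Longrightarrow> finite (clique_part Z)" "finite Z \<Longrightarrow> finite (indep_part Z)"
  unfolding clique_part_def indep_part_def by (rule finite_SigmaI; simp)+

lemma not_both_parts: "v \<in> clique_part Z \<Longrightarrow> v \<notin> indep_part Z"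
  by (cases v) (simp add: clique_part_iff indep_part_iff)

lemma split_weighted_module:
  assumes "finite Z"
  shows "split_weighted (clique_part Z \<union> indep_part Z) (module_weight Z) (clique_part Z) (indep_part Z)"
proof
  show "finite (clique_part Z \<union> indep_part Z)"
    using assms by (simp add: finite_parts)
  show "module_weight Z u w = module_weight Z w u" for u w
    by (cases "fst u = fst w"; cases "u = w")
      (simp_all add: module_weight_def conj_commute disj_commute cross_commute)
  show "module_weight Z u w = 0" if "u \<notin> clique_part Z \<union> indep_part Z" for u w
    using that by (simp add: module_weight_def)
  show "clique_part Z \<inter> indep_part Z = {}" using not_both_parts by blast
  show "module_weight Z u w = 0" if "u \<in> indep_part Z" "w \<in> indep_part Z" for u w
    using that not_both_parts[of u Z] not_both_parts[of w Z] by (auto simp: module_weight_def)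
qed (simp_all add: module_weight_def)

lemma sum_less_3: "(\<Sum>i<(3::nat). f i) = f 0 + f 1 + (f 2 :: real)"
  by (simp add: numeral_3_eq_3 numeral_2_eq_2)

lemma less_3_cases: "(i::nat) < 3 \<Longrightarrow> i = 0 \<or> i = 1 \<or> i = 2"
  by linarith

lemma sum_clique_part:
  assumes "finite Z"
  shows "sum f (clique_part Z) = (\<Sum>z\<in>Z. \<Sum>i<3. \<Sum>x<width (fst z). f (z, True, i, x))"
proof -
  have "sum f (clique_part Z) = (\<Sum>z\<in>Z. \<Sum>w\<in>{True} \<times> {..<3} \<times> {..<width (fst z)}. f (z, w))"
    unfolding clique_part_def using assms by (subst sum.Sigma) (simp_all add: split_beta)
  then show ?thesis by (simp add: sum.cartesian_product')
qed

lemma sum_indep_part: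
  assumes "finite Z"
  shows "sum f (indep_part Z) = (\<Sum>z\<in>Z. \<Sum>i<3. \<Sum>y<depth (fst z). f (z, False, i, y))"
proof -
  have "sum f (indep_part Z) = (\<Sum>z\<in>Z. \<Sum>w\<in>{False} \<times> {..<3} \<times> {..<depth (fst z)}. f (z, w))"
    unfolding indep_part_def using assms by (subst sum.Sigma) (simp_all add: split_beta)
  then show ?thesis by (simp add: sum.cartesian_product')
qed

lemma sum_cross: "(\<Sum>j<3. cross \<iota> i j) = valency \<iota>" if "i < 3"
  using less_3_cases[OF that] by (auto simp: sum_less_3 cross_def valency_def)

locale module_graph =
  fixes Z :: "(module \<times> nat) set"
  assumes finZ: "finite Z"
begin

sublocale split_weighted "clique_part Z \<union> indep_part Z" "module_weight Z" "clique_part Z" "indep_part Z"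
  by (rule split_weighted_module[OF finZ])

lemma down_eq:
  assumes "supported (clique_part Z) f" "(z, False, i, y) \<in> indep_part Z"
  shows "down f (z, False, i, y) = (\<Sum>j<3. \<Sum>x<width (fst z). cross (fst z) i j * f (z, True, j, x))"
proof -
  have z: "z \<in> Z" using assms(2) by (simp add: indep_part_iff)
  have nK: "(z, False, i, y) \<notin> clique_part Z" by (simp add: clique_part_iff)
  have "down f (z, False, i, y) = (\<Sum>w\<in>clique_part Z. module_weight Z (z, False, i, y) w * f w)"
  proof -
    have "(\<Sum>w\<in>indep_part Z. module_weight Z (z, False, i, y) w * f w) = 0"
    proof (intro sum.neutral ballI)
      fix w assume "w \<in> indep_part Z"
      then have "f w = 0" using assms(1) not_both_parts[of w Z] unfolding supported_def by metis
      then show "module_weight Z (z, False, i, y) w * f w = 0" by simp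
    qed
    then show ?thesis using assms(2) by (simp add: down_def restrict_to_def A_def sum_V)
  qed
  also have "\<dots> = (\<Sum>z'\<in>Z. if z = z'
      then \<Sum>j<3. \<Sum>x<width (fst z). cross (fst z) i j * f (z, True, j, x) else 0)"
    unfolding sum_clique_part[OF finZ]
  proof (intro sum.cong refl)
    fix z' assume "z' \<in> Z"
    then have "module_weight Z (z, False, i, y) (z', True, j, x)
        = (if z = z' then cross (fst z) i j else 0)" if "j < 3" "x < width (fst z')" for j x
      using that assms(2) nK by (simp add: module_weight_def clique_part_iff)
    then show "(\<Sum>j<3. \<Sum>x<width (fst z'). module_weight Z (z, False, i, y) (z', True, j, x) * f (z', True, j, x))
        = (if z = z' then \<Sum>j<3. \<Sum>x<width (fst z). cross (fst z) i j * f (z, True, j, x) else 0)"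
      by simp
  qed
  also have "\<dots> = (\<Sum>j<3. \<Sum>x<width (fst z). cross (fst z) i j * f (z, True, j, x))"
    using z finZ by simp
  finally show ?thesis .
qed

lemma A_indep_eq:
  assumes "supported (indep_part Z) f" "(z, True, i, x) \<in> clique_part Z"
  shows "A f (z, True, i, x) = (\<Sum>j<3. \<Sum>y<depth (fst z). cross (fst z) i j * f (z, False, j, y))"
proof -
  have z: "z \<in> Z" using assms(2) by (simp add: clique_part_iff)
  have nK: "(z, True, i, x) \<notin> indep_part Z" by (simp add: indep_part_iff)
  have "A f (z, True, i, x) = (\<Sum>w\<in>indep_part Z. module_weight Z (z, True, i, x) w * f w)"
  proof -
    have "(\<Sum>w\<in>clique_part Z. module_weight Z (z, True, i, x) w * f w) = 0"
    proof (intro sum.neutral ballI)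
      fix w assume "w \<in> clique_part Z"
      then have "f w = 0" using assms(1) not_both_parts[of w Z] unfolding supported_def by metis
      then show "module_weight Z (z, True, i, x) w * f w = 0" by simp
    qed
    then show ?thesis by (simp add: A_def sum_V)
  qed
  also have "\<dots> = (\<Sum>z'\<in>Z. if z = z'
      then \<Sum>j<3. \<Sum>y<depth (fst z). cross (fst z) i j * f (z, False, j, y) else 0)"
    unfolding sum_indep_part[OF finZ]
  proof (intro sum.cong refl)
    fix z' assume "z' \<in> Z"
    then have "module_weight Z (z, True, i, x) (z', False, j, y)
        = (if z = z' then cross (fst z) i j else 0)" if "j < 3" "y < depth (fst z')" for j y
      using that assms(2) nK by (simp add: module_weight_def clique_part_iff indep_part_iff)
    then show "(\<Sum>j<3. \<Sum>y<depth (fst z'). module_weight Z (z, True, i, x) (z', False, j, y) * f (z', False, j, y))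
        = (if z = z' then \<Sum>j<3. \<Sum>y<depth (fst z). cross (fst z) i j * f (z, False, j, y) else 0)"
      by simp
  qed
  also have "\<dots> = (\<Sum>j<3. \<Sum>y<depth (fst z). cross (fst z) i j * f (z, False, j, y))"
    using z finZ by simp
  finally show ?thesis .
qed

lemma sum_cross_const:
  assumes "i < 3"
  shows "(\<Sum>j<3. \<Sum>x<n. cross \<iota> i j * c) = real n * real (valency \<iota>) * c"
  using sum_cross[OF assms] by (simp add: sum_distrib_left[symmetric] sum_distrib_right[symmetric])

lemma gram_pow_indic:
  assumes "(z, True, i, x) \<in> clique_part Z"
  shows "(gram ^^ r) (indic (clique_part Z)) (z, True, i, x) = growth (fst z) ^ r"
  using assms
proof (induction r arbitrary: i x)
  case 0
  then show ?case by (simp add: indic_def)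
next
  case (Suc r)
  have z: "z \<in> Z" "i < 3" using Suc.prems by (simp_all add: clique_part_iff)
  have "down (p r) (z, False, j, y) = real (width (fst z)) * real (valency (fst z)) * growth (fst z) ^ r"
    if "j < 3" "y < depth (fst z)" for j y
  proof -
    have "down (p r) (z, False, j, y) = (\<Sum>k<3. \<Sum>x<width (fst z). cross (fst z) j k * growth (fst z) ^ r)"
      using z that by (subst down_eq[OF supported_p])
        (simp_all add: indep_part_iff clique_part_iff Suc.IH)
    also have "\<dots> = real (width (fst z)) * real (valency (fst z)) * growth (fst z) ^ r" by (rule sum_cross_const[OF that(1)])
    finally show ?thesis .
  qed
  then have "gram (p r) (z, True, i, x) = (\<Sum>j<3. \<Sum>y<depth (fst z). cross (fst z) i j *
      (real (width (fst z)) * real (valency (fst z)) * growth (fst z) ^ r))"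
    unfolding gram_def by (subst A_indep_eq[OF supported_down Suc.prems]) simp
  then show ?case unfolding sum_cross_const[OF z(2)] by (simp add: power2_eq_square)
qed

lemma down_gram_pow_indic:
  assumes "(z, False, i, y) \<in> indep_part Z"
  shows "down (p r) (z, False, i, y) = real (width (fst z)) * real (valency (fst z)) * growth (fst z) ^ r"
proof -
  have z: "z \<in> Z" "i < 3" using assms by (simp_all add: indep_part_iff)
  have "down (p r) (z, False, i, y) = (\<Sum>k<3. \<Sum>x<width (fst z). cross (fst z) i k * growth (fst z) ^ r)"
    using z by (subst down_eq[OF supported_p assms]) (simp add: clique_part_iff gram_pow_indic)
  then show ?thesis unfolding sum_cross_const[OF z(2)] .
qed

lemma cogram_pow_indic:
  assumes "(z, False, i, y) \<in> indep_part Z"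
  shows "(cogram ^^ r) (indic (indep_part Z)) (z, False, i, y) = growth (fst z) ^ r"
  using assms
proof (induction r arbitrary: i y)
  case 0
  then show ?case by (simp add: indic_def)
next
  case (Suc r)
  have z: "z \<in> Z" "i < 3" using Suc.prems by (simp_all add: indep_part_iff)
  have "q r (z, True, j, x) = real (depth (fst z)) * real (valency (fst z)) * growth (fst z) ^ r"
    if "j < 3" "x < width (fst z)" for j x
  proof -
    have "q r (z, True, j, x) = (\<Sum>k<3. \<Sum>y<depth (fst z). cross (fst z) j k * growth (fst z) ^ r)"
      using z that by (subst A_indep_eq[OF supported_n])
        (simp_all add: indep_part_iff clique_part_iff Suc.IH)
    also have "\<dots> = real (depth (fst z)) * real (valency (fst z)) * growth (fst z) ^ r" by (rule sum_cross_const[OF that(1)])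
    finally show ?thesis .
  qed
  then have "down (q r) (z, False, i, y) = (\<Sum>j<3. \<Sum>x<width (fst z). cross (fst z) i j *
      (real (depth (fst z)) * real (valency (fst z)) * growth (fst z) ^ r))"
    by (subst down_eq[OF supported_q Suc.prems]) simp
  then show ?case unfolding down_q sum_cross_const[OF z(2)] by (simp add: power2_eq_square)
qed

lemma cross_cross:
  assumes "i < 3" "k < 3"
  shows "(\<Sum>j<3. cross \<iota> i j * cross \<iota> j k)
    = (real (valency \<iota>) ^ 2 - defect \<iota>) / 3 + (if i = k then defect \<iota> else 0)"
  using less_3_cases[OF assms(1)] less_3_cases[OF assms(2)]
  by (auto simp: sum_less_3 cross_def valency_def defect_def)

lemma gram_eq:
  assumes f: "supported (clique_part Z) f" and v: "(z, True, i, x) \<in> clique_part Z"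
    and const: "\<And>j x'. j < 3 \<Longrightarrow> x' < width (fst z) \<Longrightarrow> f (z, True, j, x') = g j"
  shows "gram f (z, True, i, x) = real (width (fst z)) * real (depth (fst z)) *
    ((real (valency (fst z)) ^ 2 - defect (fst z)) / 3 * (\<Sum>j<3. g j) + defect (fst z) * g i)"
proof -
  have z: "z \<in> Z" "i < 3" using v by (simp_all add: clique_part_iff)
  have d: "down f (z, False, j, y) = real (width (fst z)) * (\<Sum>k<3. cross (fst z) j k * g k)"
    if "j < 3" "y < depth (fst z)" for j y
    using z that by (subst down_eq[OF f]) (auto simp: indep_part_iff const sum_distrib_left)
  have "gram f (z, True, i, x)
      = real (depth (fst z)) * (\<Sum>j<3. cross (fst z) i j * (real (width (fst z)) * (\<Sum>k<3. cross (fst z) j k * g k)))"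
    unfolding gram_def using d
    by (subst A_indep_eq[OF supported_down v]) (simp add: sum_distrib_left)
  also have "\<dots> = real (width (fst z)) * real (depth (fst z)) *
      (\<Sum>k<3. (\<Sum>j<3. cross (fst z) i j * cross (fst z) j k) * g k)"
    by (simp add: sum_less_3 algebra_simps)
  also have "(\<Sum>k<3. (\<Sum>j<3. cross (fst z) i j * cross (fst z) j k) * g k)
      = (\<Sum>k<3. (real (valency (fst z)) ^ 2 - defect (fst z)) / 3 * g k + (if i = k then defect (fst z) * g k else 0))"
  proof (intro sum.cong refl)
    fix k :: nat assume "k \<in> {..<3}"
    then show "(\<Sum>j<3. cross (fst z) i j * cross (fst z) j k) * g k
        = (real (valency (fst z)) ^ 2 - defect (fst z)) / 3 * g k + (if i = k then defect (fst z) * g k else 0)"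
      by (subst cross_cross[OF z(2)]) (auto simp: distrib_right)
  qed
  also have "\<dots> = (real (valency (fst z)) ^ 2 - defect (fst z)) / 3 * (\<Sum>j<3. g j) + defect (fst z) * g i"
    using z by (simp add: sum.distrib sum_distrib_left)
  finally show ?thesis .
qed

text \<open>
  The powers of \<open>B B\<^sup>T\<close> are constant on pairs of classes, so they are determined by the powers of
  the 3 by 3 matrix \<open>N N\<^sup>T = a J + b I\<close>.
\<close>

lemma gram_pow_point:
  assumes v: "(z, True, i, x) \<in> clique_part Z" and u: "(z, True, k, x') \<in> clique_part Z"
  shows "(gram ^^ Suc r) (point (z, True, i, x)) (z, True, k, x') =
    real (width (fst z)) ^ r * real (depth (fst z)) ^ Suc r *
      ((real (valency (fst z)) ^ (2 * Suc r) - defect (fst z)) / 3 + (if i = k then defect (fst z) else 0))"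
  using u
proof (induction r arbitrary: k x')
  case 0
  have z: "z \<in> Z" "i < 3" "k < 3" "x < width (fst z)" using v 0 by (simp_all add: clique_part_iff)
  have s: "supported (clique_part Z) (point (z, True, i, x))" by (rule supported_point[OF v])
  have d: "down (point (z, True, i, x)) (z, False, j, y) = cross (fst z) j i"
    if "j < 3" "y < depth (fst z)" for j y
  proof -
    have "down (point (z, True, i, x)) (z, False, j, y)
        = (\<Sum>k<3. \<Sum>x'<width (fst z). if k = i then if x' = x then cross (fst z) j i else 0 else 0)"
      using z that by (subst down_eq[OF s]) (auto simp: indep_part_iff point_def intro!: sum.cong)
    also have "\<dots> = (\<Sum>k<3. if k = i then cross (fst z) j i else 0)"
      using z by (intro sum.cong) auto
    finally show ?thesis using z by simp
  qed
  then have "gram (point (z, True, i, x)) (z, True, k, x')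
      = real (depth (fst z)) * (\<Sum>j<3. cross (fst z) k j * cross (fst z) j i)"
    unfolding gram_def
    by (subst A_indep_eq[OF supported_down 0]) (simp add: sum_distrib_left)
  then show ?case using z by (simp add: cross_cross)
next
  case (Suc r)
  let ?c = "real (width (fst z)) ^ r * real (depth (fst z)) ^ Suc r"
  let ?A = "(real (valency (fst z)) ^ (2 * Suc r) - defect (fst z)) / 3"
  let ?g = "\<lambda>j. ?c * (?A + (if i = j then defect (fst z) else 0))"
  have z: "z \<in> Z" "i < 3" using v by (simp_all add: clique_part_iff)
  have s: "supported (clique_part Z) ((gram ^^ Suc r) (point (z, True, i, x)))"
    by (rule supported_gram_pow[OF supported_point[OF v]])
  have "(gram ^^ Suc (Suc r)) (point (z, True, i, x)) (z, True, k, x')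
      = real (width (fst z)) * real (depth (fst z)) *
        ((real (valency (fst z)) ^ 2 - defect (fst z)) / 3 * (\<Sum>j<3. ?g j) + defect (fst z) * ?g k)"
  proof -
    have "gram ((gram ^^ Suc r) (point (z, True, i, x))) (z, True, k, x')
        = real (width (fst z)) * real (depth (fst z)) *
          ((real (valency (fst z)) ^ 2 - defect (fst z)) / 3 * (\<Sum>j<3. ?g j) + defect (fst z) * ?g k)"
      by (rule gram_eq[OF s Suc.prems], rule Suc.IH) (simp add: clique_part_iff z)
    then show ?thesis by (simp only: funpow.simps comp_apply)
  qed
  also have "(\<Sum>j<3. ?g j) = ?c * real (valency (fst z)) ^ (2 * Suc r)"
    using less_3_cases[OF z(2)] by (auto simp: sum_less_3 field_simps)
  also have "real (width (fst z)) * real (depth (fst z)) *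
        ((real (valency (fst z)) ^ 2 - defect (fst z)) / 3 * (?c * real (valency (fst z)) ^ (2 * Suc r)) + defect (fst z) * ?g k)
      = real (width (fst z)) ^ Suc r * real (depth (fst z)) ^ Suc (Suc r) *
        ((real (valency (fst z)) ^ (2 * Suc (Suc r)) - defect (fst z)) / 3 + (if i = k then defect (fst z) else 0))"
  proof -
    have "defect (fst z) = 0 \<or> defect (fst z) = 1" by (simp add: defect_def)
    then show ?thesis by (elim disjE) (simp_all add: field_simps power2_eq_square)
  qed
  finally show ?case .
qed

lemma clique_moment_eq: "clique_moment r = (\<Sum>z\<in>Z. 3 * real (width (fst z)) * growth (fst z) ^ r)"
  unfolding clique_moment_def sum_clique_part[OF finZ]
  by (intro sum.cong refl) (simp add: gram_pow_indic clique_part_iff)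

lemma indep_moment_eq: "indep_moment r = (\<Sum>z\<in>Z. 3 * real (depth (fst z)) * growth (fst z) ^ r)"
  unfolding indep_moment_def sum_indep_part[OF finZ]
  by (intro sum.cong refl) (simp add: cogram_pow_indic indep_part_iff)

lemma cross_moment_eq: "cross_moment r =
    (\<Sum>z\<in>Z. 3 * real (width (fst z)) * real (depth (fst z)) * real (valency (fst z)) * growth (fst z) ^ r)"
  unfolding cross_moment_def sum_indep_part[OF finZ]
  by (intro sum.cong refl) (simp add: down_gram_pow_indic indep_part_iff)

lemma trace_moment_0: "trace_moment 0 = (\<Sum>z\<in>Z. 3 * real (width (fst z)))"
  unfolding trace_moment_def sum_clique_part[OF finZ] by (simp add: point_def)

lemma trace_moment_Suc: "trace_moment (Suc r) = (\<Sum>z\<in>Z. (real (width (fst z)) * real (depth (fst z))) ^ Suc r *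
    (real (valency (fst z)) ^ (2 * Suc r) + 2 * defect (fst z)))"
  unfolding trace_moment_def sum_clique_part[OF finZ]
proof (intro sum.cong refl)
  fix z assume z: "z \<in> Z"
  have "(gram ^^ Suc r) (point (z, True, i, x)) (z, True, i, x) =
      real (width (fst z)) ^ r * real (depth (fst z)) ^ Suc r *
      ((real (valency (fst z)) ^ (2 * Suc r) - defect (fst z)) / 3 + defect (fst z))"
    if "i < 3" "x < width (fst z)" for i x
    using gram_pow_point[of z i x i x r] that z by (simp add: clique_part_iff)
  then show "(\<Sum>i<3. \<Sum>x<width (fst z). (gram ^^ Suc r) (point (z, True, i, x)) (z, True, i, x))
     = (real (width (fst z)) * real (depth (fst z))) ^ Suc r *
    (real (valency (fst z)) ^ (2 * Suc r) + 2 * defect (fst z))"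
    by (simp del: funpow.simps add: power_mult_distrib) (simp add: field_simps)
qed

end

text \<open>
  The vertices of the graph are tuples, which have to be encoded as natural numbers.
\<close>

lemma walks_transfer:
  fixes h :: "'a \<Rightarrow> 'b"
  assumes wg: "weighted_graph V a" "weighted_graph V' a'"
    and V': "V' = h ` V" and h: "inj h" and a': "\<And>u w. a' (h u) (h w) = a u w"
  shows "weighted_graph.closed_walks V' a' = weighted_graph.closed_walks V a"
    "weighted_graph.walks V' a' = weighted_graph.walks V a"
proof -
  interpret G: weighted_graph V a by (rule wg)
  interpret H: weighted_graph V' a' by (rule wg)
  have sum': "sum g V' = (\<Sum>v\<in>V. g (h v))" for g :: "'b \<Rightarrow> real"
    unfolding V' by (rule sum.reindex_cong[OF inj_on_subset[OF h]]) auto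
  have A: "H.A f (h u) = G.A (\<lambda>u. f (h u)) u" for f u
    unfolding H.A_def G.A_def sum' by (simp add: a')
  have pow: "(H.A ^^ j) f (h u) = (G.A ^^ j) (\<lambda>u. f (h u)) u" for f u j
  proof (induction j arbitrary: u)
    case (Suc j)
    then show ?case by (simp add: A)
  qed simp
  have "(\<lambda>u. point (h v) (h u)) = point v" for v
    using h by (simp add: point_def inj_eq fun_eq_iff)
  then have "H.closed_walks j = G.closed_walks j" for j
    unfolding H.closed_walks_def G.closed_walks_def sum' pow by simp
  then show "H.closed_walks = G.closed_walks" by (rule ext)
  have "(\<lambda>u. indic V' (h u)) = indic V"
    unfolding V' indic_def inj_image_mem_iff[OF h] ..
  then have "H.walks j = G.walks j" for j
    unfolding H.walks_def G.walks_def H.inner_def G.inner_def sum' pow by (simp add: fun_eq_iff)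
  then show "H.walks = G.walks" by (rule ext)
qed

definition module_ngraph :: "(module \<times> nat) set \<Rightarrow> ngraph" where
  "module_ngraph Z =
    (let V = to_nat ` (clique_part Z \<union> indep_part Z)
     in \<lparr> pverts = V,
          parcs = {(i, j). i \<in> V \<and> j \<in> V \<and> module_weight Z (from_nat i) (from_nat j) \<noteq> 0} \<rparr>)"

lemma pverts_module_ngraph: "pverts (module_ngraph Z) = to_nat ` (clique_part Z \<union> indep_part Z)"
  by (simp add: module_ngraph_def Let_def)

lemma parcs_module_ngraph:
  "(i, j) \<in> parcs (module_ngraph Z) \<longleftrightarrow> i \<in> pverts (module_ngraph Z) \<and> j \<in> pverts (module_ngraph Z) \<and>
    module_weight Z (from_nat i) (from_nat j) \<noteq> 0"
  by (simp add: module_ngraph_def Let_def)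

lemma module_weight_outside:
  "u \<notin> clique_part Z \<union> indep_part Z \<or> v \<notin> clique_part Z \<union> indep_part Z \<Longrightarrow> module_weight Z u v = 0"
  by (auto simp only: module_weight_def split: if_split)

lemma edge_weight_module_ngraph:
  "edge_weight (module_ngraph Z) (to_nat u) (to_nat v) = module_weight Z u v"
proof -
  have "module_weight Z u v = 0 \<or> module_weight Z u v = 1"
    by (simp add: module_weight_def cross_def)
  moreover have "to_nat w \<in> pverts (module_ngraph Z) \<longleftrightarrow> w \<in> clique_part Z \<union> indep_part Z" for w
    unfolding pverts_module_ngraph by (rule inj_image_mem_iff[OF inj_to_nat])
  ultimately show ?thesis
    using module_weight_outside[of u Z v] unfolding edge_weight_def parcs_module_ngraph from_nat_to_nat
    by metis
qed

lemma split_graph_module_ngraph: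
  assumes Z: "finite Z" and ne: "clique_part Z \<noteq> {}"
  shows "split_graph (module_ngraph Z)"
proof -
  interpret split_weighted "clique_part Z \<union> indep_part Z" "module_weight Z" "clique_part Z" "indep_part Z"
    by (rule split_weighted_module[OF Z])
  have "sgraph (module_ngraph Z)"
  proof (rule sgraphI)
    show "finite (pverts (module_ngraph Z))"
      unfolding pverts_module_ngraph by (rule finite_imageI[OF fin])
    show "pverts (module_ngraph Z) \<noteq> {}"
      unfolding pverts_module_ngraph using ne by simp
    show "parcs (module_ngraph Z) \<subseteq> pverts (module_ngraph Z) \<times> pverts (module_ngraph Z)"
      using parcs_module_ngraph[of _ _ Z] by (intro subrelI SigmaI) simp_all
    show "(v, u) \<in> parcs (module_ngraph Z)" if "(u, v) \<in> parcs (module_ngraph Z)" for u v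
      using that sym[of "from_nat u" "from_nat v"] unfolding parcs_module_ngraph by simp
    show "(u, u) \<notin> parcs (module_ngraph Z)" for u
    proof
      assume u: "(u, u) \<in> parcs (module_ngraph Z)"
      then obtain v where v: "v \<in> clique_part Z \<union> indep_part Z" "u = to_nat v"
        unfolding parcs_module_ngraph pverts_module_ngraph by blast
      have "module_weight Z v v = 0" using v(1) clique[of v v] indep[of v v] by (elim UnE) simp_all
      then show False using u v(2) unfolding parcs_module_ngraph by simp
    qed
  qed
  moreover have "pverts (module_ngraph Z) = to_nat ` clique_part Z \<union> to_nat ` indep_part Z"
    unfolding pverts_module_ngraph by (rule image_Un)
  moreover have "to_nat ` clique_part Z \<inter> to_nat ` indep_part Z = {}"
    unfolding image_Int[OF inj_to_nat, symmetric] disjoint by simp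
  moreover have "\<forall>u\<in>to_nat ` clique_part Z. \<forall>v\<in>to_nat ` clique_part Z.
      u \<noteq> v \<longrightarrow> (u, v) \<in> parcs (module_ngraph Z)"
    unfolding parcs_module_ngraph pverts_module_ngraph by (simp add: clique)
  moreover have "\<forall>u\<in>to_nat ` indep_part Z. \<forall>v\<in>to_nat ` indep_part Z. (u, v) \<notin> parcs (module_ngraph Z)"
    unfolding parcs_module_ngraph by (simp add: indep)
  ultimately show ?thesis unfolding split_graph_def by blast
qed

text \<open>
  The moments are linear in the multiplicities of the modules, and make sense for real ones.
\<close>

definition modules_upto :: "nat \<Rightarrow> module set" where
  "modules_upto n = UNIV \<times> {..n} \<times> {..n}"

definition real_clique_moment :: "nat \<Rightarrow> (module \<Rightarrow> real) \<Rightarrow> nat \<Rightarrow> real" where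
  "real_clique_moment n x r = (\<Sum>\<iota>\<in>modules_upto n. x \<iota> * (3 * real (width \<iota>) * growth \<iota> ^ r))"

definition real_indep_moment :: "nat \<Rightarrow> (module \<Rightarrow> real) \<Rightarrow> nat \<Rightarrow> real" where
  "real_indep_moment n x r = (\<Sum>\<iota>\<in>modules_upto n. x \<iota> * (3 * real (depth \<iota>) * growth \<iota> ^ r))"

definition real_cross_moment :: "nat \<Rightarrow> (module \<Rightarrow> real) \<Rightarrow> nat \<Rightarrow> real" where
  "real_cross_moment n x r = (\<Sum>\<iota>\<in>modules_upto n.
     x \<iota> * (3 * real (width \<iota>) * real (depth \<iota>) * real (valency \<iota>) * growth \<iota> ^ r))"

definition real_trace_moment :: "nat \<Rightarrow> (module \<Rightarrow> real) \<Rightarrow> nat \<Rightarrow> real" where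
  "real_trace_moment n x r = (\<Sum>\<iota>\<in>modules_upto n. x \<iota> *
     (if r = 0 then 3 * real (width \<iota>)
      else (real (width \<iota>) * real (depth \<iota>)) ^ r * (real (valency \<iota>) ^ (2 * r) + 2 * defect \<iota>)))"

definition real_word_trace :: "nat \<Rightarrow> (module \<Rightarrow> real) \<Rightarrow> bool list \<Rightarrow> real" where
  "real_word_trace n x w = word_trace
     (split_closed_walks (real_indep_moment n x) (real_clique_moment n x) (real_trace_moment n x))
     (split_walks (real_indep_moment n x) (real_clique_moment n x) (real_cross_moment n x)) w 0"

lemma walk_count_module_ngraph:
  assumes k: "\<And>\<iota>. \<iota> \<in> modules_upto n \<Longrightarrow> k \<iota> \<ge> 1" and n: "n \<ge> 1"
  obtains G where "split_graph G" "\<And>w. walk_count w G = real_word_trace n (\<lambda>\<iota>. real (k \<iota>)) w"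
proof -
  define Z where "Z = (SIGMA \<iota>:modules_upto n. {..<k \<iota>})"
  have fin_mod: "finite (modules_upto n)" by (simp add: modules_upto_def)
  then have finZ: "finite Z" by (simp add: Z_def)
  interpret module_graph Z by unfold_locales (rule finZ)
  have Z_sum: "(\<Sum>z\<in>Z. f (fst z)) = (\<Sum>\<iota>\<in>modules_upto n. real (k \<iota>) * f \<iota>)" for f :: "module \<Rightarrow> real"
    unfolding Z_def using fin_mod by (subst sum.Sigma[symmetric, of _ _ "\<lambda>\<iota> _. f \<iota>", unfolded split_def]) simp_all
  let ?x = "\<lambda>\<iota>. real (k \<iota>)"
  have "clique_moment = real_clique_moment n ?x"
    unfolding fun_eq_iff clique_moment_eq real_clique_moment_def by (intro allI Z_sum)
  moreover have "indep_moment = real_indep_moment n ?x"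
    unfolding fun_eq_iff indep_moment_eq real_indep_moment_def by (intro allI Z_sum)
  moreover have "cross_moment = real_cross_moment n ?x"
    unfolding fun_eq_iff cross_moment_eq real_cross_moment_def by (intro allI Z_sum)
  moreover have "trace_moment = real_trace_moment n ?x"
  proof
    fix r
    show "trace_moment r = real_trace_moment n ?x r"
    proof (cases r)
      case 0
      show ?thesis unfolding 0 trace_moment_0 real_trace_moment_def by (subst Z_sum) simp
    next
      case (Suc i)
      show ?thesis unfolding Suc trace_moment_Suc real_trace_moment_def by (subst Z_sum) simp
    qed
  qed
  ultimately have walks: "closed_walks = split_closed_walks (real_indep_moment n ?x)
        (real_clique_moment n ?x) (real_trace_moment n ?x)"
    "walks = split_walks (real_indep_moment n ?x) (real_clique_moment n ?x) (real_cross_moment n ?x)"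
    unfolding fun_eq_iff[of closed_walks] fun_eq_iff[of walks] closed_walks_eq walks_eq by simp_all
  have "(((False, 1, 1), 0), True, 0, 0) \<in> clique_part Z"
    using n k[of "(False, 1, 1)"] by (simp add: clique_part_iff Z_def modules_upto_def width_def)
  then have split: "split_graph (module_ngraph Z)"
    using finZ by (intro split_graph_module_ngraph) auto
  then have G: "sgraph (module_ngraph Z)" by (simp add: split_graph_def)
  note transfer = walks_transfer[OF weighted_graph_axioms weighted_graph_edge_weight[OF G]
      pverts_module_ngraph inj_to_nat edge_weight_module_ngraph]
  have "walk_count w (module_ngraph Z) = real_word_trace n (\<lambda>\<iota>. real (k \<iota>)) w" for w
    unfolding walk_count_eq_word_trace[OF G] transfer real_word_trace_def walks ..
  with split show ?thesis by (rule that)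
qed

subsection \<open>Polynomials in many variables\<close>

text \<open>
  Being polynomial in each variable separately suffices for passing from natural to real arguments,
  one variable at a time.
\<close>

definition separately_polynomial :: "(('i \<Rightarrow> real) \<Rightarrow> real) \<Rightarrow> bool" where
  "separately_polynomial f \<longleftrightarrow> (\<forall>x i. \<exists>q. \<forall>y. f (x(i := y)) = poly q y)"

named_theorems sep_poly

lemma sep_poly_const [sep_poly]: "separately_polynomial (\<lambda>x. c)"
  unfolding separately_polynomial_def by (metis poly_pCons poly_0 mult_zero_right add.right_neutral)

lemma sep_poly_coord [sep_poly]: "separately_polynomial (\<lambda>x. x j)"
  unfolding separately_polynomial_def
proof (intro allI)
  fix x :: "'a \<Rightarrow> real" and i
  show "\<exists>q. \<forall>y. (x(i := y)) j = poly q y"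
    by (rule exI[of _ "if i = j then [:0, 1:] else [:x j:]"]) simp
qed

lemma sep_poly_add [sep_poly]:
  "separately_polynomial f \<Longrightarrow> separately_polynomial g \<Longrightarrow> separately_polynomial (\<lambda>x. f x + g x)"
  unfolding separately_polynomial_def by (metis poly_add)

lemma sep_poly_diff [sep_poly]:
  "separately_polynomial f \<Longrightarrow> separately_polynomial g \<Longrightarrow> separately_polynomial (\<lambda>x. f x - g x)"
  unfolding separately_polynomial_def by (metis poly_diff)

lemma sep_poly_mult [sep_poly]:
  "separately_polynomial f \<Longrightarrow> separately_polynomial g \<Longrightarrow> separately_polynomial (\<lambda>x. f x * g x)"
  unfolding separately_polynomial_def by (metis poly_mult)

lemma sep_poly_sum [sep_poly]:
  "(\<And>a. a \<in> X \<Longrightarrow> separately_polynomial (f a)) \<Longrightarrow> separately_polynomial (\<lambda>x. \<Sum>a\<in>X. f a x)"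
  by (induction X rule: infinite_finite_induct) (simp_all add: sep_poly)

lemma separately_polynomial_zero:
  assumes f: "separately_polynomial f" and I: "finite I"
    and zero: "\<And>k :: 'i \<Rightarrow> nat. \<And>x. (\<And>i. i \<in> I \<Longrightarrow> k i \<ge> 1) \<Longrightarrow> (\<And>i. i \<in> I \<Longrightarrow> x i = real (k i)) \<Longrightarrow> f x = 0"
  shows "f x = 0"
proof -
  have "\<forall>k. (\<forall>i\<in>I - J. k i \<ge> (1::nat) \<and> x i = real (k i)) \<longrightarrow> f x = 0" if "finite J" "J \<subseteq> I" for J x
    using that
  proof (induction J arbitrary: x)
    case empty
    then show ?case using zero by blast
  next
    case (insert j J)
    show ?case
    proof (intro allI impI)
      fix k assume k: "\<forall>i\<in>I - insert j J. k i \<ge> (1::nat) \<and> x i = real (k i)"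
      obtain q where q: "\<And>y. f (x(j := y)) = poly q y"
        using f unfolding separately_polynomial_def by blast
      have "poly q (real (Suc m)) = 0" for m
      proof -
        have "\<forall>i\<in>I - J. (k(j := Suc m)) i \<ge> 1 \<and> (x(j := real (Suc m))) i = real ((k(j := Suc m)) i)"
          using k by auto
        moreover have "J \<subseteq> I" using insert.prems by simp
        ultimately have "f (x(j := real (Suc m))) = 0"
          using insert.IH[of "x(j := real (Suc m))"] by metis
        then show ?thesis by (simp only: q)
      qed
      then have "(\<lambda>m. real (Suc m)) ` UNIV \<subseteq> {y. poly q y = 0}" by auto
      moreover have "infinite ((\<lambda>m. real (Suc m)) ` UNIV)"
        by (rule range_inj_infinite) (simp add: inj_def)
      ultimately have "q = 0" using poly_roots_finite finite_subset by blast
      then show "f x = 0" using q[of "x j"] by simp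
    qed
  qed
  from this[of I] I show ?thesis by blast
qed

lemma sep_poly_clique_walks [sep_poly]:
  assumes "\<And>r. separately_polynomial (\<lambda>x. B x r)"
  shows "separately_polynomial (\<lambda>x. clique_walks (B x) j i r)"
  by (induction j arbitrary: i r rule: induct_nat_012) (simp_all add: sep_poly assms)

lemma sep_poly_clique_trace [sep_poly]:
  assumes "\<And>r. separately_polynomial (\<lambda>x. B x r)" "\<And>r. separately_polynomial (\<lambda>x. T x r)"
  shows "separately_polynomial (\<lambda>x. clique_trace (B x) (T x) j i)"
  by (induction j arbitrary: i rule: induct_nat_012) (simp_all add: sep_poly assms)

lemma sep_poly_clique_row [sep_poly]:
  assumes "\<And>r. separately_polynomial (\<lambda>x. B x r)" "\<And>r. separately_polynomial (\<lambda>x. C x r)"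
  shows "separately_polynomial (\<lambda>x. clique_row (B x) (C x) j i)"
  by (induction j arbitrary: i rule: induct_nat_012) (simp_all add: sep_poly assms)

lemma sep_poly_cross_row [sep_poly]:
  assumes "\<And>r. separately_polynomial (\<lambda>x. D x r)" "\<And>r. separately_polynomial (\<lambda>x. B x r)"
    "\<And>r. separately_polynomial (\<lambda>x. C x r)"
  shows "separately_polynomial (\<lambda>x. cross_row (D x) (B x) (C x) j i)"
  by (induction j arbitrary: i rule: induct_nat_012) (simp_all add: sep_poly assms)

lemma sep_poly_split_closed_walks [sep_poly]:
  assumes "\<And>r. separately_polynomial (\<lambda>x. D x r)" "\<And>r. separately_polynomial (\<lambda>x. B x r)"
    "\<And>r. separately_polynomial (\<lambda>x. T x r)"
  shows "separately_polynomial (\<lambda>x. split_closed_walks (D x) (B x) (T x) j)"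
  by (induction j rule: induct_nat_012)
    (simp_all add: sep_poly assms del: clique_trace.simps)

lemma sep_poly_split_walks [sep_poly]:
  assumes "\<And>r. separately_polynomial (\<lambda>x. D x r)" "\<And>r. separately_polynomial (\<lambda>x. B x r)"
    "\<And>r. separately_polynomial (\<lambda>x. C x r)"
  shows "separately_polynomial (\<lambda>x. split_walks (D x) (B x) (C x) j)"
  by (cases j) (simp_all add: sep_poly assms del: clique_row.simps)

lemma sep_poly_walk_form [sep_poly]:
  assumes "\<And>r. separately_polynomial (\<lambda>x. W x r)"
  shows "separately_polynomial (\<lambda>x. walk_form (W x) w i r)"
proof (induction w arbitrary: i r)
  case (Cons b w)
  then show ?case by (cases b) (simp_all add: sep_poly assms)
qed (simp add: assms)

lemma sep_poly_word_trace [sep_poly]: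
  assumes "\<And>r. separately_polynomial (\<lambda>x. t x r)" "\<And>r. separately_polynomial (\<lambda>x. W x r)"
  shows "separately_polynomial (\<lambda>x. word_trace (t x) (W x) w r)"
proof (induction w arbitrary: r)
  case (Cons b w)
  then show ?case by (cases b) (simp_all add: sep_poly assms)
qed (simp add: assms)

lemma sep_poly_real_word_trace: "separately_polynomial (\<lambda>x. real_word_trace n x w)"
  unfolding real_word_trace_def
  by (intro sep_poly_word_trace sep_poly_split_closed_walks sep_poly_split_walks)
    (simp_all add: real_indep_moment_def real_clique_moment_def real_cross_moment_def
      real_trace_moment_def sep_poly)

subsection \<open>Prescribing finitely many moments\<close>

lemma sum_modules_upto:
  "(\<Sum>\<iota>\<in>modules_upto n. f \<iota>) = (\<Sum>p\<le>n. \<Sum>q\<le>n. f (False, p, q)) + (\<Sum>p\<le>n. \<Sum>q\<le>n. f (True, p, q))"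
  for f :: "module \<Rightarrow> real"
  unfolding modules_upto_def sum.cartesian_product' UNIV_bool by simp

text \<open>
  The moments of all modules are products \<open>w\<^sup>a d\<^sup>b\<close> up to constants, with \<open>a = b + 1\<close> for the clique,
  \<open>b = a + 1\<close> for the independent set and \<open>a = b\<close> for both the mixed and the trace moments. The last two
  are separated by combining the two kinds of modules.
\<close>

lemma real_moments_surjective:
  assumes "\<tau> 0 = \<beta> 0" "\<tau> 1 = \<gamma> 0"
  obtains x where "\<And>r. r \<le> n \<Longrightarrow> real_clique_moment (Suc n) x r = \<beta> r"
    "\<And>r. r \<le> n \<Longrightarrow> real_indep_moment (Suc n) x r = \<alpha> r"
    "\<And>r. r \<le> n \<Longrightarrow> real_cross_moment (Suc n) x r = \<gamma> r"
    "\<And>r. r \<le> n \<Longrightarrow> real_trace_moment (Suc n) x r = \<tau> r"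
proof -
  \<comment> \<open>the crown modules correct the traces; the factor vanishes for \<open>j = 1\<close> only\<close>
  define c1 where "c1 j = (if j \<ge> 2 then (\<tau> j - \<gamma> (j - 1)) / (2 - 4 ^ j / 2) else 0)" for j :: nat
  define c0 where "c0 j = (\<gamma> (j - 1) - 3 / 2 * 4 ^ j * c1 j) / 9 ^ j" for j :: nat
  obtain y :: "nat \<Rightarrow> nat \<Rightarrow> real" where y: "\<And>a b. a \<le> Suc n \<Longrightarrow> b \<le> Suc n \<Longrightarrow>
      (\<Sum>p\<le>Suc n. \<Sum>q\<le>Suc n. y p q * (real p ^ a * real q ^ b)) = (if a = b then c1 a else 0)"
    by (rule power_moments_surjective[of "Suc n" "\<lambda>a b. if a = b then c1 a else 0"]) blast
  obtain z :: "nat \<Rightarrow> nat \<Rightarrow> real" where z: "\<And>a b. a \<le> Suc n \<Longrightarrow> b \<le> Suc n \<Longrightarrow>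
      (\<Sum>p\<le>Suc n. \<Sum>q\<le>Suc n. z p q * (real p ^ a * real q ^ b))
      = (if a = b then c0 a else if a = Suc b then \<beta> b / (3 * 9 ^ b) else \<alpha> a / (3 * 9 ^ a))"
    by (rule power_moments_surjective[of "Suc n"
        "\<lambda>a b. if a = b then c0 a else if a = Suc b then \<beta> b / (3 * 9 ^ b) else \<alpha> a / (3 * 9 ^ a)"]) blast
  define x :: "module \<Rightarrow> real" where "x = (\<lambda>(e, p, q). if e then y p q else z p q)"
  have mono: "(\<Sum>\<iota>\<in>modules_upto (Suc n). x \<iota> * f \<iota>)
      = Cl * (if a = b then c0 a else if a = Suc b then \<beta> b / (3 * 9 ^ b) else \<alpha> a / (3 * 9 ^ a))
        + Cc * (if a = b then c1 a else 0)"
    if "\<And>p q. f (False, p, q) = Cl * (real p ^ a * real q ^ b)"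
      "\<And>p q. f (True, p, q) = Cc * (real p ^ a * real q ^ b)" "a \<le> Suc n" "b \<le> Suc n"
    for f Cl Cc a b
    unfolding y[OF that(3,4), symmetric] z[OF that(3,4), symmetric] sum_modules_upto sum_distrib_left x_def
    by (simp only: that(1,2) prod.case if_True if_False mult.left_commute)
  note defs = width_def depth_def valency_def defect_def power_mult_distrib power_mult[symmetric]
  have pow: "(2::real) ^ (2 * r) = 4 ^ r" "(3::real) ^ (2 * r) = 9 ^ r" for r
    by (simp_all add: power_mult)
  have "real_clique_moment (Suc n) x r = \<beta> r" if "r \<le> n" for r
    unfolding real_clique_moment_def
    by (subst mono[where Cl = "3 * 9 ^ r" and Cc = "3 * 4 ^ r" and a = "Suc r" and b = r])
      (use that in \<open>simp_all add: defs pow\<close>)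
  moreover have "real_indep_moment (Suc n) x r = \<alpha> r" if "r \<le> n" for r
    unfolding real_indep_moment_def
    by (subst mono[where Cl = "3 * 9 ^ r" and Cc = "3 * 4 ^ r" and a = r and b = "Suc r"])
      (use that in \<open>simp_all add: defs pow\<close>)
  moreover have "real_cross_moment (Suc n) x r = \<gamma> r" if "r \<le> n" for r
    unfolding real_cross_moment_def
    by (subst mono[where Cl = "9 * 9 ^ r" and Cc = "6 * 4 ^ r" and a = "Suc r" and b = "Suc r"])
      (use that in \<open>simp_all add: defs pow c0_def field_simps\<close>)
  moreover have "real_trace_moment (Suc n) x r = \<tau> r" if r: "r \<le> n" for r
  proof (cases r)
    case 0
    then have "real_trace_moment (Suc n) x r = real_clique_moment (Suc n) x 0"
      by (simp add: real_trace_moment_def real_clique_moment_def)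
    then show ?thesis using calculation(1)[of 0] 0 assms by simp
  next
    case (Suc m)
    have r0: "r \<noteq> 0" by (simp add: Suc)
    have "real_trace_moment (Suc n) x r = 9 ^ r * c0 r + (4 ^ r + 2) * c1 r"
      unfolding real_trace_moment_def
      by (subst mono[where Cl = "9 ^ r" and Cc = "4 ^ r + 2" and a = r and b = r])
        (use r r0 in \<open>simp_all add: defs pow\<close>)
    also have "\<dots> = \<gamma> m + (2 - 4 ^ r / 2) * c1 r"
      by (simp add: c0_def Suc field_simps)
    also have "\<dots> = \<tau> r"
    proof (cases m)
      case 0
      then show ?thesis using Suc assms by (simp add: c1_def)
    next
      case (Suc k)
      have "(4::real) ^ k \<ge> 1" by simp
      then have "1 < 4 * (4::real) ^ k" by linarith
      then have "2 - (4::real) ^ r / 2 < 0" by (simp add: \<open>r = Suc m\<close> Suc)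
      then have "2 - (4::real) ^ r / 2 \<noteq> 0" by linarith
      then show ?thesis by (simp add: c1_def \<open>r = Suc m\<close> Suc)
    qed
    finally show ?thesis .
  qed
  ultimately show ?thesis by (rule that) auto
qed

subsection \<open>Locality of the recursions\<close>

lemma clique_walks_cong:
  "(\<And>k. k \<le> i + r + j \<Longrightarrow> \<beta> k = \<beta>' k) \<Longrightarrow> clique_walks \<beta> j i r = clique_walks \<beta>' j i r"
  by (induction j arbitrary: i r rule: induct_nat_012) simp_all

lemma clique_trace_cong:
  "(\<And>k. k \<le> i + j \<Longrightarrow> \<beta> k = \<beta>' k) \<Longrightarrow> (\<And>k. k \<le> i + j \<Longrightarrow> \<tau> k = \<tau>' k) \<Longrightarrow>
    clique_trace \<beta> \<tau> j i = clique_trace \<beta>' \<tau>' j i"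
proof (induction j arbitrary: i rule: induct_nat_012)
  case (ge2 j)
  have "clique_walks \<beta> (Suc j) 0 i = clique_walks \<beta>' (Suc j) 0 i"
    by (rule clique_walks_cong) (simp add: ge2.prems)
  then show ?case using ge2 by simp
qed simp_all

lemma clique_row_cong:
  "(\<And>k. k \<le> r + j \<Longrightarrow> \<beta> k = \<beta>' k) \<Longrightarrow> (\<And>k. k \<le> r + j \<Longrightarrow> \<gamma> k = \<gamma>' k) \<Longrightarrow>
    clique_row \<beta> \<gamma> j r = clique_row \<beta>' \<gamma>' j r"
  by (induction j arbitrary: r rule: induct_nat_012) simp_all

lemma cross_row_cong:
  "(\<And>k. k \<le> r + j \<Longrightarrow> \<alpha> k = \<alpha>' k) \<Longrightarrow> (\<And>k. k \<le> r + j \<Longrightarrow> \<beta> k = \<beta>' k) \<Longrightarrow>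
    (\<And>k. k \<le> r + j \<Longrightarrow> \<gamma> k = \<gamma>' k) \<Longrightarrow> cross_row \<alpha> \<beta> \<gamma> j r = cross_row \<alpha>' \<beta>' \<gamma>' j r"
proof (induction j arbitrary: r rule: induct_nat_012)
  case (ge2 j)
  have "clique_row \<beta> \<gamma> (Suc j) 0 = clique_row \<beta>' \<gamma>' (Suc j) 0"
    by (rule clique_row_cong) (simp_all add: ge2.prems)
  then show ?case using ge2 by simp
qed simp_all

lemma split_closed_walks_cong:
  assumes "\<And>k. k \<le> j \<Longrightarrow> \<alpha> k = \<alpha>' k" "\<And>k. k \<le> j \<Longrightarrow> \<beta> k = \<beta>' k" "\<And>k. k \<le> j \<Longrightarrow> \<tau> k = \<tau>' k"
  shows "split_closed_walks \<alpha> \<beta> \<tau> j = split_closed_walks \<alpha>' \<beta>' \<tau>' j"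
proof (cases "(\<alpha>, \<beta>, \<tau>, j)" rule: split_closed_walks.cases)
  case (3 _ _ _ i)
  have "clique_trace \<beta> \<tau> (Suc (Suc i)) 0 = clique_trace \<beta>' \<tau>' (Suc (Suc i)) 0"
    "clique_trace \<beta> \<tau> i 1 = clique_trace \<beta>' \<tau>' i 1"
    by (rule clique_trace_cong; use assms 3 in auto)+
  then show ?thesis using 3 by (simp del: clique_trace.simps)
qed (simp_all add: assms)

lemma split_walks_cong:
  assumes "\<And>k. k \<le> j \<Longrightarrow> \<alpha> k = \<alpha>' k" "\<And>k. k \<le> j \<Longrightarrow> \<beta> k = \<beta>' k" "\<And>k. k \<le> j \<Longrightarrow> \<gamma> k = \<gamma>' k"
  shows "split_walks \<alpha> \<beta> \<gamma> j = split_walks \<alpha>' \<beta>' \<gamma>' j"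
proof (cases j)
  case (Suc i)
  have "clique_row \<beta> \<gamma> (Suc i) 0 = clique_row \<beta>' \<gamma>' (Suc i) 0"
    by (rule clique_row_cong) (simp_all add: assms Suc)
  moreover have "cross_row \<alpha> \<beta> \<gamma> i 0 = cross_row \<alpha>' \<beta>' \<gamma>' i 0"
    by (rule cross_row_cong) (simp_all add: assms Suc)
  ultimately show ?thesis using Suc by simp
qed (simp add: assms)

lemma walk_form_cong:
  "(\<And>k. k \<le> i + r + length w \<Longrightarrow> W k = W' k) \<Longrightarrow> walk_form W w i r = walk_form W' w i r"
  by (induction w arbitrary: i r) simp_all

lemma word_trace_cong:
  "(\<And>k. k \<le> r + length w \<Longrightarrow> t k = t' k) \<Longrightarrow> (\<And>k. k \<le> r + length w \<Longrightarrow> W k = W' k) \<Longrightarrow>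
    word_trace t W w r = word_trace t' W' w r"
proof (induction w arbitrary: r)
  case (Cons b w)
  have "walk_form W w 0 r = walk_form W' w 0 r"
    by (rule walk_form_cong) (simp add: Cons.prems)
  then show ?case using Cons by simp
qed simp

subsection \<open>No walk-realizable supporter\<close>

text \<open>
  Up to any given length, an arbitrary graph has the walk counts of a split graph with real
  multiplicities of modules.
\<close>

lemma walk_count_eq_real_word_trace:
  assumes "sgraph G"
  obtains x where "\<And>w. length w \<le> l \<Longrightarrow> walk_count w G = real_word_trace (Suc l) x w"
proof -
  interpret weighted_graph "pverts G" "edge_weight G" by (rule weighted_graph_edge_weight[OF assms])
  have square: "edge_weight G u v * edge_weight G u v = edge_weight G u v" for u v
    by (simp add: edge_weight_def)
  have A_point: "A (point v) u = edge_weight G u v" if "v \<in> pverts G" for u v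
    using that fin by (simp add: A_def point_def if_distrib cong: if_cong)
  have "closed_walks 0 = walks 0"
    by (simp add: closed_walks_def walks_def inner_def point_def indic_def)
  moreover have "closed_walks 1 = 0"
    using sgraph_arcs(4)[OF assms] by (simp add: closed_walks_def A_point edge_weight_def)
  moreover have "closed_walks 2 = walks 1"
  proof -
    have "closed_walks 2 = (\<Sum>v\<in>pverts G. \<Sum>w\<in>pverts G. edge_weight G v w * edge_weight G w v)"
      unfolding closed_walks_def numeral_2_eq_2 funpow.simps comp_apply id_apply
      by (intro sum.cong refl) (simp only: A_def[of "A _"] A_point)
    also have "\<dots> = (\<Sum>v\<in>pverts G. \<Sum>w\<in>pverts G. edge_weight G v w)"
      by (intro sum.cong refl) (metis sym square)
    also have "\<dots> = walks 1"
      by (simp add: walks_def inner_def A_def indic_def)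
    finally show ?thesis .
  qed
  ultimately obtain \<alpha> \<beta> \<gamma> \<tau> where m: "\<tau> 0 = \<beta> 0" "\<tau> 1 = \<gamma> 0"
    and real: "split_closed_walks \<alpha> \<beta> \<tau> = closed_walks" "split_walks \<alpha> \<beta> \<gamma> = walks"
    by (rule split_moments_realize_walks)
  obtain x where x: "\<And>r. r \<le> l \<Longrightarrow> real_clique_moment (Suc l) x r = \<beta> r"
    "\<And>r. r \<le> l \<Longrightarrow> real_indep_moment (Suc l) x r = \<alpha> r"
    "\<And>r. r \<le> l \<Longrightarrow> real_cross_moment (Suc l) x r = \<gamma> r"
    "\<And>r. r \<le> l \<Longrightarrow> real_trace_moment (Suc l) x r = \<tau> r"
    by (rule real_moments_surjective[of \<tau> \<beta> \<gamma> l \<alpha>, OF m]) blast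
  have "walk_count w G = real_word_trace (Suc l) x w" if "length w \<le> l" for w
    unfolding walk_count_eq_word_trace[OF assms] real[symmetric] real_word_trace_def
    using that by (intro word_trace_cong split_closed_walks_cong split_walks_cong) (simp_all add: x)
  then show ?thesis by (rule that)
qed

lemma real_word_trace_cong:
  assumes "\<And>\<iota>. \<iota> \<in> modules_upto n \<Longrightarrow> x \<iota> = y \<iota>"
  shows "real_word_trace n x = real_word_trace n y"
proof -
  have "real_clique_moment n x = real_clique_moment n y" "real_indep_moment n x = real_indep_moment n y"
    "real_cross_moment n x = real_cross_moment n y" "real_trace_moment n x = real_trace_moment n y"
    unfolding fun_eq_iff real_clique_moment_def real_indep_moment_def real_cross_moment_def
      real_trace_moment_def using assms by (auto intro!: sum.cong)
  then show ?thesis by (intro ext) (simp only: real_word_trace_def)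
qed

theorem walk_polynomial_zero_on_split_graphs:
  fixes a :: "bool list \<Rightarrow> real"
  assumes zero: "\<And>G. split_graph G \<Longrightarrow> (\<Sum>w | 1 \<le> length w \<and> length w \<le> l. a w * walk_count w G) = 0"
    and G: "sgraph G"
  shows "(\<Sum>w | 1 \<le> length w \<and> length w \<le> l. a w * walk_count w G) = 0"
proof -
  let ?ws = "{w. 1 \<le> length w \<and> length w \<le> l}"
  obtain x where x: "\<And>w. length w \<le> l \<Longrightarrow> walk_count w G = real_word_trace (Suc l) x w"
    by (rule walk_count_eq_real_word_trace[OF G]) blast
  let ?f = "\<lambda>x. \<Sum>w\<in>?ws. a w * real_word_trace (Suc l) x w"
  have "?f x = 0"
  proof (rule separately_polynomial_zero[where f = ?f and I = "modules_upto (Suc l)"])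
    show "separately_polynomial ?f"
      by (intro sep_poly_sum sep_poly_mult sep_poly_const sep_poly_real_word_trace)
    show "finite (modules_upto (Suc l))" by (simp add: modules_upto_def)
    fix k :: "module \<Rightarrow> nat" and y :: "module \<Rightarrow> real"
    assume k: "\<And>\<iota>. \<iota> \<in> modules_upto (Suc l) \<Longrightarrow> 1 \<le> k \<iota>"
      and y: "\<And>\<iota>. \<iota> \<in> modules_upto (Suc l) \<Longrightarrow> y \<iota> = real (k \<iota>)"
    obtain H where "split_graph H" "\<And>w. walk_count w H = real_word_trace (Suc l) (\<lambda>\<iota>. real (k \<iota>)) w"
      by (rule walk_count_module_ngraph[OF k]) auto
    then show "?f y = 0"
      using zero[of H] real_word_trace_cong[of "Suc l" y "\<lambda>\<iota>. real (k \<iota>)"] y by simp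
  qed
  then show ?thesis using x by simp
qed

text \<open>
  An induced subgraph of a split graph is free of the obstructions, so its coefficient is zero.
\<close>

lemma supporter_zero_on_split:
  assumes \<Phi>: "supporter split_obstructions l \<Phi>" and G: "split_graph G"
  shows "\<Phi> G = 0"
proof -
  obtain d :: "ngraph set \<Rightarrow> real" where
    sum: "\<And>G. sgraph G \<Longrightarrow> \<Phi> G = (\<Sum>c\<in>iso_classes_upto l. d c * real (ind (SOME H. H \<in> c) G))"
    and free: "\<And>H. sgraph H \<Longrightarrow> card (pverts H) \<le> l \<Longrightarrow> H \<in> Forb split_obstructions \<Longrightarrow> d (iso_class H) = 0"
    using \<Phi> unfolding supporter_def by blast
  have sG: "sgraph G" using G by (simp add: split_graph_def)
  have GF: "G \<in> Forb split_obstructions" by (rule split_imp_Forb[OF G])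
  have "d c * real (ind (SOME H. H \<in> c) G) = 0" if c: "c \<in> iso_classes_upto l" for c
  proof -
    obtain H where H: "sgraph H" "card (pverts H) \<le> l" "c = iso_class H"
      using c unfolding iso_classes_upto_def image_iff mem_Collect_eq by blast
    have "(SOME H. H \<in> c) \<in> c"
      using H graph_iso_refl[OF H(1)] by (intro someI[of "\<lambda>H. H \<in> c" H]) (simp add: iso_class_def)
    then have "H \<cong>\<^sub>g (SOME H. H \<in> c)" unfolding H(3) by (simp add: iso_class_def)
    then have ind: "ind (SOME H. H \<in> c) G = ind H G" using ind_cong_iso[OF H(1)] by metis
    show ?thesis
    proof (cases "H \<in> Forb split_obstructions")
      case True
      then show ?thesis using free[OF H(1,2)] H(3) by simp
    next
      case False
      then obtain F g where F: "F \<in> split_obstructions" "induced_embedding g F H"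
        using H(1) by (auto simp: Forb_split_obstructions_iff)
      have "\<not> (\<exists>U\<subseteq>pverts G. induced G U \<cong>\<^sub>g H)"
        unfolding induced_copy_iff_embedding[OF sG H(1)]
        using F induced_embedding_trans[OF F(2)] GF by (auto simp: Forb_split_obstructions_iff)
      then have "{U. U \<subseteq> pverts G \<and> induced G U \<cong>\<^sub>g H} = {}" by blast
      then have "ind H G = 0" by (simp only: ind_def card.empty)
      then show ?thesis using ind by simp
    qed
  qed
  then show ?thesis unfolding sum[OF sG] by (intro sum.neutral ballI)
qed

lemma supporter_pos_two_K2:
  assumes \<Phi>: "supporter split_obstructions l \<Phi>" and l: "l \<ge> 4"
  shows "\<Phi> two_K2 > 0"
proof -
  obtain d :: "ngraph set \<Rightarrow> real" where
    sum: "\<And>G. sgraph G \<Longrightarrow> \<Phi> G = (\<Sum>c\<in>iso_classes_upto l. d c * real (ind (SOME H. H \<in> c) G))"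
    and nonneg: "\<And>c. c \<in> iso_classes_upto l \<Longrightarrow> d c \<ge> 0" and pos: "d (iso_class two_K2) > 0"
    using \<Phi> unfolding supporter_def split_obstructions_def by blast
  let ?c = "iso_class two_K2"
  have "two_K2 \<in> ?c" using sgraph_two_K2 graph_iso_refl by (simp add: iso_class_def)
  then have "(SOME H. H \<in> ?c) \<in> ?c" by (rule someI)
  then have "two_K2 \<cong>\<^sub>g (SOME H. H \<in> ?c)" by (simp add: iso_class_def)
  then have ind: "ind (SOME H. H \<in> ?c) two_K2 = ind two_K2 two_K2"
    using ind_cong_iso[OF sgraph_two_K2] by metis
  have "induced two_K2 (pverts two_K2) = two_K2" by (simp add: induced_def two_K2_def)
  then have "pverts two_K2 \<in> {U. U \<subseteq> pverts two_K2 \<and> induced two_K2 U \<cong>\<^sub>g two_K2}"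
    using graph_iso_refl[OF sgraph_two_K2] by simp
  moreover have "finite {U. U \<subseteq> pverts two_K2 \<and> induced two_K2 U \<cong>\<^sub>g two_K2}"
    by (rule finite_subset[of _ "Pow (pverts two_K2)"]) (auto simp: pverts_simps)
  ultimately have "ind two_K2 two_K2 > 0" unfolding ind_def card_gt_0_iff by blast
  then have "d ?c * real (ind (SOME H. H \<in> ?c) two_K2) > 0" using pos ind by simp
  moreover have "?c \<in> iso_classes_upto l"
    using l sgraph_two_K2 by (auto simp: iso_classes_upto_def pverts_simps)
  ultimately show ?thesis
    unfolding sum[OF sgraph_two_K2]
    using nonneg finite_iso_classes_upto by (intro sum_pos2[of _ ?c]) auto
qed

theorem no_walk_realizable_supporter:
  assumes "l \<ge> 5" "supporter split_obstructions l \<Phi>"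
  shows "\<not> walk_realizable l \<Phi>"
proof
  assume "walk_realizable l \<Phi>"
  then obtain a where a: "\<And>G. sgraph G \<Longrightarrow>
      \<Phi> G = (\<Sum>w | 1 \<le> length w \<and> length w \<le> l. a w * walk_count w G)"
    unfolding walk_realizable_def by blast
  have "(\<Sum>w | 1 \<le> length w \<and> length w \<le> l. a w * walk_count w G) = 0" if "split_graph G" for G
    using supporter_zero_on_split[OF assms(2) that] a[of G] that by (simp add: split_graph_def)
  then have "\<Phi> two_K2 = 0"
    using walk_polynomial_zero_on_split_graphs[where l = l and a = a and G = two_K2] sgraph_two_K2 a by simp
  then show False using supporter_pos_two_K2[OF assms(2)] assms(1) by simp
qed

section \<open>Spectral closedness without a walk-realizable supporter\<close>

theorem theorem1p3:
  "(Forb split_obstructions = {G. split_graph G} \<and>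
      generalized_spectrally_closed (Forb split_obstructions)) \<and>
   \<not> (\<exists>l :: nat. l \<ge> 5 \<and>
        (\<exists>\<Phi>. supporter split_obstructions l \<Phi> \<and> walk_realizable l \<Phi>))"
  using Foeldes_Hammer split_graphs_generalized_spectrally_closed no_walk_realizable_supporter
  by (simp only: simp_thms) blast

end
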